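(* Let $\Omega$ be an open, bounded and connected subset of $\mathbb{R}^N$ having Lipschitz boundary and satisfying the uniform interior sphere condition. Let $a:\Omega\times\mathbb{R}\times\mathbb{R}^N\to\mathbb{R}^N$ be a Carathéodory function satisfying, for some $\beta>0$, $$|a(x,s,\xi)|\leq \beta(1+|\xi|)\qquad \text{for all } (s,\xi)\in\mathbb{R}\times\mathbb{R}^N,\ \text{for a.e. } x\in\Omega.$$ Let $p>2$, $\lambda\geq 0$, and let $f\in L^q(\Omega)$ for some $q\ge 1$ with $q>\frac{N}{p}$. Let $u\in W^{1,p}_{\rm loc}(\Omega)$ be such that $\lambda u^-\in L^q(\Omega)$ and such that the inequality $$\lambda u+|\nabla u|^p\leq \operatorname{div}(a(x,u,\nabla u))+f(x)\qquad\text{in }\Omega$$ is satisfied in the sense of distributions. Then $u$ is Hölder continuous in $\overline\Omega$ (i.e., up to the boundary) and satisfies $$|u(x)-u(y)|\leq K|x-y|^\alpha\qquad\text{for all }x,y\in\overline\Omega,$$ where $\alpha=\min\left(1-\frac{N}{pq},\,1-\frac{1}{p-1}\right)$ and $K$ depends on $p$, $q$, $N$, $\beta$, $\Omega$, $\|f\|_{L^q(\Omega)}$ and $\|\lambda u^-\|_{L^q(\Omega)}$.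
   Context: Carathéodory function: measurable in $x$ for every fixed $(s,\xi)$ and continuous in $(s,\xi)$ for a.e. $x$. $u^+=\max\{u,0\}$, $u^-=\max\{-u,0\}$. The inequality holds in the sense of distributions if for every $\varphi\in C^\infty_0(\Omega)$ (smooth, compactly supported) with $\varphi\ge0$, $$\int_\Omega a(x,u,\nabla u)\cdot\nabla\varphi\,dx+\lambda\int_\Omega u\,\varphi\,dx+\int_\Omega|\nabla u|^p\varphi\,dx\leq\int_\Omega f\varphi\,dx.$$ Uniform interior sphere condition: there is $r>0$ such that every $x_0\in\partial\Omega$ lies on the boundary of some ball of radius $r$ contained in $\Omega$. Hölder continuity in $\overline\Omega$ is understood for the continuous representative of $u$, extended by continuity to $\overline\Omega$. *)

theory Defs
  imports "HOL-Analysis.Analysis"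
begin

section \<open>Smooth functions and test functions\<close>

primrec C_k :: "nat \<Rightarrow> ('a::real_normed_vector \<Rightarrow> real) \<Rightarrow> bool" where
  "C_k 0 f \<longleftrightarrow> continuous_on UNIV f"
| "C_k (Suc k) f \<longleftrightarrow>
     (\<forall>x. f differentiable (at x)) \<and> (\<forall>v. C_k k (\<lambda>x. frechet_derivative f (at x) v))"

definition smooth :: "('a::real_normed_vector \<Rightarrow> real) \<Rightarrow> bool" where
  "smooth f \<longleftrightarrow> (\<forall>k. C_k k f)"

text \<open>Elements of \<open>C\<^sub>0\<^sup>\<infinity>(\<Omega>)\<close> are represented by their extension by zero to the whole space.\<close>

definition test_functions :: "'a::euclidean_space set \<Rightarrow> ('a \<Rightarrow> real) set" where
  "test_functions \<Omega> = {\<phi>. smooth \<phi> \<and> compact (closure {x. \<phi> x \<noteq> 0}) \<and> closure {x. \<phi> x \<noteq> 0} \<subseteq> \<Omega>}"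

definition grad :: "('a::real_inner \<Rightarrow> real) \<Rightarrow> 'a \<Rightarrow> 'a" where
  "grad \<phi> x = (THE D. GDERIV \<phi> x :> D)"

section \<open>Lebesgue and Sobolev spaces\<close>

text \<open>The spaces consist of functions rather than of classes modulo null sets. Only
  \<open>1 \<le> p < \<infinity>\<close> is relevant, and values outside of the domain do not matter.\<close>

definition Lp :: "real \<Rightarrow> 'a::euclidean_space set \<Rightarrow> ('a \<Rightarrow> 'b::euclidean_space) set" where
  "Lp p \<Omega> = {f. f \<in> borel_measurable (lebesgue_on \<Omega>) \<and>
                 integrable (lebesgue_on \<Omega>) (\<lambda>x. norm (f x) powr p)}"

definition Lp_norm :: "real \<Rightarrow> 'a::euclidean_space set \<Rightarrow> ('a \<Rightarrow> 'b::euclidean_space) \<Rightarrow> real" where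
  "Lp_norm p \<Omega> f = (\<integral>x. norm (f x) powr p \<partial>lebesgue_on \<Omega>) powr (1 / p)"

definition Lp_loc :: "real \<Rightarrow> 'a::euclidean_space set \<Rightarrow> ('a \<Rightarrow> 'b::euclidean_space) set" where
  "Lp_loc p \<Omega> = {f. \<forall>C. compact C \<longrightarrow> C \<subseteq> \<Omega> \<longrightarrow> f \<in> Lp p C}"

definition has_weak_gradient ::
  "'a::euclidean_space set \<Rightarrow> ('a \<Rightarrow> real) \<Rightarrow> ('a \<Rightarrow> 'a) \<Rightarrow> bool" where
  "has_weak_gradient \<Omega> u Du \<longleftrightarrow>
     u \<in> Lp_loc 1 \<Omega> \<and> Du \<in> Lp_loc 1 \<Omega> \<and>
     (\<forall>\<phi> \<in> test_functions \<Omega>.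
        (\<integral>x. u x *\<^sub>R grad \<phi> x \<partial>lebesgue_on \<Omega>) = - (\<integral>x. \<phi> x *\<^sub>R Du x \<partial>lebesgue_on \<Omega>))"

text \<open>\<open>u \<in> W\<^sup>1\<^sup>,\<^sup>p\<^sub>l\<^sub>o\<^sub>c(\<Omega>)\<close>, where \<open>Du\<close> is any representative of the weak gradient
  (which is unique up to null sets).\<close>

definition W1p_loc ::
  "real \<Rightarrow> 'a::euclidean_space set \<Rightarrow> ('a \<Rightarrow> real) \<Rightarrow> ('a \<Rightarrow> 'a) \<Rightarrow> bool" where
  "W1p_loc p \<Omega> u Du \<longleftrightarrow> has_weak_gradient \<Omega> u Du \<and> u \<in> Lp_loc p \<Omega> \<and> Du \<in> Lp_loc p \<Omega>"

section \<open>Regularity of the domain\<close>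

text \<open>Near each boundary point, \<open>\<Omega>\<close> is, in a suitable orthonormal coordinate system, the strict
  epigraph of a Lipschitz function. Here \<open>e\<close> is the direction of the last coordinate axis, and the
  remaining coordinates of \<open>x\<close> are encoded by its projection onto the hyperplane orthogonal
  to \<open>e\<close>. In dimension one that hyperplane is \<open>{0}\<close>.\<close>

definition lipschitz_boundary :: "'a::euclidean_space set \<Rightarrow> bool" where
  "lipschitz_boundary \<Omega> \<longleftrightarrow>
     (\<forall>x0 \<in> frontier \<Omega>. \<exists>r>0. \<exists>e L \<gamma>. norm e = 1 \<and> L-lipschitz_on {y. y \<bullet> e = 0} \<gamma> \<and>
        \<Omega> \<inter> ball x0 r = {x \<in> ball x0 r. \<gamma> (x - (x \<bullet> e) *\<^sub>R e) < x \<bullet> e})"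

definition uniform_interior_sphere :: "'a::euclidean_space set \<Rightarrow> bool" where
  "uniform_interior_sphere \<Omega> \<longleftrightarrow>
     (\<exists>r>0. \<forall>x0 \<in> frontier \<Omega>. \<exists>c. x0 \<in> sphere c r \<and> ball c r \<subseteq> \<Omega>)"

section \<open>The differential inequality\<close>

definition caratheodory ::
  "'a::euclidean_space set \<Rightarrow> ('a \<Rightarrow> real \<Rightarrow> 'a \<Rightarrow> 'a) \<Rightarrow> bool" where
  "caratheodory \<Omega> a \<longleftrightarrow>
     (\<forall>s \<xi>. (\<lambda>x. a x s \<xi>) \<in> borel_measurable (lebesgue_on \<Omega>)) \<and>
     (AE x in lebesgue_on \<Omega>. continuous_on UNIV (\<lambda>(s, \<xi>). a x s \<xi>))"

text \<open>\<open>\<lambda>u + |\<nabla>u|\<^sup>p \<le> div (a(x, u, \<nabla>u)) + f\<close> in the sense of distributions. Bochner integrals of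
  non-integrable functions are \<open>0\<close>, but this never occurs if \<open>\<Omega>\<close> is open, \<open>p \<ge> 1\<close>,
  \<open>W1p_loc p \<Omega> u Du\<close>, \<open>f \<in> Lp q \<Omega>\<close> with \<open>q \<ge> 1\<close>, and \<open>a\<close> is a Caratheodory function with
  at most linear growth in its last argument.\<close>

definition distributional_ineq ::
  "'a::euclidean_space set \<Rightarrow> ('a \<Rightarrow> real \<Rightarrow> 'a \<Rightarrow> 'a) \<Rightarrow> real \<Rightarrow> real \<Rightarrow> ('a \<Rightarrow> real) \<Rightarrow>
   ('a \<Rightarrow> real) \<Rightarrow> ('a \<Rightarrow> 'a) \<Rightarrow> bool" where
  "distributional_ineq \<Omega> a l p f u Du \<longleftrightarrow>
     (\<forall>\<phi> \<in> test_functions \<Omega>. (\<forall>x. 0 \<le> \<phi> x) \<longrightarrow>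
        (\<integral>x. a x (u x) (Du x) \<bullet> grad \<phi> x \<partial>lebesgue_on \<Omega>)
        + l * (\<integral>x. u x * \<phi> x \<partial>lebesgue_on \<Omega>)
        + (\<integral>x. norm (Du x) powr p * \<phi> x \<partial>lebesgue_on \<Omega>)
        \<le> (\<integral>x. f x * \<phi> x \<partial>lebesgue_on \<Omega>))"

end

theory Submission
  imports Defs
begin

text \<open>
  Testing the inequality with the square of a bump supported in \<open>cball x (2 * t)\<close> and absorbing
  \<open>a \<cdot> \<nabla>\<phi>\<close> by Young's inequality (this is where \<open>p > 2\<close> makes a square sufficient) yields
  \<open>\<integral> |\<nabla>u| \<le> M t\<^bsup>N - 1 + \<alpha>\<^esup>\<close> over \<open>cball x t\<close> whenever \<open>cball x (2 * t) \<subseteq> \<Omega>\<close>.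
  Let \<open>F(x, t)\<close> be the mollification of \<open>u\<close> at \<open>x\<close> and scale \<open>t\<close>. The \<open>(x, t)\<close>-derivative of the
  mollification kernel in any direction is a divergence in the integration variable, so
  \<open>|\<nabla>F(x, t)| \<le> C M t\<^bsup>\<alpha> - 1\<^esup>\<close>, which is integrable along the segments
  \<open>\<tau> \<mapsto> (x + \<tau> e, c \<tau>)\<close>. Near a point of the Lipschitz boundary one direction \<open>e\<close> can be used for all
  \<open>x\<close>, since \<open>\<Omega>\<close> contains the corresponding cones; joining two points \<open>x, y\<close> at height
  \<open>\<tau> \<sim> |x - y|\<close> gives the Hoelder estimate up to the boundary. Compactness of the
  closure and connectedness make it global.
\<close>

section \<open>Smooth bump functions\<close>

text \<open>Since p \<le> N is allowed, membership in the Sobolev space alone gives no continuity;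
  it has to come from decay of the energy. On a ball of radius t the data contribute t^(N - N / q)
  and the vector field t^(N - p') with p' = p / (p - 1). Writing the smaller exponent as N - p + p
  \<alpha> produces exactly the stated \<alpha>, and passing to the integral of |Du| turns it into N
  - 1 + \<alpha>.

  Paths in the half space of pairs (x, t) avoid them: the scale shrinks in proportion to the
  distance still to be travelled, so every kernel used stays inside \<Omega>.

  \<open>K\<close> may see f and u only through two norms. Constants are therefore chosen before u
  throughout, and the local-to-global step is stated for a whole family of functions. The limits at
  scale 0 are matched with u by applying Fubini's theorem on boxes.\<close>

lemma C_k_SucI:
  fixes f :: "'a::real_normed_vector \<Rightarrow> real"
  assumes "\<And>x. (f has_derivative f' x) (at x)" and "\<And>v. C_k k (\<lambda>x. f' x v)"
  shows "C_k (Suc k) f"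
proof -
  have "frechet_derivative f (at x) = f' x" for x
    using frechet_derivative_at[OF assms(1)] by metis
  then show ?thesis
    using assms by (auto simp: differentiable_def)
qed

lemma C_k_SucD:
  fixes f :: "'a::real_normed_vector \<Rightarrow> real"
  assumes "C_k (Suc k) f"
  shows "(f has_derivative frechet_derivative f (at x)) (at x)"
    and "C_k k (\<lambda>x. frechet_derivative f (at x) v)"
  using assms by (auto simp: frechet_derivative_works)

lemma C_k_Suc_imp: "C_k (Suc k) f \<Longrightarrow> C_k k f"
proof (induction k arbitrary: f)
  case 0
  then have "f differentiable (at x)" for x
    by simp
  then show ?case
    by (simp add: continuous_at_imp_continuous_on differentiable_imp_continuous_within)
next
  case (Suc k)
  then show ?case
    by (metis C_k.simps(2))
qed

lemma C_k_const: "C_k k (\<lambda>x. c)"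
proof (induction k arbitrary: c)
  case (Suc k)
  show ?case
    by (rule C_k_SucI[where f' = "\<lambda>_ _. 0"]) (auto intro: Suc)
qed simp

lemma C_k_bounded_linear: "bounded_linear f \<Longrightarrow> C_k k f"
proof (cases k)
  case 0
  assume "bounded_linear f"
  then show ?thesis
    using 0 by (simp add: linear_continuous_on)
next
  case (Suc j)
  assume "bounded_linear f"
  then show ?thesis
    unfolding Suc by (intro C_k_SucI[where f' = "\<lambda>_. f"] bounded_linear_imp_has_derivative C_k_const)
qed

lemma C_k_add: "C_k k f \<Longrightarrow> C_k k g \<Longrightarrow> C_k k (\<lambda>x. f x + g x)"
proof (induction k arbitrary: f g)
  case 0
  then show ?case by (simp add: continuous_on_add)
next
  case (Suc k)
  show ?case
    by (rule C_k_SucI[OF has_derivative_add[OF C_k_SucD(1)[OF Suc.prems(1)] C_k_SucD(1)[OF Suc.prems(2)]]])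
      (intro Suc.IH C_k_SucD(2)[OF Suc.prems(1)] C_k_SucD(2)[OF Suc.prems(2)])
qed

lemma C_k_mult: "C_k k f \<Longrightarrow> C_k k g \<Longrightarrow> C_k k (\<lambda>x. f x * g x)"
proof (induction k arbitrary: f g)
  case 0
  then show ?case by (simp add: continuous_on_mult)
next
  case (Suc k)
  show ?case
    by (rule C_k_SucI[OF has_derivative_mult[OF C_k_SucD(1)[OF Suc.prems(1)] C_k_SucD(1)[OF Suc.prems(2)]]])
      (intro C_k_add Suc.IH C_k_Suc_imp[OF Suc.prems(1)] C_k_Suc_imp[OF Suc.prems(2)]
        C_k_SucD(2)[OF Suc.prems(1)] C_k_SucD(2)[OF Suc.prems(2)])
qed

text \<open>The powers of \<open>1 / s\<close> are included because the family is then closed under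
  differentiation up to linear combinations.\<close>

definition flat_exp :: "nat \<Rightarrow> real \<Rightarrow> real" where
  "flat_exp n s = (if s > 0 then inverse s ^ n * exp (- inverse s) else 0)"

lemma flat_exp_nonneg: "0 \<le> flat_exp n s"
  by (simp add: flat_exp_def)

lemma tendsto_flat_exp_0: "(flat_exp n \<longlongrightarrow> 0) (at 0)"
proof -
  have "((\<lambda>x::real. x ^ n / exp x) \<longlongrightarrow> 0) at_top"
    by (rule tendsto_power_div_exp_0)
  then have "((\<lambda>s::real. inverse s ^ n / exp (inverse s)) \<longlongrightarrow> 0) (at_right 0)"
    using filterlim_inverse_at_top_right by (rule filterlim_compose)
  moreover have "\<forall>\<^sub>F s in at_right 0. inverse s ^ n / exp (inverse s) = flat_exp n s"
    by (auto simp: eventually_at_filter flat_exp_def exp_minus divide_inverse)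
  ultimately have "(flat_exp n \<longlongrightarrow> 0) (at_right 0)"
    by (simp add: tendsto_cong)
  moreover have "(flat_exp n \<longlongrightarrow> 0) (at_left 0)"
    by (rule tendsto_eventually) (auto simp: eventually_at_filter flat_exp_def)
  ultimately show ?thesis
    by (simp add: filterlim_split_at)
qed

lemma DERIV_flat_exp:
  "(flat_exp n has_real_derivative flat_exp (n + 2) s - real n * flat_exp (n + 1) s) (at s)"
proof -
  consider "s > 0" | "s < 0" | "s = 0" by linarith
  then show ?thesis
  proof cases
    case 1
    have "((\<lambda>s. inverse s ^ n * exp (- inverse s)) has_real_derivative
        flat_exp (n + 2) s - real n * flat_exp (n + 1) s) (at s)"
      using 1 power_eq_if[of s "n - 1"] by (cases n) (auto intro!: derivative_eq_intros simp: flat_exp_def field_simps power2_eq_square)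
    moreover have "\<forall>\<^sub>F y in nhds s. inverse y ^ n * exp (- inverse y) = flat_exp n y"
      using eventually_nhds_in_open[of "{0<..}" s] 1
      by (auto elim!: eventually_mono simp: flat_exp_def)
    ultimately show ?thesis
      by (rule DERIV_cong_ev[THEN iffD1, OF refl _ refl, rotated])
  next
    case 2
    have "((\<lambda>s. 0) has_real_derivative flat_exp (n + 2) s - real n * flat_exp (n + 1) s) (at s)"
      using 2 by (simp add: flat_exp_def)
    moreover have "\<forall>\<^sub>F y in nhds s. 0 = flat_exp n y"
      using eventually_nhds_in_open[of "{..<0}" s] 2
      by (auto elim!: eventually_mono simp: flat_exp_def)
    ultimately show ?thesis
      by (rule DERIV_cong_ev[THEN iffD1, OF refl _ refl, rotated])
  next
    case 3
    \<comment> \<open>At 0 the difference quotient of \<open>flat_exp n\<close> is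
      \<open>flat_exp (Suc n)\<close> itself, as division by h only raises the power of 1 / h. The
      limit known for every exponent then gives the derivative 0.\<close>
    have "\<forall>\<^sub>F h in at 0. flat_exp (Suc n) h = (flat_exp n (0 + h) - flat_exp n 0) / h"
      by (auto simp: eventually_at_filter flat_exp_def field_simps)
    with tendsto_flat_exp_0[of "Suc n"] show ?thesis
      unfolding 3 DERIV_def by (simp add: tendsto_cong flat_exp_def)
  qed
qed

lemma continuous_on_flat_exp [continuous_intros]:
  "continuous_on S f \<Longrightarrow> continuous_on S (\<lambda>x. flat_exp n (f x))"
  by (rule continuous_on_compose2[of UNIV])
    (auto intro!: DERIV_continuous_on DERIV_flat_exp)

text \<open>With x = 1 / s, the quotient x^n / n! is a single term of the exponential series at a
  positive point. The explicit value matters for n = 0 and n = 2: it bounds the bump by 1 and the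
  factor in its gradient by 2.\<close>

lemma flat_exp_bound: "flat_exp n s \<le> fact n"
proof (cases "s > 0")
  case True
  define x where "x = inverse s"
  have "x ^ n / fact n \<le> exp x"
  proof -
    have *: "(\<lambda>k. x ^ k / fact k) sums exp x"
      using exp_converges[of x] by (simp add: divide_inverse mult.commute)
    have "(\<Sum>k\<in>{n}. x ^ k / fact k) \<le> (\<Sum>k. x ^ k / fact k)"
      by (rule sum_le_suminf) (use * True in \<open>auto simp: x_def sums_iff\<close>)
    with * show ?thesis
      by (simp add: sums_iff)
  qed
  then have "x ^ n * exp (- x) \<le> fact n"
    by (simp add: exp_minus field_simps)
  with True show ?thesis
    by (simp add: flat_exp_def x_def)
qed (simp add: flat_exp_def)

text \<open>Differentiation replaces \<open>n\<close> by \<open>n + 1\<close> and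
  \<open>n + 2\<close>, so the induction on the order of smoothness has to carry all
  \<open>n\<close> at once.\<close>

lemma C_k_flat_exp_comp:
  fixes P :: "'a::real_normed_vector \<Rightarrow> real"
  assumes "\<And>k. C_k k P"
  shows "C_k k (\<lambda>x. flat_exp n (P x))"
proof (induction k arbitrary: n)
  case 0
  then show ?case
    using assms[of 0] by (simp add: continuous_on_flat_exp)
next
  case (Suc k)
  have P: "(P has_derivative frechet_derivative P (at x)) (at x)" for x
    by (rule C_k_SucD(1)[OF assms])
  show ?case
  proof (rule C_k_SucI)
    show "((\<lambda>x. flat_exp n (P x)) has_derivative
        (\<lambda>v. (flat_exp (n + 2) (P x) + (- real n) * flat_exp (n + 1) (P x)) * frechet_derivative P (at x) v)) (at x)" for x
      using has_derivative_compose[OF P[of x] DERIV_flat_exp[of n "P x", unfolded has_field_derivative_def]]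
      by simp
    show "C_k k (\<lambda>x. (flat_exp (n + 2) (P x) + (- real n) * flat_exp (n + 1) (P x)) * frechet_derivative P (at x) v)" for v
      by (intro C_k_mult C_k_add C_k_const Suc C_k_SucD(2)[OF assms])
  qed
qed

lemma grad_eqI: "GDERIV f x :> D \<Longrightarrow> grad f x = D"
  unfolding grad_def gderiv_def
proof (rule the_equality)
  fix E
  assume "(f has_derivative (\<lambda>h. h \<bullet> D)) (at x)" "(f has_derivative (\<lambda>h. h \<bullet> E)) (at x)"
  then have "(\<lambda>h. h \<bullet> D) = (\<lambda>h. h \<bullet> E)"
    by (rule has_derivative_unique)
  then show "E = D"
    by (metis vector_eq_ldot)
qed

text \<open>For \<open>n = 0\<close> this is the standard bump exp (- 1 / (1 - |z|^2 / t^2)); the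
  other \<open>n\<close> are what its derivatives produce, up to smooth factors. Using
  \<open>z \<bullet> z\<close> in place of the norm keeps the argument smooth at the origin.\<close>

definition bump :: "nat \<Rightarrow> real \<Rightarrow> 'a::euclidean_space \<Rightarrow> real" where
  "bump n t z = flat_exp n (1 - (z \<bullet> z) / t\<^sup>2)"

lemma bump_nonneg: "0 \<le> bump n t z"
  by (simp add: bump_def flat_exp_nonneg)

lemma bump_le: "bump n t z \<le> fact n"
  by (simp add: bump_def flat_exp_bound)

lemma bump_eq_0:
  assumes "t > 0" "norm z \<ge> t"
  shows "bump n t z = 0"
proof -
  have "t\<^sup>2 \<le> z \<bullet> z"
    using assms by (simp add: dot_square_norm power_mono)
  then show ?thesis
    using assms by (simp add: bump_def flat_exp_def)
qed

text \<open>The free factor \<open>g\<close> serves two kinds of test functions: a second bump, for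
  the square in the energy estimate, and an affine function, for the components of the vector field
  whose divergence is the kernel derivative.\<close>

lemma smooth_bump_mult:
  fixes x :: "'a::euclidean_space"
  assumes "\<And>k. C_k k g"
  shows "smooth (\<lambda>y. bump n t (x - y) * g y)"
proof -
  have C: "C_k k (\<lambda>y. 1 - ((x - y) \<bullet> (x - y)) / t\<^sup>2)" for k
  proof (cases k)
    case 0
    then show ?thesis by (auto intro!: continuous_intros simp: divide_inverse)
  next
    case (Suc j)
    show ?thesis
      unfolding Suc
    proof (rule C_k_SucI)
      show "((\<lambda>y. 1 - ((x - y) \<bullet> (x - y)) / t\<^sup>2) has_derivative
          (\<lambda>v. 2 / t\<^sup>2 * (x \<bullet> v) + (- 2 / t\<^sup>2) * (y \<bullet> v))) (at y)" for y
        by (auto intro!: derivative_eq_intros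
            simp: divide_inverse inner_diff_left inner_diff_right inner_commute algebra_simps)
      show "C_k j (\<lambda>y. 2 / t\<^sup>2 * (x \<bullet> v) + (- 2 / t\<^sup>2) * (y \<bullet> v))" for v
        by (intro C_k_add C_k_mult C_k_const C_k_bounded_linear bounded_linear_inner_left)
    qed
  qed
  show ?thesis
    unfolding smooth_def bump_def
    by (intro allI C_k_mult C_k_flat_exp_comp[OF C] assms)
qed

lemma test_functions_bump_mult:
  fixes x :: "'a::euclidean_space"
  assumes "\<And>k. C_k k g" "t > 0" "cball x t \<subseteq> \<Omega>"
  shows "(\<lambda>y. bump n t (x - y) * g y) \<in> test_functions \<Omega>"
proof -
  have "{y. bump n t (x - y) * g y \<noteq> 0} \<subseteq> cball x t"
    using bump_eq_0[OF assms(2), where 'a = 'a, of "x - _" n] by (force simp: dist_norm not_le)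
  then have *: "closure {y. bump n t (x - y) * g y \<noteq> 0} \<subseteq> cball x t"
    by (simp add: closure_minimal)
  have "bounded (closure {y. bump n t (x - y) * g y \<noteq> 0})"
    by (rule bounded_subset[OF bounded_cball *])
  then have "compact (closure {y. bump n t (x - y) * g y \<noteq> 0})"
    by (simp only: compact_eq_bounded_closed closed_closure simp_thms)
  with * show ?thesis
    using assms smooth_bump_mult[OF assms(1), of n t x] by (auto simp: test_functions_def)
qed

text \<open>The derivative is joint in \<open>z\<close> and \<open>t\<close> because the later paths
  move the centre and the scale of the kernel simultaneously.\<close>

lemma has_derivative_bump:
  fixes z :: "'a::euclidean_space"
  assumes "t > 0"
  shows "((\<lambda>(z, t). bump n t z) has_derivative
    (\<lambda>(v, w). (bump (n + 2) t z - real n * bump (n + 1) t z) *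
       (2 * (z \<bullet> z) * w / t ^ 3 - 2 * (z \<bullet> v) / t\<^sup>2))) (at (z, t))"
proof -
  define P where "P = (\<lambda>y :: 'a \<times> real. 1 - (fst y \<bullet> fst y) / (snd y)\<^sup>2)"
  have P: "(P has_derivative
    (\<lambda>y. 2 * (z \<bullet> z) * snd y / t ^ 3 - 2 * (z \<bullet> fst y) / t\<^sup>2)) (at (z, t))"
  proof -
    have "((\<lambda>y :: 'a \<times> real. fst y \<bullet> fst y) has_derivative (\<lambda>y. 2 * (z \<bullet> fst y))) (at (z, t))"
      by (auto intro!: derivative_eq_intros simp: inner_commute)
    moreover have "((\<lambda>y :: 'a \<times> real. (snd y)\<^sup>2) has_derivative (\<lambda>y. 2 * t * snd y)) (at (z, t))"
      by (auto intro!: derivative_eq_intros simp: power2_eq_square)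
    ultimately have "(P has_derivative (\<lambda>y. 0 - (2 * (z \<bullet> fst y) * t\<^sup>2 - (z \<bullet> z) * (2 * t * snd y)) / (t\<^sup>2 * t\<^sup>2)))
        (at (z, t))"
      unfolding P_def using assms
      by (intro has_derivative_diff has_derivative_const has_derivative_divide'[THEN has_derivative_eq_rhs]) auto
    moreover have "0 - (2 * a * t\<^sup>2 - b * (2 * t * w)) / (t\<^sup>2 * t\<^sup>2) = 2 * b * w / t ^ 3 - 2 * a / t\<^sup>2" for a b w :: real
      using assms by (simp add: divide_simps power2_eq_square power3_eq_cube) (simp add: algebra_simps)
    ultimately show ?thesis
      by simp
  qed
  have "P (z, t) = 1 - (z \<bullet> z) / t\<^sup>2"
    by (simp add: P_def)
  moreover note has_derivative_compose[OF P
      DERIV_flat_exp[of n "P (z, t)", unfolded has_field_derivative_def]]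
  ultimately show ?thesis
    by (simp add: case_prod_unfold bump_def[abs_def] P_def)
qed

section \<open>The gradient estimate\<close>

text \<open>Either \<open>b\<close> is at most \<open>a powr (p - 1) / 2\<close> and the first term
  alone dominates, or \<open>a\<close> is at most \<open>(2 * b) powr (1 / (p - 1))\<close> and the
  second does. The factor 1 / 2 is what permits absorbing the first term in the energy
  inequality.\<close>

lemma young_split:
  fixes a b p :: real
  assumes "0 \<le> a" "0 \<le> b" "1 < p"
  shows "a * b \<le> a powr p / 2 + (2 * b) powr (p / (p - 1))"
proof (cases "b \<le> a powr (p - 1) / 2")
  case True
  then have "a * b \<le> a * (a powr (p - 1) / 2)"
    using assms by (intro mult_left_mono)
  also have "\<dots> = a powr p / 2"
    using assms by (cases "a = 0") (auto simp: powr_diff)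
  finally show ?thesis
    by (smt (verit) powr_ge_zero)
next
  case False
  then have b: "b > 0" "a powr (p - 1) \<le> 2 * b"
    using assms powr_ge_zero[of a "p - 1"] by linarith+
  then have "(a powr (p - 1)) powr (1 / (p - 1)) \<le> (2 * b) powr (1 / (p - 1))"
    using assms by (intro powr_mono2) auto
  then have "a \<le> (2 * b) powr (1 / (p - 1))"
    using assms by (cases "a = 0") (auto simp: powr_powr)
  then have "a * b \<le> (2 * b) powr (1 / (p - 1)) * (2 * b)"
    using assms by (intro mult_mono) auto
  also have "\<dots> = (2 * b) powr (1 / (p - 1) + 1)"
    using b by (simp add: powr_add)
  also have "1 / (p - 1) + 1 = p / (p - 1)"
    using assms by (simp add: field_simps)
  finally show ?thesis
    by (smt (verit) powr_ge_zero divide_nonneg_nonneg)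
qed

text \<open>Used with a \<open>k\<close> adapted to the radius of a ball in place of Hoelder's inequality.\<close>

lemma truncation_bound:
  fixes s k q :: real
  assumes "0 \<le> s" "0 < k" "1 \<le> q"
  shows "s \<le> k + k powr (1 - q) * s powr q"
proof (cases "s \<le> k")
  case True
  then show ?thesis by (smt (verit) powr_ge_zero mult_nonneg_nonneg)
next
  case False
  then have "s powr (1 - q) \<le> k powr (1 - q)"
    using assms by (intro powr_mono2') auto
  then have "s powr (1 - q) * s powr q \<le> k powr (1 - q) * s powr q"
    by (intro mult_right_mono) auto
  moreover have "s powr (1 - q) * s powr q = s"
    using assms False by (simp flip: powr_add)
  ultimately show ?thesis using assms by linarith
qed

section \<open>Integrals and null sets on subsets of the domain\<close>

lemma lebesgue_on_support:
  fixes g :: "'a::euclidean_space \<Rightarrow> 'b::{banach, second_countable_topology}"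
  assumes "S \<in> sets lebesgue" "T \<in> sets lebesgue" "S \<subseteq> T" "\<And>x. x \<in> T - S \<Longrightarrow> g x = 0"
  shows "integrable (lebesgue_on T) g \<longleftrightarrow> integrable (lebesgue_on S) g"
    and "integral\<^sup>L (lebesgue_on T) g = integral\<^sup>L (lebesgue_on S) g"
proof -
  have "(\<lambda>x. indicator T x *\<^sub>R g x) = (\<lambda>x. indicator S x *\<^sub>R g x)"
    using assms(3,4) by (auto simp: indicator_def fun_eq_iff)
  then show "integrable (lebesgue_on T) g \<longleftrightarrow> integrable (lebesgue_on S) g"
    and "integral\<^sup>L (lebesgue_on T) g = integral\<^sup>L (lebesgue_on S) g"
    using assms(1,2) by (simp_all add: integrable_restrict_space integral_restrict_space)
qed

lemma integrable_lebesgue_on_subset: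
  fixes g :: "'a::euclidean_space \<Rightarrow> 'b::{banach, second_countable_topology}"
  assumes "integrable (lebesgue_on T) g" "S \<in> sets lebesgue" "T \<in> sets lebesgue" "S \<subseteq> T"
  shows "integrable (lebesgue_on S) g"
proof -
  have "integrable lebesgue (\<lambda>x. indicator T x *\<^sub>R g x)"
    using assms by (simp add: integrable_restrict_space)
  then have "integrable lebesgue (\<lambda>x. indicator S x *\<^sub>R indicator T x *\<^sub>R g x)"
    by (rule integrable_mult_indicator[OF assms(2)])
  moreover have "(\<lambda>x. indicator S x *\<^sub>R indicator T x *\<^sub>R g x) = (\<lambda>x. indicator S x *\<^sub>R g x)"
    using assms(4) by (auto simp: indicator_def fun_eq_iff)
  ultimately show ?thesis
    using assms(2) by (simp add: integrable_restrict_space)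
qed

lemma integral_lebesgue_on_mono_set:
  fixes g :: "'a::euclidean_space \<Rightarrow> real"
  assumes "integrable (lebesgue_on T) g" "S \<in> sets lebesgue" "T \<in> sets lebesgue" "S \<subseteq> T"
    and "\<And>x. 0 \<le> g x"
  shows "integral\<^sup>L (lebesgue_on S) g \<le> integral\<^sup>L (lebesgue_on T) g"
proof -
  have "integrable lebesgue (\<lambda>x. indicator T x *\<^sub>R g x)" "integrable lebesgue (\<lambda>x. indicator S x *\<^sub>R g x)"
    using assms(1-3) integrable_lebesgue_on_subset[OF assms(1-4)]
    by (simp_all add: integrable_restrict_space)
  then have "(\<integral>x. indicator S x *\<^sub>R g x \<partial>lebesgue) \<le> (\<integral>x. indicator T x *\<^sub>R g x \<partial>lebesgue)"
    by (intro integral_mono) (use assms(4,5) in \<open>auto simp: indicator_def\<close>)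
  then show ?thesis
    using assms(2,3) by (simp add: integral_restrict_space)
qed

lemma AE_lebesgue_on_subset:
  fixes S T :: "'a::euclidean_space set"
  assumes "AE x in lebesgue_on T. P x" "S \<in> sets lebesgue" "T \<in> sets lebesgue" "S \<subseteq> T"
  shows "AE x in lebesgue_on S. P x"
  using assms by (auto simp: AE_restrict_space_iff)

lemma measure_cball:
  fixes x :: "'a::euclidean_space"
  assumes "0 \<le> t"
  shows "measure lebesgue (cball x t) = unit_ball_vol (DIM('a)) * t powr DIM('a)"
proof (cases "t = 0")
  case True
  then show ?thesis by (simp add: content_cball)
next
  case False
  then show ?thesis using assms by (simp add: content_cball powr_realpow)
qed

lemma finite_measure_lebesgue_on_cball: "finite_measure (lebesgue_on (cball (x::'a::euclidean_space) t))"
  by (rule finite_measure_lebesgue_on) simp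

text \<open>The level \<open>k\<close> stays free so that the two terms can be balanced as powers of
  the radius. It is applied to the data with exponent \<open>q\<close> and to the gradient with
  exponent \<open>p\<close>.\<close>

lemma integral_truncation:
  fixes g :: "'a::euclidean_space \<Rightarrow> real"
  assumes g: "g \<in> borel_measurable (lebesgue_on (cball x t))"
    and gq: "integrable (lebesgue_on (cball x t)) (\<lambda>y. \<bar>g y\<bar> powr q)"
    and "0 \<le> t" "0 < k" "1 \<le> q"
  shows "integrable (lebesgue_on (cball x t)) g"
    and "(\<integral>y. \<bar>g y\<bar> \<partial>lebesgue_on (cball x t))
      \<le> k * (unit_ball_vol (DIM('a)) * t powr DIM('a))
         + k powr (1 - q) * (\<integral>y. \<bar>g y\<bar> powr q \<partial>lebesgue_on (cball x t))"
proof -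
  interpret finite_measure "lebesgue_on (cball x t)"
    by (rule finite_measure_lebesgue_on_cball)
  have int: "integrable (lebesgue_on (cball x t)) (\<lambda>y. k + k powr (1 - q) * \<bar>g y\<bar> powr q)"
    using gq by simp
  have le: "\<bar>g y\<bar> \<le> k + k powr (1 - q) * \<bar>g y\<bar> powr q" for y
    by (rule truncation_bound) (use assms in auto)
  show "integrable (lebesgue_on (cball x t)) g"
    by (rule Bochner_Integration.integrable_bound[OF int g])
      (use le in \<open>auto intro!: AE_I2 simp: order_trans[OF _ abs_ge_self]\<close>)
  then have "(\<integral>y. \<bar>g y\<bar> \<partial>lebesgue_on (cball x t))
      \<le> (\<integral>y. k + k powr (1 - q) * \<bar>g y\<bar> powr q \<partial>lebesgue_on (cball x t))"
    by (intro integral_mono int le) auto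
  also have "\<dots> = k * (unit_ball_vol (DIM('a)) * t powr DIM('a))
         + k powr (1 - q) * (\<integral>y. \<bar>g y\<bar> powr q \<partial>lebesgue_on (cball x t))"
    using gq assms(3) measure_cball[of t x] by (simp add: measure_restrict_space del: measure_completion)
  finally show "(\<integral>y. \<bar>g y\<bar> \<partial>lebesgue_on (cball x t)) \<le> \<dots>" .
qed

lemma GDERIV_bump:
  fixes x :: "'a::euclidean_space"
  assumes "t > 0"
  shows "GDERIV (\<lambda>y. bump n t (x - y)) y :>
    ((bump (n + 2) t (x - y) - real n * bump (n + 1) t (x - y)) * 2 / t\<^sup>2) *\<^sub>R (x - y)"
proof -
  have "((\<lambda>y. (x - y, t)) has_derivative (\<lambda>v. (- v, 0))) (at y)"
    by (auto intro!: derivative_eq_intros)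
  from has_derivative_compose[OF this has_derivative_bump[OF assms], of n]
  have "((\<lambda>y. bump n t (x - y)) has_derivative
      (\<lambda>v. (bump (n + 2) t (x - y) - real n * bump (n + 1) t (x - y)) * (2 * ((x - y) \<bullet> v) / t\<^sup>2))) (at y)"
    by simp
  then show ?thesis
    unfolding gderiv_def by (rule has_derivative_eq_rhs) (simp add: fun_eq_iff inner_commute)
qed

lemma continuous_on_bump:
  fixes x :: "'a::euclidean_space"
  shows "t \<noteq> 0 \<Longrightarrow> continuous_on S (\<lambda>y. bump n t (x - y))"
  unfolding bump_def by (auto intro!: continuous_intros)

text \<open>Since 1 - (1 / 2)^2 = 3 / 4, the constant is the value of the bump at distance
  \<open>t / 2\<close>, its minimum over the half ball.\<close>

lemma bump_lower:
  assumes "norm z \<le> t / 2" "t > 0"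
  shows "exp (- 4 / 3) \<le> bump 0 t z"
proof -
  have "z \<bullet> z \<le> t\<^sup>2 / 4"
    using power_mono[OF assms(1) norm_ge_zero, of 2] by (simp add: dot_square_norm power_divide)
  then have le: "(z \<bullet> z) / t\<^sup>2 \<le> 1 / 4"
    using assms(2) by (simp add: field_simps)
  then have "inverse (1 - (z \<bullet> z) / t\<^sup>2) \<le> inverse (3 / 4)"
    by (intro le_imp_inverse_le) auto
  moreover have "1 - (z \<bullet> z) / t\<^sup>2 > 0"
    using le by linarith
  ultimately show ?thesis
    by (simp add: bump_def flat_exp_def)
qed

text \<open>The zero-order term calls for no upper bound on \<open>u\<close>: as \<open>l\<close>
  and the test function are nonnegative, only the negative part of \<open>u\<close> can hurt. The
  factor 2 comes from absorbing half of the gradient term, and exp (8 / 3) from squaring the lower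
  bound exp (- 4 / 3) of the bump.\<close>

lemma energy_estimate:
  fixes \<Omega> :: "'a::euclidean_space set"
  assumes "open \<Omega>" "cball x R \<subseteq> \<Omega>" "0 < R" "2 < p" "0 \<le> \<beta>" "0 \<le> l"
    and growth: "AE y in lebesgue_on \<Omega>. \<forall>s \<xi>. norm (a y s \<xi>) \<le> \<beta> * (1 + norm \<xi>)"
    and f: "integrable (lebesgue_on (cball x R)) f"
    and u: "integrable (lebesgue_on (cball x R)) (\<lambda>y. l * max (- u y) 0)"
    and Du: "Du \<in> Lp_loc p \<Omega>"
    and ineq: "distributional_ineq \<Omega> a l p f u Du"
  shows "(\<integral>y. norm (Du y) powr p \<partial>lebesgue_on (cball x (R / 2))) \<le> 2 * exp (8 / 3) *
    ((\<integral>y. \<bar>f y\<bar> \<partial>lebesgue_on (cball x R)) + (\<integral>y. \<bar>l * max (- u y) 0\<bar> \<partial>lebesgue_on (cball x R))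
      + (8 * \<beta> / R + (16 * \<beta> / R) powr (p / (p - 1))) * measure lebesgue (cball x R))"
proof -
  let ?B = "cball x R"
  let ?M = "lebesgue_on ?B"
  interpret finite_measure ?M
    by (rule finite_measure_lebesgue_on_cball)
  have \<Omega>: "\<Omega> \<in> sets lebesgue" and B: "?B \<in> sets lebesgue"
    using assms(1) by (auto intro: lmeasurable_cball)
  define \<eta> where "\<eta> = (\<lambda>y. bump 0 R (x - y))"
  define \<phi> where "\<phi> = (\<lambda>y. \<eta> y * \<eta> y)"
  have \<eta>: "0 \<le> \<eta> y" "\<eta> y \<le> 1" for y
    using bump_nonneg[of 0 R "x - y"] bump_le[of 0 R "x - y"] by (auto simp: \<eta>_def)
  have \<phi>: "0 \<le> \<phi> y" "\<phi> y \<le> 1" for y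
    using \<eta>[of y] by (auto simp: \<phi>_def intro: mult_le_one)
  have C\<eta>: "C_k k \<eta>" for k
    using smooth_bump_mult[of "\<lambda>_. 1" 0 R x] by (simp add: smooth_def \<eta>_def C_k_const)
  have test: "\<phi> \<in> test_functions \<Omega>"
    using test_functions_bump_mult[OF C\<eta> assms(3,2), of 0] by (simp add: \<phi>_def \<eta>_def)
  have zero: "\<eta> y = 0" if "y \<notin> ball x R" for y
    unfolding \<eta>_def using that assms(3) by (intro bump_eq_0) (auto simp: dist_norm)
  have G\<eta>: "GDERIV \<eta> y :> (bump 2 R (x - y) * 2 / R\<^sup>2) *\<^sub>R (x - y)" for y
    using GDERIV_bump[OF assms(3), of 0 x y] by (simp add: \<eta>_def numeral_2_eq_2)
  have "GDERIV \<phi> y :> (4 * \<eta> y * bump 2 R (x - y) / R\<^sup>2) *\<^sub>R (x - y)" for y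
    using GDERIV_mult[OF G\<eta>[of y] G\<eta>[of y]] unfolding \<phi>_def
    by (simp add: algebra_simps flip: scaleR_add_left)
  then have grad: "grad \<phi> y = (4 * \<eta> y * bump 2 R (x - y) / R\<^sup>2) *\<^sub>R (x - y)" for y
    by (rule grad_eqI)
  \<comment> \<open>The gradient of \<eta>^2 keeps one factor \<eta>. The 8 is 2 from the square,
    times 2 from differentiating |x - y|^2, times the bound 2 for \<open>bump 2\<close>.\<close>
  have grad_le: "norm (grad \<phi> y) \<le> 8 / R * \<eta> y" for y
  proof (cases "y \<in> ball x R")
    case True
    have "norm (grad \<phi> y) = 4 * \<eta> y * (bump 2 R (x - y) * norm (x - y)) / R\<^sup>2"
      using \<eta>[of y] bump_nonneg[of 2 R "x - y"] by (simp add: grad)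
    also have "\<dots> \<le> 4 * \<eta> y * (2 * R) / R\<^sup>2"
    proof -
      have "bump 2 R (x - y) * norm (x - y) \<le> 2 * R"
        using bump_le[of 2 R "x - y"] True by (intro mult_mono) (auto simp: dist_norm)
      then show ?thesis
        using \<eta>[of y] by (intro divide_right_mono mult_left_mono) auto
    qed
    also have "\<dots> = 8 / R * \<eta> y"
      using assms(3) by (simp add: power2_eq_square)
    finally show ?thesis .
  next
    case False
    then show ?thesis using zero by (simp add: grad)
  qed
  \<comment> \<open>What Young's inequality leaves over: 8 \<beta> / R from the constant part of the
    growth bound, and the conjugate power of twice that number from the part linear in the
    gradient.\<close>
  define c where "c = 8 * \<beta> / R + (16 * \<beta> / R) powr (p / (p - 1))"
  have c: "0 \<le> c"
    using assms(3,5) by (simp add: c_def)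
  have pointwise: "b * norm (grad \<phi> y) \<le> norm (Du y) powr p * \<phi> y / 2 + c"
    if "b \<le> \<beta> * (1 + norm (Du y))" "0 \<le> b" for b y
  proof -
    let ?s = "norm (Du y)"
    have "b * norm (grad \<phi> y) \<le> (\<beta> * (1 + ?s)) * (8 / R * \<eta> y)"
      using that grad_le[of y] assms(5) by (intro mult_mono) auto
    also have "\<dots> = 8 * \<beta> / R * \<eta> y + (?s * \<eta> y) * (8 * \<beta> / R)"
      by (simp add: algebra_simps add_divide_distrib)
    \<comment> \<open>Young is applied with s \<eta> as one factor. The p-th power of \<eta> is at
      most \<eta>^2 because \<eta> \<le> 1 and p > 2, so the test function reappears next to
      s^p.\<close>
    also have "(?s * \<eta> y) * (8 * \<beta> / R) \<le> (?s * \<eta> y) powr p / 2 + (2 * (8 * \<beta> / R)) powr (p / (p - 1))"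
      using \<eta>[of y] assms by (intro young_split) auto
    also have "(?s * \<eta> y) powr p \<le> ?s powr p * \<phi> y"
    proof -
      have "\<eta> y powr p \<le> \<eta> y powr 2"
        using \<eta>[of y] assms(4) by (intro powr_mono') auto
      then show ?thesis
        using \<eta>[of y] by (simp add: powr_mult \<phi>_def power2_eq_square mult_left_mono)
    qed
    also have "8 * \<beta> / R * \<eta> y \<le> 8 * \<beta> / R * 1"
      using \<eta>[of y] assms by (intro mult_left_mono) auto
    finally show ?thesis by (simp add: c_def)
  qed
  have supp: "integral\<^sup>L (lebesgue_on \<Omega>) g = integral\<^sup>L ?M g" if "\<And>y. \<eta> y = 0 \<Longrightarrow> g y = 0" for g :: "'a \<Rightarrow> real"
    using lebesgue_on_support(2)[OF B \<Omega> assms(2), of g] that zero by auto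
  have \<phi>0: "\<phi> y = 0" "grad \<phi> y = 0" if "\<eta> y = 0" for y
    using that by (simp_all add: grad, simp add: \<phi>_def)
  have "\<forall>y. 0 \<le> \<phi> y"
    using \<phi> by blast
  then have main: "(\<integral>y. a y (u y) (Du y) \<bullet> grad \<phi> y \<partial>?M) + l * (\<integral>y. u y * \<phi> y \<partial>?M)
      + (\<integral>y. norm (Du y) powr p * \<phi> y \<partial>?M) \<le> (\<integral>y. f y * \<phi> y \<partial>?M)"
    using ineq test unfolding distributional_ineq_def
    by (subst (1 2 3 4) supp[symmetric]) (auto simp: \<phi>0)
  have meas\<phi>: "\<phi> \<in> borel_measurable ?M"
  proof -
    have "continuous_on UNIV \<phi>"
      using assms(3) unfolding \<phi>_def \<eta>_def by (intro continuous_intros continuous_on_bump) auto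
    then show ?thesis
      using B by (intro continuous_imp_measurable_on_sets_lebesgue) (auto intro: continuous_on_subset)
  qed
  have int\<phi>: "integrable ?M (\<lambda>y. g y * \<phi> y)" if "integrable ?M g" for g :: "'a \<Rightarrow> real"
    by (rule Bochner_Integration.integrable_bound[OF that])
      (use that meas\<phi> \<phi> in \<open>auto intro!: AE_I2 simp: abs_mult mult_left_le\<close>)
  have Dp: "integrable ?M (\<lambda>y. norm (Du y) powr p)"
    using Du assms(2) by (auto simp: Lp_loc_def Lp_def)
  \<comment> \<open>The absorption in abstract form: I is the weighted energy, the vector-field term
    A is at least - (I / 2 + X), and I / 2 moves to the left.\<close>
  have arith: "I \<le> 2 * (F1 + L1 + X)"
    if "F \<le> F1" "- L1 \<le> L" "- J \<le> A" "J = I / 2 + X" "A + L + I \<le> F" for A F F1 I J L L1 X :: real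
    using that unfolding distrib_left by linarith
  have "(\<integral>y. f y * \<phi> y \<partial>?M) \<le> (\<integral>y. \<bar>f y\<bar> \<partial>?M)"
  proof (rule integral_mono)
    show "f y * \<phi> y \<le> \<bar>f y\<bar>" for y
      using mult_mono[of "f y" "\<bar>f y\<bar>" "\<phi> y" 1] \<phi>[of y] by simp
  qed (use f int\<phi> in auto)
  \<comment> \<open>Without integrability the Bochner integral is 0, while the lower bound is at
    most 0, so the claim survives. The same default value settles the vector-field term
    below.\<close>
  moreover have "- (\<integral>y. \<bar>l * max (- u y) 0\<bar> \<partial>?M) \<le> l * (\<integral>y. u y * \<phi> y \<partial>?M)"
  proof (cases "integrable ?M (\<lambda>y. l * (u y * \<phi> y))")
    case True
    have "- (\<integral>y. \<bar>l * max (- u y) 0\<bar> \<partial>?M) = (\<integral>y. - \<bar>l * max (- u y) 0\<bar> \<partial>?M)"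
      by simp
    also have "\<dots> \<le> (\<integral>y. l * (u y * \<phi> y) \<partial>?M)"
    proof (rule integral_mono)
      show "- \<bar>l * max (- u y) 0\<bar> \<le> l * (u y * \<phi> y)" for y
      proof -
        have "- max (- u y) 0 \<le> u y * \<phi> y"
          using \<phi>[of y] mult_left_mono_neg[of "\<phi> y" 1 "u y"] by (cases "u y \<ge> 0") auto
        then have "l * - max (- u y) 0 \<le> l * (u y * \<phi> y)"
          using assms(6) by (rule mult_left_mono)
        then show ?thesis using assms(6) by (simp add: abs_mult)
      qed
    qed (use u True in auto)
    finally show ?thesis by simp
  next
    case False
    then have "l * (\<integral>y. u y * \<phi> y \<partial>?M) = 0"
      by (metis integral_mult_right_zero not_integrable_integral_eq)
    moreover have "0 \<le> (\<integral>y. \<bar>l * max (- u y) 0\<bar> \<partial>?M)"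
      by (intro integral_nonneg_AE) auto
    ultimately show ?thesis
      by linarith
  qed
  moreover have "- (\<integral>y. norm (Du y) powr p * \<phi> y / 2 + c \<partial>?M) \<le> (\<integral>y. a y (u y) (Du y) \<bullet> grad \<phi> y \<partial>?M)"
  proof (cases "integrable ?M (\<lambda>y. a y (u y) (Du y) \<bullet> grad \<phi> y)")
    case True
    have "AE y in ?M. norm (a y (u y) (Du y)) \<le> \<beta> * (1 + norm (Du y))"
      using AE_lebesgue_on_subset[OF growth B \<Omega> assms(2)] by eventually_elim auto
    then have "AE y in ?M. - (norm (Du y) powr p * \<phi> y / 2 + c) \<le> a y (u y) (Du y) \<bullet> grad \<phi> y"
    proof eventually_elim
      case (elim y)
      have "\<bar>a y (u y) (Du y) \<bullet> grad \<phi> y\<bar> \<le> norm (a y (u y) (Du y)) * norm (grad \<phi> y)"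
        by (rule Cauchy_Schwarz_ineq2)
      with pointwise[OF elim] show ?case by auto
    qed
    then have "(\<integral>y. - (norm (Du y) powr p * \<phi> y / 2 + c) \<partial>?M) \<le> (\<integral>y. a y (u y) (Du y) \<bullet> grad \<phi> y \<partial>?M)"
      using True int\<phi>[OF Dp] by (intro integral_mono_AE) auto
    then show ?thesis by (simp only: Bochner_Integration.integral_minus)
  next
    case False
    have "0 \<le> (\<integral>y. norm (Du y) powr p * \<phi> y / 2 + c \<partial>?M)"
      using c \<phi> by (intro integral_nonneg_AE) auto
    then show ?thesis using False by (simp add: not_integrable_integral_eq)
  qed
  moreover have "(\<integral>y. norm (Du y) powr p * \<phi> y / 2 + c \<partial>?M)
      = (\<integral>y. norm (Du y) powr p * \<phi> y \<partial>?M) / 2 + c * measure lebesgue ?B"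
    using int\<phi>[OF Dp] B by (simp add: measure_restrict_space)
  ultimately have "(\<integral>y. norm (Du y) powr p * \<phi> y \<partial>?M) \<le> 2 *
      ((\<integral>y. \<bar>f y\<bar> \<partial>?M) + (\<integral>y. \<bar>l * max (- u y) 0\<bar> \<partial>?M) + c * measure lebesgue ?B)"
    using main by (rule arith)
  moreover have "(\<integral>y. norm (Du y) powr p \<partial>lebesgue_on (cball x (R / 2)))
      \<le> exp (8 / 3) * (\<integral>y. norm (Du y) powr p * \<phi> y \<partial>?M)"
  proof -
    have sub: "cball x (R / 2) \<subseteq> cball x R"
      using assms(3) by (simp add: subset_cball)
    have S: "cball x (R / 2) \<in> sets lebesgue"
      by (auto intro: lmeasurable_cball)
    have "(\<integral>y. norm (Du y) powr p \<partial>lebesgue_on (cball x (R / 2)))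
      \<le> (\<integral>y. exp (8 / 3) * (norm (Du y) powr p * \<phi> y) \<partial>lebesgue_on (cball x (R / 2)))"
    proof (rule integral_mono_AE)
      show "integrable (lebesgue_on (cball x (R / 2))) (\<lambda>y. exp (8 / 3) * (norm (Du y) powr p * \<phi> y))"
        by (rule integrable_lebesgue_on_subset[OF integrable_mult_right[OF int\<phi>[OF Dp]] S B sub])
      have "norm (Du y) powr p \<le> exp (8 / 3) * (norm (Du y) powr p * \<phi> y)" if "y \<in> cball x (R / 2)" for y
      proof -
        have "exp (- 4 / 3) \<le> \<eta> y"
          unfolding \<eta>_def using that assms(3) by (intro bump_lower) (auto simp: dist_norm)
        then have "exp (- 4 / 3) * exp (- 4 / 3) \<le> \<phi> y"
          unfolding \<phi>_def by (intro mult_mono) (auto simp: \<eta>)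
        then have "exp (8 / 3) * (exp (- 4 / 3) * exp (- 4 / 3)) \<le> exp (8 / 3) * \<phi> y"
          by (intro mult_left_mono) auto
        then have "1 \<le> exp (8 / 3) * \<phi> y"
          by (simp flip: exp_add)
        from mult_left_mono[OF this, of "norm (Du y) powr p"] show ?thesis
          by (simp add: mult_ac)
      qed
      then show "AE y in lebesgue_on (cball x (R / 2)). norm (Du y) powr p \<le> exp (8 / 3) * (norm (Du y) powr p * \<phi> y)"
        by (intro AE_I2) auto
    qed (rule integrable_lebesgue_on_subset[OF Dp S B sub])
    also have "\<dots> \<le> (\<integral>y. exp (8 / 3) * (norm (Du y) powr p * \<phi> y) \<partial>?M)"
      using \<phi> by (intro integral_lebesgue_on_mono_set integrable_mult_right int\<phi> Dp S B sub) auto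
    finally show ?thesis by simp
  qed
  moreover have "J \<le> 2 * exp (8 / 3) * X" if "I \<le> 2 * X" "J \<le> exp (8 / 3) * I" for I J X :: real
    using order_trans[OF that(2) mult_left_mono[OF that(1)]] by (simp add: mult_ac)
  ultimately show ?thesis
    unfolding c_def[symmetric] by blast
qed

text \<open>For bounded \<open>t\<close>, the different powers in the energy estimate can all be
  traded for the smallest exponent at the price of a constant.\<close>

lemma powr_le_powr_bounded:
  fixes t D e \<gamma> :: real
  assumes "0 < t" "t \<le> D" "\<gamma> \<le> e"
  shows "t powr e \<le> D powr (e - \<gamma>) * t powr \<gamma>"
proof -
  have "t powr e = t powr (e - \<gamma>) * t powr \<gamma>"
    by (simp flip: powr_add)
  also have "\<dots> \<le> D powr (e - \<gamma>) * t powr \<gamma>"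
    using assms by (intro mult_right_mono powr_mono2) auto
  finally show ?thesis .
qed

text \<open>The constant precedes the coefficient, the data and the solution, so it sees
  \<open>f\<close> and the negative part of \<open>u\<close> only through the bounds
  \<open>A\<close> and \<open>B\<close> on the q-th powers of their norms. The doubled ball reflects
  the halving of the radius in the energy estimate.\<close>

lemma gradient_mean_bound:
  fixes \<Omega> :: "'a::euclidean_space set" and p q \<beta> A B :: real
  defines "N \<equiv> real DIM('a)"
  defines "\<alpha> \<equiv> min (1 - N / (p * q)) (1 - 1 / (p - 1))"
  assumes "open \<Omega>" "bounded \<Omega>" "2 < p" "1 \<le> q" "0 \<le> \<beta>" "0 \<le> A" "0 \<le> B"
  shows "\<exists>M\<ge>0. \<forall>a l f u Du x t.
      (AE y in lebesgue_on \<Omega>. \<forall>s \<xi>. norm (a y s \<xi>) \<le> \<beta> * (1 + norm \<xi>)) \<longrightarrow> 0 \<le> l \<longrightarrow>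
      f \<in> Lp q \<Omega> \<longrightarrow> (\<integral>y. \<bar>f y\<bar> powr q \<partial>lebesgue_on \<Omega>) \<le> A \<longrightarrow>
      (\<lambda>y. l * max (- u y) 0) \<in> Lp q \<Omega> \<longrightarrow> (\<integral>y. \<bar>l * max (- u y) 0\<bar> powr q \<partial>lebesgue_on \<Omega>) \<le> B \<longrightarrow>
      Du \<in> Lp_loc p \<Omega> \<longrightarrow> distributional_ineq \<Omega> a l p f u Du \<longrightarrow>
      0 < t \<longrightarrow> cball x (2 * t) \<subseteq> \<Omega> \<longrightarrow>
      (\<integral>y. norm (Du y) \<partial>lebesgue_on (cball x t)) \<le> M * t powr (N - 1 + \<alpha>)"
proof -
  define V where "V = unit_ball_vol N"
  define p' where "p' = p / (p - 1)"
  \<comment> \<open>By the choice of \<alpha> this is the smaller of N - N / q and N - p', the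
    exponents with which the data and the vector field enter the energy.\<close>
  define \<gamma> where "\<gamma> = N - p + p * \<alpha>"
  have V: "0 \<le> V" by (simp add: V_def N_def)
  obtain D where D: "D > 0" "\<And>x y. x \<in> \<Omega> \<Longrightarrow> y \<in> \<Omega> \<Longrightarrow> dist x y \<le> D"
  proof
    show "diameter \<Omega> + 1 > 0"
      using diameter_ge_0[OF assms(4)] by linarith
    show "dist x y \<le> diameter \<Omega> + 1" if "x \<in> \<Omega>" "y \<in> \<Omega>" for x y
      using diameter_bounded_bound[OF assms(4) that] by linarith
  qed
  have p\<alpha>: "p * \<alpha> - p \<le> - N / q" "p * \<alpha> - p \<le> - p'"
  proof -
    have "p * \<alpha> \<le> p * (1 - N / (p * q))" "p * \<alpha> \<le> p * (1 - 1 / (p - 1))"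
      using assms(5) by (auto simp: \<alpha>_def intro!: mult_left_mono)
    moreover have "p * (1 - N / (p * q)) = p - N / q" "p * (1 - 1 / (p - 1)) = p - p'"
      using assms(5,6) by (auto simp: p'_def right_diff_distrib)
    ultimately show "p * \<alpha> - p \<le> - N / q" "p * \<alpha> - p \<le> - p'"
      by auto
  qed
  have p': "1 < p'"
    using assms(5) by (simp add: p'_def field_simps)
  \<comment> \<open>The first line collects \<open>f\<close> and the negative part of
    \<open>u\<close>, the second the vector field; each power of \<open>D\<close> is the price of
    lowering an exponent to \<gamma>. In \<open>M\<close>, the summand \<open>V\<close> comes from
    truncating the gradient.\<close>
  define E where "E = D powr (N - N / q - \<gamma>) * (2 * V * 2 powr N + A + B)
    + V * 2 powr N * (4 * \<beta> * D powr (N - 1 - \<gamma>) + (8 * \<beta>) powr p' * D powr (N - p' - \<gamma>))"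
  define M where "M = V + 2 * exp (8 / 3) * E"
  have "0 \<le> E"
    using V assms by (simp add: E_def)
  then have "0 \<le> M"
    using V by (simp add: M_def)
  moreover have "(\<integral>y. norm (Du y) \<partial>lebesgue_on (cball x t)) \<le> M * t powr (N - 1 + \<alpha>)"
    if growth: "AE y in lebesgue_on \<Omega>. \<forall>s \<xi>. norm (a y s \<xi>) \<le> \<beta> * (1 + norm \<xi>)" and "0 \<le> l"
      and f: "f \<in> Lp q \<Omega>" "(\<integral>y. \<bar>f y\<bar> powr q \<partial>lebesgue_on \<Omega>) \<le> A"
      and g: "(\<lambda>y. l * max (- u y) 0) \<in> Lp q \<Omega>" "(\<integral>y. \<bar>l * max (- u y) 0\<bar> powr q \<partial>lebesgue_on \<Omega>) \<le> B"
      and Du: "Du \<in> Lp_loc p \<Omega>" and ineq: "distributional_ineq \<Omega> a l p f u Du"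
      and t: "0 < t" and sub: "cball x (2 * t) \<subseteq> \<Omega>"
    for a l f u x t and Du :: "'a \<Rightarrow> 'a"
  proof -
    have \<Omega>: "\<Omega> \<in> sets lebesgue" and C: "cball x r \<in> sets lebesgue" for r
      using assms(3) by (auto intro: lmeasurable_cball)
    have tD: "t \<le> D"
    proof -
      obtain b :: 'a where b: "b \<in> Basis" using nonempty_Basis by blast
      have "x \<in> \<Omega>" "x + t *\<^sub>R b \<in> \<Omega>"
        using sub t b by (auto simp: subset_iff dist_norm)
      from D(2)[OF this] show ?thesis using t b by (simp add: dist_norm)
    qed
    have trunc: "integrable (lebesgue_on (cball x (2 * t))) g \<and>
        (\<integral>y. \<bar>g y\<bar> \<partial>lebesgue_on (cball x (2 * t))) \<le> (V * 2 powr N + I) * t powr (N - N / q)"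
      if g: "g \<in> Lp q \<Omega>" "(\<integral>y. \<bar>g y\<bar> powr q \<partial>lebesgue_on \<Omega>) \<le> I" for g :: "'a \<Rightarrow> real" and I
    proof -
      have meas: "g \<in> borel_measurable (lebesgue_on (cball x (2 * t)))"
        using g(1) sub C \<Omega> by (auto simp: Lp_def intro: measurable_restrict_mono)
      have int: "integrable (lebesgue_on \<Omega>) (\<lambda>y. \<bar>g y\<bar> powr q)"
        using g(1) by (simp add: Lp_def)
      have intc: "integrable (lebesgue_on (cball x (2 * t))) (\<lambda>y. \<bar>g y\<bar> powr q)"
        by (rule integrable_lebesgue_on_subset[OF int C \<Omega> sub])
      have le: "(\<integral>y. \<bar>g y\<bar> powr q \<partial>lebesgue_on (cball x (2 * t))) \<le> I"
        using integral_lebesgue_on_mono_set[OF int C \<Omega> sub] g(2) by simp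
      \<comment> \<open>At this level k t^N and k^(1 - q) are the same power, t^(N - N / q).\<close>
      let ?k = "t powr (- N / q)"
      have "- N / q * (1 - q) = N - N / q"
        using assms(6) by (simp add: field_simps)
      then have k: "?k powr (1 - q) = t powr (N - N / q)"
        by (simp add: powr_powr)
      have "?k * (V * (2 * t) powr N) = V * 2 powr N * t powr (N - N / q)"
        using t by (simp add: powr_mult powr_diff powr_minus field_simps)
      moreover have "?k powr (1 - q) * (\<integral>y. \<bar>g y\<bar> powr q \<partial>lebesgue_on (cball x (2 * t))) \<le> t powr (N - N / q) * I"
        unfolding k using le by (intro mult_left_mono) auto
      moreover have "(\<integral>y. \<bar>g y\<bar> \<partial>lebesgue_on (cball x (2 * t)))
          \<le> ?k * (V * (2 * t) powr N) + ?k powr (1 - q) * (\<integral>y. \<bar>g y\<bar> powr q \<partial>lebesgue_on (cball x (2 * t)))"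
        using integral_truncation(2)[OF meas intc _ _ assms(6), of ?k] t by (simp add: V_def N_def)
      ultimately have "(\<integral>y. \<bar>g y\<bar> \<partial>lebesgue_on (cball x (2 * t)))
          \<le> V * 2 powr N * t powr (N - N / q) + t powr (N - N / q) * I"
        by linarith
      then show ?thesis
        using integral_truncation(1)[OF meas intc _ _ assms(6), of 1] t by (simp add: algebra_simps)
    qed
    have "(\<integral>y. norm (Du y) powr p \<partial>lebesgue_on (cball x (2 * t / 2))) \<le> 2 * exp (8 / 3) *
      ((\<integral>y. \<bar>f y\<bar> \<partial>lebesgue_on (cball x (2 * t))) + (\<integral>y. \<bar>l * max (- u y) 0\<bar> \<partial>lebesgue_on (cball x (2 * t)))
      + (8 * \<beta> / (2 * t) + (16 * \<beta> / (2 * t)) powr (p / (p - 1))) * measure lebesgue (cball x (2 * t)))"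
      using t sub assms by (intro energy_estimate[OF _ _ _ _ _ \<open>0 \<le> l\<close> growth
          conjunct1[OF trunc[OF f]] conjunct1[OF trunc[OF g]] Du ineq]) auto
    also have "\<dots> \<le> 2 * exp (8 / 3) * (E * t powr \<gamma>)"
    proof (intro mult_left_mono)
      have "\<gamma> \<le> N - N / q" "\<gamma> \<le> N - 1" "\<gamma> \<le> N - p'"
        using p\<alpha> p' by (simp_all add: \<gamma>_def)
      note b = this[THEN powr_le_powr_bounded[OF t tD]]
      have "(\<integral>y. \<bar>f y\<bar> \<partial>lebesgue_on (cball x (2 * t))) + (\<integral>y. \<bar>l * max (- u y) 0\<bar> \<partial>lebesgue_on (cball x (2 * t)))
        \<le> (2 * V * 2 powr N + A + B) * t powr (N - N / q)"
        using trunc[OF f] trunc[OF g] by (simp add: algebra_simps)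
      also have "\<dots> \<le> (2 * V * 2 powr N + A + B) * (D powr (N - N / q - \<gamma>) * t powr \<gamma>)"
        using V assms(8,9) b by (intro mult_left_mono) auto
      finally have 1: "(\<integral>y. \<bar>f y\<bar> \<partial>lebesgue_on (cball x (2 * t))) + (\<integral>y. \<bar>l * max (- u y) 0\<bar> \<partial>lebesgue_on (cball x (2 * t)))
        \<le> D powr (N - N / q - \<gamma>) * (2 * V * 2 powr N + A + B) * t powr \<gamma>"
        by (simp only: mult_ac)
      have "measure lebesgue (cball x (2 * t)) = V * 2 powr N * t powr N"
        using t measure_cball[of "2 * t" x] by (simp add: V_def N_def powr_mult)
      moreover have "8 * \<beta> / (2 * t) + (16 * \<beta> / (2 * t)) powr p' = 4 * \<beta> * t powr (- 1) + (8 * \<beta>) powr p' * t powr (- p')"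
      proof -
        have "16 * \<beta> / (2 * t) = 8 * \<beta> / t"
          by simp
        then show ?thesis
          using t assms(7) powr_minus_divide[of t 1] powr_minus_divide[of t p'] by (simp only: powr_divide) simp
      qed
      moreover have "t powr (- 1) * t powr N = t powr (N - 1)" "t powr (- p') * t powr N = t powr (N - p')"
        by (simp_all only: powr_add[symmetric], simp_all)
      moreover have "(b * r + c * s) * (d * w) = d * (b * (r * w) + c * (s * w))" for b c d r s w :: real
        by (simp add: algebra_simps)
      ultimately have "(8 * \<beta> / (2 * t) + (16 * \<beta> / (2 * t)) powr p') * measure lebesgue (cball x (2 * t))
        = V * 2 powr N * (4 * \<beta> * t powr (N - 1) + (8 * \<beta>) powr p' * t powr (N - p'))"
        by (simp only:)
      also have "\<dots> \<le> V * 2 powr N * (4 * \<beta> * (D powr (N - 1 - \<gamma>) * t powr \<gamma>) + (8 * \<beta>) powr p' * (D powr (N - p' - \<gamma>) * t powr \<gamma>))"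
        using V assms(7) b by (intro mult_left_mono add_mono) auto
      also have "\<dots> = V * 2 powr N * (4 * \<beta> * D powr (N - 1 - \<gamma>) + (8 * \<beta>) powr p' * D powr (N - p' - \<gamma>)) * t powr \<gamma>"
        by (simp only: distrib_left distrib_right mult.assoc)
      finally show "(\<integral>y. \<bar>f y\<bar> \<partial>lebesgue_on (cball x (2 * t))) + (\<integral>y. \<bar>l * max (- u y) 0\<bar> \<partial>lebesgue_on (cball x (2 * t)))
          + (8 * \<beta> / (2 * t) + (16 * \<beta> / (2 * t)) powr (p / (p - 1))) * measure lebesgue (cball x (2 * t)) \<le> E * t powr \<gamma>"
        using 1 unfolding E_def p'_def[symmetric] distrib_right[of _ _ "t powr \<gamma>"] by linarith
    qed auto
    finally have energy: "(\<integral>y. norm (Du y) powr p \<partial>lebesgue_on (cball x t)) \<le> 2 * exp (8 / 3) * E * t powr \<gamma>"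
      by (simp only: mult.assoc div_by_1) simp
    have "cball x t \<subseteq> \<Omega>"
      using sub t by (auto simp: subset_iff)
    then have DuB: "Du \<in> borel_measurable (lebesgue_on (cball x t))"
      "integrable (lebesgue_on (cball x t)) (\<lambda>y. norm (Du y) powr p)"
      using Du by (auto simp: Lp_loc_def Lp_def)
    \<comment> \<open>At this level the volume term and the energy term both become t^(N - 1 +
      \<alpha>); for the latter the exponent (\<alpha> - 1) (1 - p) + \<gamma> collapses by the
      definition of \<gamma>.\<close>
    let ?k = "t powr (\<alpha> - 1)"
    have "(\<integral>y. \<bar>norm (Du y)\<bar> \<partial>lebesgue_on (cball x t)) \<le> ?k * (V * t powr N)
        + ?k powr (1 - p) * (\<integral>y. \<bar>norm (Du y)\<bar> powr p \<partial>lebesgue_on (cball x t))"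
      using integral_truncation(2)[of "\<lambda>y. norm (Du y)" x t p ?k] DuB t assms(5)
      by (simp add: V_def N_def)
    also have "\<dots> \<le> ?k * (V * t powr N) + ?k powr (1 - p) * (2 * exp (8 / 3) * E * t powr \<gamma>)"
      using energy by (intro add_left_mono mult_left_mono) auto
    also have "?k * (V * t powr N) = V * t powr (\<alpha> - 1 + N)"
      unfolding powr_add by (simp only: mult_ac)
    also have "?k powr (1 - p) * (2 * exp (8 / 3) * E * t powr \<gamma>) = 2 * exp (8 / 3) * E * t powr ((\<alpha> - 1) * (1 - p) + \<gamma>)"
      unfolding powr_add powr_powr by (simp only: mult_ac)
    also have "\<alpha> - 1 + N = N - 1 + \<alpha>"
      by simp
    also have "(\<alpha> - 1) * (1 - p) + \<gamma> = N - 1 + \<alpha>"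
      by (simp add: \<gamma>_def algebra_simps)
    finally show ?thesis
      unfolding M_def distrib_right by simp
  qed
  ultimately show ?thesis by blast
qed

section \<open>Derivatives of mollifications\<close>

lemma integrable_dominated:
  fixes f :: "'a \<Rightarrow> 'b::{banach, second_countable_topology}"
    and h :: "'a \<Rightarrow> 'c::{banach, second_countable_topology}"
  assumes "integrable M f" "h \<in> borel_measurable M" "\<And>y. y \<in> space M \<Longrightarrow> norm (h y) \<le> C * norm (f y)"
  shows "integrable M h"
proof (rule Bochner_Integration.integrable_bound[OF _ assms(2)])
  show "integrable M (\<lambda>y. C * norm (f y))"
    using assms(1) by simp
  show "AE y in M. norm (h y) \<le> norm (C * norm (f y))"
    using assms(3) by (intro AE_I2) (metis abs_ge_self order_trans real_norm_def)
qed

lemma integrable_mult_bounded: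
  fixes u g :: "'a \<Rightarrow> real"
  assumes "integrable M u" "g \<in> borel_measurable M" "\<And>y. y \<in> space M \<Longrightarrow> \<bar>g y\<bar> \<le> C"
  shows "integrable M (\<lambda>y. u y * g y)"
proof (rule integrable_dominated[OF assms(1)])
  show "norm (u y * g y) \<le> C * norm (u y)" if "y \<in> space M" for y
    using mult_right_mono[OF assms(3)[OF that] abs_ge_zero[of "u y"]] by (simp add: abs_mult mult.commute)
qed (use assms in simp)

text \<open>By the mean value theorem the bound on \<open>g'\<close> bounds all difference
  quotients, so \<open>B * \<bar>u y\<bar>\<close> dominates them. Stating the derivative at 0 is
  enough, since other parameters are reached by shifting the path.\<close>

lemma DERIV_integral_param:
  fixes u :: "'a \<Rightarrow> real" and g g' :: "real \<Rightarrow> 'a \<Rightarrow> real"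
  assumes u: "integrable M u" and \<delta>: "0 < \<delta>"
    and g: "\<And>\<tau> y. \<bar>\<tau>\<bar> < \<delta> \<Longrightarrow> y \<in> space M \<Longrightarrow> ((\<lambda>\<tau>. g \<tau> y) has_real_derivative g' \<tau> y) (at \<tau>)"
    and B: "\<And>\<tau> y. \<bar>\<tau>\<bar> < \<delta> \<Longrightarrow> y \<in> space M \<Longrightarrow> \<bar>g' \<tau> y\<bar> \<le> B"
    and meas: "\<And>\<tau>. \<bar>\<tau>\<bar> < \<delta> \<Longrightarrow> g \<tau> \<in> borel_measurable M"
    and C: "\<And>\<tau> y. \<bar>\<tau>\<bar> < \<delta> \<Longrightarrow> y \<in> space M \<Longrightarrow> \<bar>g \<tau> y\<bar> \<le> C"
    and meas': "g' 0 \<in> borel_measurable M"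
  shows "((\<lambda>\<tau>. \<integral>y. u y * g \<tau> y \<partial>M) has_real_derivative (\<integral>y. u y * g' 0 y \<partial>M)) (at 0)"
  unfolding DERIV_def tendsto_at_iff_sequentially
proof (intro allI impI)
  fix X :: "nat \<Rightarrow> real"
  assume X0: "\<forall>i. X i \<in> UNIV - {0}" and X: "X \<longlonglongrightarrow> 0"
  have "\<forall>\<^sub>F n in sequentially. \<bar>X n\<bar> < \<delta>"
    using tendstoD[OF X \<delta>] by (simp add: dist_real_def)
  then obtain k where k: "\<And>n. n \<ge> k \<Longrightarrow> \<bar>X n\<bar> < \<delta>"
    by (auto simp: eventually_sequentially)
  \<comment> \<open>Dominated convergence asks for a bound on every term, so the finitely many steps
    that may lie outside the \<delta>-neighbourhood are dropped; \<open>LIMSEQ_offset\<close>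
    restores them at the end.\<close>
  define Y where "Y n = X (n + k)" for n
  have Y: "Y n \<noteq> 0" "\<bar>Y n\<bar> < \<delta>" "Y \<longlonglongrightarrow> 0" for n
    using X0 k LIMSEQ_ignore_initial_segment[OF X, of k] by (auto simp: Y_def[abs_def])
  have int: "integrable M (\<lambda>y. u y * g \<tau> y)" if "\<bar>\<tau>\<bar> < \<delta>" for \<tau>
    using integrable_mult_bounded[OF u meas C] that by auto
  have "(\<lambda>n. \<integral>y. u y * ((g (Y n) y - g 0 y) / Y n) \<partial>M) \<longlonglongrightarrow> (\<integral>y. u y * g' 0 y \<partial>M)"
  proof (rule integral_dominated_convergence)
    show "integrable M (\<lambda>y. B * \<bar>u y\<bar>)"
      using u by simp
    show "(\<lambda>y. u y * g' 0 y) \<in> borel_measurable M"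
      using u meas' by simp
    show "(\<lambda>y. u y * ((g (Y n) y - g 0 y) / Y n)) \<in> borel_measurable M" for n
      using u meas[OF Y(2)] meas[of 0] \<delta> by simp
    show "AE y in M. norm (u y * ((g (Y n) y - g 0 y) / Y n)) \<le> B * \<bar>u y\<bar>" for n
    proof (rule AE_I2)
      fix y assume y: "y \<in> space M"
      have "norm (g (Y n) y - g 0 y) \<le> B * norm (Y n - 0)"
      proof (rule field_differentiable_bound)
        show "convex {- \<delta><..<\<delta>}" by simp
        show "((\<lambda>\<tau>. g \<tau> y) has_real_derivative g' z y) (at z within {- \<delta><..<\<delta>})"
          if "z \<in> {- \<delta><..<\<delta>}" for z
          using g[of z y] y that by (simp add: has_field_derivative_at_within abs_less_iff)
        show "norm (g' z y) \<le> B" if "z \<in> {- \<delta><..<\<delta>}" for z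
          using B[of z y] y that by (simp add: abs_less_iff)
        show "Y n \<in> {- \<delta><..<\<delta>}" "0 \<in> {- \<delta><..<\<delta>}"
          using Y(2)[of n] \<delta> by auto
      qed
      then have "\<bar>(g (Y n) y - g 0 y) / Y n\<bar> \<le> B"
        using Y(1)[of n] by (simp add: field_simps)
      then have "\<bar>u y\<bar> * \<bar>(g (Y n) y - g 0 y) / Y n\<bar> \<le> \<bar>u y\<bar> * B"
        by (intro mult_left_mono) auto
      then show "norm (u y * ((g (Y n) y - g 0 y) / Y n)) \<le> B * \<bar>u y\<bar>"
        by (simp only: real_norm_def abs_mult mult.commute)
    qed
    show "AE y in M. (\<lambda>n. u y * ((g (Y n) y - g 0 y) / Y n)) \<longlonglongrightarrow> u y * g' 0 y"
    proof (rule AE_I2)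
      fix y assume y: "y \<in> space M"
      have "((\<lambda>h. (g (0 + h) y - g 0 y) / h) \<longlongrightarrow> g' 0 y) (at 0)"
        using g[OF _ y, of 0] \<delta> by (simp add: DERIV_def)
      then have "((\<lambda>h. (g (0 + h) y - g 0 y) / h) \<circ> Y) \<longlonglongrightarrow> g' 0 y"
        unfolding tendsto_at_iff_sequentially using Y by auto
      then show "(\<lambda>n. u y * ((g (Y n) y - g 0 y) / Y n)) \<longlonglongrightarrow> u y * g' 0 y"
        by (intro tendsto_mult tendsto_const) (simp add: o_def)
    qed
  qed
  moreover have "(\<integral>y. u y * ((g (Y n) y - g 0 y) / Y n) \<partial>M)
      = ((\<integral>y. u y * g (0 + Y n) y \<partial>M) - (\<integral>y. u y * g 0 y \<partial>M)) / Y n" for n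
    using int[OF Y(2)[of n]] int[of 0] \<delta> by (simp add: right_diff_distrib flip: Bochner_Integration.integral_diff)
  ultimately have "(\<lambda>n. ((\<lambda>h. ((\<integral>y. u y * g (0 + h) y \<partial>M) - (\<integral>y. u y * g 0 y \<partial>M)) / h) \<circ> X) (n + k))
      \<longlonglongrightarrow> (\<integral>y. u y * g' 0 y \<partial>M)"
    by (simp only: o_def Y_def)
  then show "((\<lambda>h. ((\<integral>y. u y * g (0 + h) y \<partial>M) - (\<integral>y. u y * g 0 y \<partial>M)) / h) \<circ> X)
      \<longlonglongrightarrow> (\<integral>y. u y * g' 0 y \<partial>M)"
    by (rule LIMSEQ_offset)
qed

text \<open>The kernel is not normalised: its integral is \<open>bump_mass\<close>, defined below.\<close>

definition mollify :: "'a::euclidean_space set \<Rightarrow> ('a \<Rightarrow> real) \<Rightarrow> 'a \<Rightarrow> real \<Rightarrow> real" where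
  "mollify \<Omega> u x t = (\<integral>y. u y * (bump 0 t (x - y) / t ^ DIM('a)) \<partial>lebesgue_on \<Omega>)"

lemma continuous_on_bump_path:
  fixes z :: "'b::topological_space \<Rightarrow> 'a::euclidean_space"
  assumes "continuous_on S z" "continuous_on S s" "\<And>\<tau>. \<tau> \<in> S \<Longrightarrow> s \<tau> \<noteq> 0"
  shows "continuous_on S (\<lambda>\<tau>. bump n (s \<tau>) (z \<tau>))"
  unfolding bump_def using assms by (auto intro!: continuous_intros)

text \<open>The affine field v - (w / t) (x - y) is the velocity of a point y whose ratio (x - y) /
  t stays fixed while (x, t) moves with velocity (v, w). The kernel is transported by this field, so
  by the continuity equation its derivative along the path is minus the divergence of kernel times
  field. The functions here are the components of that product, up to the factor
  \<open>t ^ DIM('a)\<close>.\<close>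

lemma grad_bump_mult_affine:
  fixes x y v b :: "'a::euclidean_space" and w t :: real
  assumes "0 < t"
  shows "grad (\<lambda>y. bump 0 t (x - y) * ((v - (w / t) *\<^sub>R (x - y)) \<bullet> b)) y
    = (((v - (w / t) *\<^sub>R (x - y)) \<bullet> b) * (bump 2 t (x - y) * 2 / t\<^sup>2)) *\<^sub>R (x - y)
        + (bump 0 t (x - y) * (w / t)) *\<^sub>R b"
proof (rule grad_eqI)
  have "GDERIV (\<lambda>y. (v - (w / t) *\<^sub>R (x - y)) \<bullet> b) y :> (w / t) *\<^sub>R b"
    unfolding gderiv_def using assms
    by (auto intro!: derivative_eq_intros simp: inner_diff_left inner_commute algebra_simps)
  from GDERIV_mult[OF GDERIV_bump[OF assms, of 0 x y] this]
  show "GDERIV (\<lambda>y. bump 0 t (x - y) * ((v - (w / t) *\<^sub>R (x - y)) \<bullet> b)) y :>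
      (((v - (w / t) *\<^sub>R (x - y)) \<bullet> b) * (bump 2 t (x - y) * 2 / t\<^sup>2)) *\<^sub>R (x - y)
        + (bump 0 t (x - y) * (w / t)) *\<^sub>R b"
    by (simp add: add.commute numeral_2_eq_2)
qed

text \<open>The right-hand side is \<open>- t ^ DIM('a)\<close> times the derivative at \<open>\<tau> = 0\<close> of the kernel
  \<open>bump 0 (t + \<tau> w) (x + \<tau> v - y) / (t + \<tau> w) ^ DIM('a)\<close>.\<close>

lemma bump_divergence_identity:
  fixes x y v :: "'a::euclidean_space" and w t :: real
  assumes "0 < t"
  shows "(\<Sum>b\<in>Basis. grad (\<lambda>y. bump 0 t (x - y) * ((v - (w / t) *\<^sub>R (x - y)) \<bullet> b)) y \<bullet> b)
    = - (bump 2 t (x - y) * (2 * ((x - y) \<bullet> (x - y)) * w / t ^ 3 - 2 * ((x - y) \<bullet> v) / t\<^sup>2)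
        - DIM('a) * w / t * bump 0 t (x - y))"
proof -
  define z where "z = x - y"
  define V where "V = v - (w / t) *\<^sub>R z"
  define c where "c = bump 2 t z * 2 / t\<^sup>2"
  define d where "d = bump 0 t z * (w / t)"
  have "(\<Sum>b\<in>Basis. grad (\<lambda>y. bump 0 t (x - y) * ((v - (w / t) *\<^sub>R (x - y)) \<bullet> b)) y \<bullet> b)
      = (\<Sum>b\<in>Basis. ((V \<bullet> b * c) *\<^sub>R z + d *\<^sub>R b) \<bullet> b)"
    unfolding grad_bump_mult_affine[OF assms] V_def c_def d_def z_def ..
  also have "\<dots> = c * (\<Sum>b\<in>Basis. (V \<bullet> b) * (z \<bullet> b)) + (\<Sum>b\<in>(Basis :: 'a set). d)"
    by (simp add: inner_add_left sum.distrib sum_distrib_left mult_ac)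
  also have "(\<Sum>b\<in>Basis. (V \<bullet> b) * (z \<bullet> b)) = V \<bullet> z"
    by (rule euclidean_inner[symmetric])
  also have "V \<bullet> z = z \<bullet> v - w / t * (z \<bullet> z)"
    by (simp add: V_def inner_diff_left inner_commute[of v z])
  finally show ?thesis
    unfolding sum_constant z_def[symmetric] c_def d_def
    by (rule trans) (use assms in \<open>simp add: field_simps power2_eq_square power3_eq_cube\<close>)
qed

lemma DERIV_bump_path:
  fixes x v y :: "'a::euclidean_space"
  assumes "0 < t + \<tau> * w"
  shows "((\<lambda>\<tau>. bump 0 (t + \<tau> * w) (x + \<tau> *\<^sub>R v - y) / (t + \<tau> * w) ^ n) has_real_derivative
    (bump 2 (t + \<tau> * w) (x + \<tau> *\<^sub>R v - y) *
       (2 * ((x + \<tau> *\<^sub>R v - y) \<bullet> (x + \<tau> *\<^sub>R v - y)) * w / (t + \<tau> * w) ^ 3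
        - 2 * ((x + \<tau> *\<^sub>R v - y) \<bullet> v) / (t + \<tau> * w)\<^sup>2)
     - real n * w / (t + \<tau> * w) * bump 0 (t + \<tau> * w) (x + \<tau> *\<^sub>R v - y)) / (t + \<tau> * w) ^ n) (at \<tau>)"
proof -
  let ?s = "t + \<tau> * w" and ?z = "x + \<tau> *\<^sub>R v - y"
  define b' where "b' = bump 2 ?s ?z * (2 * (?z \<bullet> ?z) * w / ?s ^ 3 - 2 * (?z \<bullet> v) / ?s\<^sup>2)"
  have "((\<lambda>\<tau>. (x + \<tau> *\<^sub>R v - y, t + \<tau> * w)) has_derivative (\<lambda>h. (h *\<^sub>R v, h * w))) (at \<tau>)"
    by (auto intro!: derivative_eq_intros)
  from has_derivative_compose[OF this has_derivative_bump[OF assms], of 0]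
  have "((\<lambda>\<tau>. bump 0 (t + \<tau> * w) (x + \<tau> *\<^sub>R v - y)) has_derivative
      (\<lambda>h. bump 2 ?s ?z * (2 * (?z \<bullet> ?z) * (h * w) / ?s ^ 3 - 2 * (?z \<bullet> (h *\<^sub>R v)) / ?s\<^sup>2))) (at \<tau>)"
    by (simp add: numeral_2_eq_2)
  then have "((\<lambda>\<tau>. bump 0 (t + \<tau> * w) (x + \<tau> *\<^sub>R v - y)) has_derivative (\<lambda>h. b' * h)) (at \<tau>)"
    unfolding b'_def
    by (rule has_derivative_eq_rhs) (simp add: fun_eq_iff algebra_simps)
  then have "((\<lambda>\<tau>. bump 0 (t + \<tau> * w) (x + \<tau> *\<^sub>R v - y)) has_real_derivative b') (at \<tau>)"
    by (simp add: has_field_derivative_def)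
  moreover have "((\<lambda>\<tau>. (t + \<tau> * w) ^ n) has_real_derivative real n * ?s ^ (n - 1) * w) (at \<tau>)"
    by (auto intro!: derivative_eq_intros)
  ultimately have "((\<lambda>\<tau>. bump 0 (t + \<tau> * w) (x + \<tau> *\<^sub>R v - y) / (t + \<tau> * w) ^ n) has_real_derivative
      (b' * ?s ^ n - bump 0 ?s ?z * (real n * ?s ^ (n - 1) * w)) / (?s ^ n * ?s ^ n)) (at \<tau>)"
    using assms by (intro DERIV_divide) auto
  moreover have "(b' * s ^ n - c * (real n * s ^ (n - 1) * w)) / (s ^ n * s ^ n) = (b' - real n * w / s * c) / s ^ n"
    if "s > 0" for s c :: real
    using that by (cases n) (simp_all add: field_simps)
  ultimately show ?thesis
    using assms unfolding b'_def by simp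
qed

text \<open>For small \<tau> all moved kernels live in one fixed compact ball inside \<Omega>, where
  a locally integrable \<open>u\<close> is integrable, and their scales stay away from 0.
  Differentiation under the integral can then use a single measure.\<close>

lemma cball_margin:
  fixes x v :: "'a::euclidean_space"
  assumes "open \<Omega>" "0 < t" "cball x t \<subseteq> \<Omega>"
  obtains \<delta> r where "0 < \<delta>" "cball x r \<subseteq> \<Omega>" "t \<le> r"
    "\<And>\<tau>. \<bar>\<tau>\<bar> \<le> \<delta> \<Longrightarrow> t / 2 \<le> t + \<tau> * w"
    "\<And>\<tau>. \<bar>\<tau>\<bar> \<le> \<delta> \<Longrightarrow> cball (x + \<tau> *\<^sub>R v) (t + \<tau> * w) \<subseteq> cball x r"
proof -
  obtain e where e: "0 < e" "(\<Union>y\<in>cball x t. cball y e) \<subseteq> \<Omega>"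
    using compact_subset_open_imp_cball_epsilon_subset[OF compact_cball assms(1,3)] by blast
  have sub: "cball x (t + e) \<subseteq> \<Omega>"
  proof
    fix y assume y: "y \<in> cball x (t + e)"
    show "y \<in> \<Omega>"
    proof (cases "y \<in> cball x t")
      case True
      then show ?thesis using assms(3) by blast
    next
      case False
      \<comment> \<open>The radial projection of y onto the sphere of radius \<open>t\<close>; it
        shows that the union of the small balls contains the enlarged ball.\<close>
      define z where "z = x + (t / dist x y) *\<^sub>R (y - x)"
      have d: "dist x y > t" "dist x y > 0" using False assms(2) by auto
      then have dz: "dist x z = t"
        using assms(2) by (simp add: z_def dist_norm norm_minus_commute)
      have "y - z = (1 - t / dist x y) *\<^sub>R (y - x)"
        by (simp add: z_def algebra_simps)
      then have "norm (y - z) = \<bar>1 - t / dist x y\<bar> * dist x y"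
        by (simp add: dist_norm norm_minus_commute)
      also have "\<dots> = dist x y - t"
        using d assms(2) by (simp add: field_simps)
      finally have "dist z y \<le> e"
        using y by (simp add: dist_norm norm_minus_commute)
      with dz show ?thesis
        using e(2) by force
    qed
  qed
  \<comment> \<open>Chosen so that the displacement of the centre plus the change of the radius is
    at most \<open>min (t / 2) e\<close>; the summand 1 covers v = 0 and w = 0.\<close>
  define \<delta> where "\<delta> = min (t / 2) e / (1 + norm v + \<bar>w\<bar>)"
  have \<delta>: "0 < \<delta>"
    using e(1) assms(2) by (auto simp: \<delta>_def intro!: divide_pos_pos add_pos_nonneg)
  have \<tau>: "\<bar>\<tau>\<bar> * (norm v + \<bar>w\<bar>) \<le> min (t / 2) e" if "\<bar>\<tau>\<bar> \<le> \<delta>" for \<tau>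
  proof -
    have "\<bar>\<tau>\<bar> * (norm v + \<bar>w\<bar>) \<le> \<delta> * (1 + norm v + \<bar>w\<bar>)"
      using that \<delta> by (intro mult_mono) auto
    also have "\<dots> = min (t / 2) e"
      by (simp add: \<delta>_def add_nonneg_eq_0_iff)
    finally show ?thesis .
  qed
  show thesis
  proof (rule that[OF \<delta> sub])
    show "t \<le> t + e" using e by simp
    fix \<tau> assume "\<bar>\<tau>\<bar> \<le> \<delta>"
    from \<tau>[OF this] have *: "\<bar>\<tau>\<bar> * norm v + \<bar>\<tau> * w\<bar> \<le> t / 2" "\<bar>\<tau>\<bar> * norm v + \<bar>\<tau> * w\<bar> \<le> e"
      by (simp_all add: distrib_left abs_mult)
    have "0 \<le> \<bar>\<tau>\<bar> * norm v" by simp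
    then show "t / 2 \<le> t + \<tau> * w" using *(1) by linarith
    show "cball (x + \<tau> *\<^sub>R v) (t + \<tau> * w) \<subseteq> cball x (t + e)"
    proof
      fix y assume "y \<in> cball (x + \<tau> *\<^sub>R v) (t + \<tau> * w)"
      moreover have "dist x y \<le> dist x (x + \<tau> *\<^sub>R v) + dist (x + \<tau> *\<^sub>R v) y"
        by (rule dist_triangle)
      moreover have "dist x (x + \<tau> *\<^sub>R v) = \<bar>\<tau>\<bar> * norm v"
        by (simp add: dist_norm)
      ultimately show "y \<in> cball x (t + e)"
        using *(2) by simp
    qed
  qed
qed

lemma mollify_eq_integral_on:
  assumes "\<Omega> \<in> sets lebesgue" "C \<in> sets lebesgue" "cball x t \<subseteq> C" "C \<subseteq> \<Omega>" "0 < t"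
  shows "mollify \<Omega> u x t = (\<integral>y. u y * (bump 0 t (x - y) / t ^ DIM('a)) \<partial>lebesgue_on (C :: 'a::euclidean_space set))"
  unfolding mollify_def
proof (rule lebesgue_on_support(2)[OF assms(2,1,4)])
  fix y assume "y \<in> \<Omega> - C"
  then have "y \<notin> cball x t"
    using assms(3) by blast
  then have "t \<le> norm (x - y)"
    by (simp add: dist_norm)
  then show "u y * (bump 0 t (x - y) / t ^ DIM('a)) = 0"
    using bump_eq_0[OF assms(5), of "x - y" 0] by simp
qed

text \<open>The continuity equation for the kernel lets the weak gradient take over the derivative,
  which becomes t^(- N) times the integral of Y \<bullet> Du. The field Y has length at most |v| +
  |w|, since the bump is at most 1 and |x - y| \<le> t on its support.\<close>

lemma DERIV_mollify_path:
  fixes \<Omega> :: "'a::euclidean_space set"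
  assumes "open \<Omega>" and grad: "has_weak_gradient \<Omega> u Du" and "0 < t" "cball x t \<subseteq> \<Omega>"
  shows "\<exists>D. ((\<lambda>\<tau>. mollify \<Omega> u (x + \<tau> *\<^sub>R v) (t + \<tau> * w)) has_real_derivative D) (at 0) \<and>
    \<bar>D\<bar> \<le> (norm v + \<bar>w\<bar>) / t ^ DIM('a) * (\<integral>y. norm (Du y) \<partial>lebesgue_on (cball x t))"
proof -
  let ?N = "DIM('a)"
  obtain \<delta> r where \<delta>: "0 < \<delta>" and r: "cball x r \<subseteq> \<Omega>" "t \<le> r"
    and pos: "\<And>\<tau>. \<bar>\<tau>\<bar> \<le> \<delta> \<Longrightarrow> t / 2 \<le> t + \<tau> * w"
    and sub: "\<And>\<tau>. \<bar>\<tau>\<bar> \<le> \<delta> \<Longrightarrow> cball (x + \<tau> *\<^sub>R v) (t + \<tau> * w) \<subseteq> cball x r"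
    using cball_margin[OF assms(1,3,4)] by metis
  define C where "C = cball x r"
  define M where "M = lebesgue_on C"
  have \<Omega>: "\<Omega> \<in> sets lebesgue" and C: "C \<in> sets lebesgue" "C \<subseteq> \<Omega>" "space M = C"
    using assms(1) r by (auto simp: C_def M_def intro: lmeasurable_cball)
  have tC: "cball x t \<subseteq> C"
    using r(2) by (auto simp: C_def)
  have meas: "h \<in> borel_measurable M" if "continuous_on C h" for h :: "'a \<Rightarrow> real"
    unfolding M_def by (rule continuous_imp_measurable_on_sets_lebesgue[OF that C(1)])
  have "u \<in> Lp 1 C" "Du \<in> Lp 1 C"
    using grad r(1) by (auto simp: has_weak_gradient_def Lp_loc_def C_def)
  then have u: "integrable M u" and Du: "integrable M Du"
    unfolding Lp_def M_def by (auto intro: integrable_norm_cancel)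
  define g where "g = (\<lambda>\<tau> y. bump 0 (t + \<tau> * w) (x + \<tau> *\<^sub>R v - y) / (t + \<tau> * w) ^ ?N)"
  define g' where "g' = (\<lambda>\<tau> y. (bump 2 (t + \<tau> * w) (x + \<tau> *\<^sub>R v - y) *
       (2 * ((x + \<tau> *\<^sub>R v - y) \<bullet> (x + \<tau> *\<^sub>R v - y)) * w / (t + \<tau> * w) ^ 3
        - 2 * ((x + \<tau> *\<^sub>R v - y) \<bullet> v) / (t + \<tau> * w)\<^sup>2)
     - real ?N * w / (t + \<tau> * w) * bump 0 (t + \<tau> * w) (x + \<tau> *\<^sub>R v - y)) / (t + \<tau> * w) ^ ?N)"
  \<comment> \<open>On this compact set of parameters and points the kernel and its derivative are
    jointly continuous, which yields the uniform bounds for differentiating under the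
    integral.\<close>
  define S where "S = {- \<delta>..\<delta>} \<times> C"
  have S: "compact S"
    by (simp add: S_def C_def compact_Times)
  have nz: "t + fst s * w \<noteq> 0" if "s \<in> S" for s
    using pos[of "fst s"] that assms(3) by (force simp: S_def abs_le_iff)
  have cont: "continuous_on S (\<lambda>s. g (fst s) (snd s))" "continuous_on S (\<lambda>s. g' (fst s) (snd s))"
    unfolding g_def g'_def
    by (intro continuous_intros continuous_on_bump_path; use nz in force)+
  have cont1: "continuous_on C (h \<tau>)" if h: "continuous_on S (\<lambda>s. h (fst s) (snd s))" and "\<bar>\<tau>\<bar> \<le> \<delta>"
    for h :: "real \<Rightarrow> 'a \<Rightarrow> real" and \<tau>
  proof -
    have "continuous_on C (\<lambda>y. (\<lambda>s. h (fst s) (snd s)) (\<tau>, y))"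
      using that(2) by (intro continuous_on_compose2[OF h]) (auto intro!: continuous_intros simp: S_def)
    then show ?thesis by simp
  qed
  have bdd: "\<exists>B. \<forall>\<tau> y. \<bar>\<tau>\<bar> < \<delta> \<longrightarrow> y \<in> C \<longrightarrow> \<bar>h \<tau> y\<bar> \<le> B"
    if "continuous_on S (\<lambda>s. h (fst s) (snd s))" for h :: "real \<Rightarrow> 'a \<Rightarrow> real"
  proof -
    have "bounded ((\<lambda>s. h (fst s) (snd s)) ` S)"
      by (rule compact_imp_bounded[OF compact_continuous_image[OF that S]])
    then obtain B where "\<And>s. s \<in> S \<Longrightarrow> \<bar>h (fst s) (snd s)\<bar> \<le> B"
      by (auto simp: bounded_iff)
    then have "\<bar>h \<tau> y\<bar> \<le> B" if "\<bar>\<tau>\<bar> < \<delta>" "y \<in> C" for \<tau> y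
      using that by (metis S_def SigmaI abs_le_iff atLeastAtMost_iff fst_conv less_imp_le minus_le_iff snd_conv)
    then show ?thesis by blast
  qed
  obtain B0 B1 where B: "\<And>\<tau> y. \<bar>\<tau>\<bar> < \<delta> \<Longrightarrow> y \<in> C \<Longrightarrow> \<bar>g \<tau> y\<bar> \<le> B0"
    "\<And>\<tau> y. \<bar>\<tau>\<bar> < \<delta> \<Longrightarrow> y \<in> C \<Longrightarrow> \<bar>g' \<tau> y\<bar> \<le> B1"
    using bdd[OF cont(1)] bdd[OF cont(2)] by blast
  have "((\<lambda>\<tau>. \<integral>y. u y * g \<tau> y \<partial>M) has_real_derivative (\<integral>y. u y * g' 0 y \<partial>M)) (at 0)"
  proof (rule DERIV_integral_param[OF u \<delta>])
    show "((\<lambda>\<tau>. g \<tau> y) has_real_derivative g' \<tau> y) (at \<tau>)" if "\<bar>\<tau>\<bar> < \<delta>" for \<tau> y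
      unfolding g_def g'_def
      by (rule DERIV_bump_path) (use pos[of \<tau>] that assms(3) in auto)
    show "g \<tau> \<in> borel_measurable M" if "\<bar>\<tau>\<bar> < \<delta>" for \<tau>
      using that by (intro meas cont1[OF cont(1)]) auto
    show "g' 0 \<in> borel_measurable M"
      using \<delta> by (intro meas cont1[OF cont(2)]) auto
  qed (use B C(3) in auto)
  moreover have "\<forall>\<^sub>F \<tau> in nhds 0. (\<integral>y. u y * g \<tau> y \<partial>M) = mollify \<Omega> u (x + \<tau> *\<^sub>R v) (t + \<tau> * w)"
  proof -
    have "\<forall>\<^sub>F \<tau> in nhds 0. \<tau> \<in> ball 0 \<delta>"
      using \<delta> by (intro eventually_nhds_in_open) auto
    then show ?thesis
    proof eventually_elim
      case (elim \<tau>)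
      then have "\<bar>\<tau>\<bar> \<le> \<delta>" by (simp add: dist_norm)
      then show ?case
        using mollify_eq_integral_on[OF \<Omega> C(1) _ C(2), of "x + \<tau> *\<^sub>R v" "t + \<tau> * w" u] sub[of \<tau>] pos[of \<tau>] assms(3)
        by (simp add: C_def M_def g_def)
    qed
  qed
  ultimately have "((\<lambda>\<tau>. mollify \<Omega> u (x + \<tau> *\<^sub>R v) (t + \<tau> * w)) has_real_derivative (\<integral>y. u y * g' 0 y \<partial>M)) (at 0)"
    by (rule DERIV_cong_ev[THEN iffD1, OF refl _ refl, rotated])
  moreover have "\<bar>\<integral>y. u y * g' 0 y \<partial>M\<bar> \<le> (norm v + \<bar>w\<bar>) / t ^ ?N * (\<integral>y. norm (Du y) \<partial>lebesgue_on (cball x t))"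
  proof -
    define Y where "Y = (\<lambda>y. bump 0 t (x - y) *\<^sub>R (v - (w / t) *\<^sub>R (x - y)))"
    define \<psi> where "\<psi> = (\<lambda>b y. bump 0 t (x - y) * ((v - (w / t) *\<^sub>R (x - y)) \<bullet> b))"
    have contY: "continuous_on C Y"
      unfolding Y_def using assms(3) by (intro continuous_intros continuous_on_bump) auto
    have g'0: "g' 0 y = - (\<Sum>b\<in>Basis. grad (\<psi> b) y \<bullet> b) / t ^ ?N" for y
      unfolding \<psi>_def bump_divergence_identity[OF assms(3)] by (simp add: g'_def)
    have test: "\<psi> b \<in> test_functions \<Omega>" for b
      unfolding \<psi>_def
    proof (rule test_functions_bump_mult[OF _ assms(3,4)])
      fix k
      have "C_k k (\<lambda>y. (v - (w / t) *\<^sub>R x) \<bullet> b + (w / t) * (y \<bullet> b))"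
        by (intro C_k_add C_k_mult C_k_const C_k_bounded_linear bounded_linear_inner_left)
      moreover have "(v - (w / t) *\<^sub>R (x - y)) \<bullet> b = (v - (w / t) *\<^sub>R x) \<bullet> b + (w / t) * (y \<bullet> b)" for y
        by (simp add: algebra_simps inner_diff_left)
      ultimately show "C_k k (\<lambda>y. (v - (w / t) *\<^sub>R (x - y)) \<bullet> b)"
        by simp
    qed
    have grad\<psi>: "grad (\<psi> b) y = (((v - (w / t) *\<^sub>R (x - y)) \<bullet> b) * (bump 2 t (x - y) * 2 / t\<^sup>2)) *\<^sub>R (x - y)
        + (bump 0 t (x - y) * (w / t)) *\<^sub>R b" for b y
      unfolding \<psi>_def by (rule grad_bump_mult_affine[OF assms(3)])
    have supp: "bump n t (x - y) = 0" if "y \<notin> cball x t" for n y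
      using that by (intro bump_eq_0[OF assms(3)]) (simp add: dist_norm)
    have suppY: "Y y = 0" if "y \<notin> cball x t" for y
      using supp[OF that] by (simp add: Y_def)
    have suppC: "Y y = 0" if "y \<notin> C" for y
      using suppY tC that by blast
    have cbdd: "\<exists>B. \<forall>y\<in>C. norm (h y) \<le> B" if "continuous_on C h" for h :: "'a \<Rightarrow> 'a"
      using compact_imp_bounded[OF compact_continuous_image[OF that]] by (auto simp: C_def bounded_iff)
    have meas': "h \<in> borel_measurable M" if "continuous_on C h" for h :: "'a \<Rightarrow> 'a"
      unfolding M_def by (rule continuous_imp_measurable_on_sets_lebesgue[OF that C(1)])
    have int\<psi>: "integrable M (\<lambda>y. u y *\<^sub>R grad (\<psi> b) y)" for b
    proof -
      have cont: "continuous_on C (grad (\<psi> b))"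
        unfolding grad\<psi>[abs_def] using assms(3) by (intro continuous_intros continuous_on_bump) auto
      then obtain B where B: "\<And>y. y \<in> C \<Longrightarrow> norm (grad (\<psi> b) y) \<le> B"
        using cbdd by blast
      show ?thesis
      proof (rule integrable_dominated[OF u])
        show "norm (u y *\<^sub>R grad (\<psi> b) y) \<le> B * norm (u y)" if "y \<in> space M" for y
          using mult_right_mono[OF B abs_ge_zero[of "u y"]] that C(3) by (simp add: mult.commute)
      qed (use u meas'[OF cont] in simp)
    qed
    obtain BY where BY: "\<And>y. y \<in> C \<Longrightarrow> norm (Y y) \<le> BY"
      using cbdd[OF contY] by blast
    have \<psi>Y: "\<psi> b y = Y y \<bullet> b" for b y
      by (simp add: \<psi>_def Y_def)
    have measY: "Y \<in> borel_measurable M"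
      by (rule meas'[OF contY])
    have YDu: "integrable M (\<lambda>y. (Y y \<bullet> b) *\<^sub>R Du y)" if "b \<in> Basis" for b
    proof (rule integrable_dominated[OF Du])
      show "norm ((Y y \<bullet> b) *\<^sub>R Du y) \<le> BY * norm (Du y)" if "y \<in> space M" for y
        using order_trans[OF Basis_le_norm[OF \<open>b \<in> Basis\<close>] BY] that C(3) by (auto intro: mult_right_mono)
    qed (use Du measY in simp)
    \<comment> \<open>Testing with \<open>\<psi> b\<close> gives a vector identity of which only the
      component along \<open>b\<close> is kept; summed over the basis, these components form the
      divergence.\<close>
    have weak: "(\<integral>y. u y * (grad (\<psi> b) y \<bullet> b) \<partial>M) = - (\<integral>y. (Y y \<bullet> b) * (Du y \<bullet> b) \<partial>M)"
      if b: "b \<in> Basis" for b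
    proof -
      have "(\<integral>y. u y *\<^sub>R grad (\<psi> b) y \<partial>lebesgue_on \<Omega>) = - (\<integral>y. \<psi> b y *\<^sub>R Du y \<partial>lebesgue_on \<Omega>)"
        using grad test unfolding has_weak_gradient_def by blast
      moreover have "(\<integral>y. u y *\<^sub>R grad (\<psi> b) y \<partial>lebesgue_on \<Omega>) = (\<integral>y. u y *\<^sub>R grad (\<psi> b) y \<partial>M)"
        unfolding M_def
      proof (rule lebesgue_on_support(2)[OF C(1) \<Omega> C(2)])
        fix y assume "y \<in> \<Omega> - C"
        then have "y \<notin> cball x t" using tC by blast
        then show "u y *\<^sub>R grad (\<psi> b) y = 0"
          unfolding grad\<psi> supp[OF \<open>y \<notin> cball x t\<close>] by simp
      qed
      moreover have "(\<integral>y. \<psi> b y *\<^sub>R Du y \<partial>lebesgue_on \<Omega>) = (\<integral>y. \<psi> b y *\<^sub>R Du y \<partial>M)"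
        unfolding M_def \<psi>Y
        by (rule lebesgue_on_support(2)[OF C(1) \<Omega> C(2)]) (use suppC in auto)
      ultimately have "(\<integral>y. u y *\<^sub>R grad (\<psi> b) y \<partial>M) \<bullet> b = - ((\<integral>y. (Y y \<bullet> b) *\<^sub>R Du y \<partial>M) \<bullet> b)"
        by (simp add: \<psi>Y)
      then show ?thesis
        using int\<psi>[of b] YDu[OF b] by (simp flip: integral_inner_left)
    qed
    have int1: "integrable M (\<lambda>y. u y * (grad (\<psi> b) y \<bullet> b))" for b
      using integrable_inner_left[OF int\<psi>, of b b] by simp
    have int2: "integrable M (\<lambda>y. (Y y \<bullet> b) * (Du y \<bullet> b))" if "b \<in> Basis" for b
      using integrable_inner_left[OF YDu[OF that], of b] by simp
    have "u y * g' 0 y = - (1 / t ^ ?N) * (\<Sum>b\<in>Basis. u y * (grad (\<psi> b) y \<bullet> b))" for y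
      unfolding g'0 sum_distrib_left[symmetric] by simp
    then have "(\<integral>y. u y * g' 0 y \<partial>M) = - (1 / t ^ ?N) * (\<integral>y. (\<Sum>b\<in>Basis. u y * (grad (\<psi> b) y \<bullet> b)) \<partial>M)"
      by (simp only: Bochner_Integration.integral_mult_right_zero)
    also have "(\<integral>y. (\<Sum>b\<in>Basis. u y * (grad (\<psi> b) y \<bullet> b)) \<partial>M) = (\<Sum>b\<in>Basis. \<integral>y. u y * (grad (\<psi> b) y \<bullet> b) \<partial>M)"
      by (rule Bochner_Integration.integral_sum[OF int1])
    also have "\<dots> = - (\<Sum>b\<in>Basis. \<integral>y. (Y y \<bullet> b) * (Du y \<bullet> b) \<partial>M)"
      by (simp add: weak sum_negf)
    also have "(\<Sum>b\<in>Basis. \<integral>y. (Y y \<bullet> b) * (Du y \<bullet> b) \<partial>M) = (\<integral>y. (\<Sum>b\<in>Basis. (Y y \<bullet> b) * (Du y \<bullet> b)) \<partial>M)"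
      by (rule Bochner_Integration.integral_sum[OF int2, symmetric])
    also have "\<dots> = (\<integral>y. Y y \<bullet> Du y \<partial>M)"
      by (simp only: euclidean_inner[symmetric])
    also have "\<dots> = (\<integral>y. Y y \<bullet> Du y \<partial>lebesgue_on (cball x t))"
      unfolding M_def by (rule lebesgue_on_support(2)) (use suppY tC C in \<open>auto intro: lmeasurable_cball simp del: mem_cball\<close>)
    finally have eq: "(\<integral>y. u y * g' 0 y \<partial>M) = 1 / t ^ ?N * (\<integral>y. Y y \<bullet> Du y \<partial>lebesgue_on (cball x t))"
      by simp
    have Yle: "norm (Y y) \<le> norm v + \<bar>w\<bar>" if "y \<in> cball x t" for y
    proof -
      have "norm ((w / t) *\<^sub>R (x - y)) \<le> \<bar>w\<bar> / t * t"
        using mult_left_mono[of "norm (x - y)" t "\<bar>w\<bar> / t"] that assms(3) by (simp add: dist_norm abs_divide)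
      then have "norm (v - (w / t) *\<^sub>R (x - y)) \<le> norm v + \<bar>w\<bar>"
        using norm_triangle_ineq4[of v "(w / t) *\<^sub>R (x - y)"] assms(3) by simp
      then have "bump 0 t (x - y) * norm (v - (w / t) *\<^sub>R (x - y)) \<le> 1 * (norm v + \<bar>w\<bar>)"
        using bump_nonneg[of 0 t "x - y"] bump_le[of 0 t "x - y"] by (intro mult_mono) auto
      then show ?thesis
        using bump_nonneg[of 0 t "x - y"] by (simp add: Y_def)
    qed
    have Dut: "integrable (lebesgue_on (cball x t)) Du"
      by (rule integrable_lebesgue_on_subset[OF Du[unfolded M_def] _ C(1) tC]) (auto intro: lmeasurable_cball)
    have le: "\<bar>Y y \<bullet> Du y\<bar> \<le> (norm v + \<bar>w\<bar>) * norm (Du y)" if "y \<in> cball x t" for y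
      using order_trans[OF Cauchy_Schwarz_ineq2 mult_right_mono[OF Yle[OF that] norm_ge_zero]] .
    have "Y \<in> borel_measurable (lebesgue_on (cball x t))"
      by (intro continuous_imp_measurable_on_sets_lebesgue continuous_on_subset[OF contY tC])
        (auto intro: lmeasurable_cball)
    then have YDut: "integrable (lebesgue_on (cball x t)) (\<lambda>y. Y y \<bullet> Du y)"
      by (intro integrable_dominated[OF Dut, where C = "norm v + \<bar>w\<bar>"]) (use Dut le in auto)
    have "\<bar>\<integral>y. Y y \<bullet> Du y \<partial>lebesgue_on (cball x t)\<bar> \<le> (\<integral>y. \<bar>Y y \<bullet> Du y\<bar> \<partial>lebesgue_on (cball x t))"
      by (rule integral_abs_bound)
    also have "\<dots> \<le> (\<integral>y. (norm v + \<bar>w\<bar>) * norm (Du y) \<partial>lebesgue_on (cball x t))"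
      using YDut Dut le by (intro integral_mono) auto
    also have "\<dots> = (norm v + \<bar>w\<bar>) * (\<integral>y. norm (Du y) \<partial>lebesgue_on (cball x t))"
      by simp
    finally show ?thesis
      unfolding eq using assms(3) by (simp add: abs_mult field_simps)
  qed
  ultimately show ?thesis by blast
qed

section \<open>Hoelder estimates along cones\<close>

text \<open>All that is retained of the differential inequality is the growth of the gradient
  integral. From here on the argument is of Morrey type and no longer sees \<open>p\<close>,
  \<open>q\<close> or the equation.\<close>

locale morrey_gradient =
  fixes \<Omega> :: "'a::euclidean_space set" and u :: "'a \<Rightarrow> real" and Du :: "'a \<Rightarrow> 'a" and M \<alpha> :: real
  assumes open_\<Omega>: "open \<Omega>" and weak_gradient: "has_weak_gradient \<Omega> u Du"
    and \<alpha>_pos: "0 < \<alpha>" and M_nonneg: "0 \<le> M"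
    and gradient_bound: "0 < t \<Longrightarrow> cball x (2 * t) \<subseteq> \<Omega> \<Longrightarrow>
      (\<integral>y. norm (Du y) \<partial>lebesgue_on (cball x t)) \<le> M * t powr (real DIM('a) - 1 + \<alpha>)"
begin

abbreviation F :: "'a \<Rightarrow> real \<Rightarrow> real" where
  "F \<equiv> mollify \<Omega> u"

text \<open>The kernel contributes t^(- N) and the gradient integral t^(N - 1 + \<alpha>), which
  leaves t^(\<alpha> - 1) at the current scale.\<close>

lemma DERIV_path:
  assumes "0 < t + \<tau> * w" "cball (x + \<tau> *\<^sub>R v) (2 * (t + \<tau> * w)) \<subseteq> \<Omega>"
  shows "\<exists>D. ((\<lambda>\<tau>. F (x + \<tau> *\<^sub>R v) (t + \<tau> * w)) has_real_derivative D) (at \<tau>) \<and>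
    \<bar>D\<bar> \<le> (norm v + \<bar>w\<bar>) * M * (t + \<tau> * w) powr (\<alpha> - 1)"
proof -
  let ?t = "t + \<tau> * w" and ?x = "x + \<tau> *\<^sub>R v"
  have "cball ?x ?t \<subseteq> \<Omega>"
    by (rule order_trans[OF subset_cball assms(2)]) (use assms(1) in simp)
  from DERIV_mollify_path[OF open_\<Omega> weak_gradient assms(1) this, of v w]
  obtain D where D: "((\<lambda>h. F (?x + h *\<^sub>R v) (?t + h * w)) has_real_derivative D) (at 0)"
    "\<bar>D\<bar> \<le> (norm v + \<bar>w\<bar>) / ?t ^ DIM('a) * (\<integral>y. norm (Du y) \<partial>lebesgue_on (cball ?x ?t))"
    by blast
  have "((\<lambda>h. (\<lambda>\<tau>. F (x + \<tau> *\<^sub>R v) (t + \<tau> * w)) (h + \<tau>)) has_real_derivative D) (at 0)"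
    using D(1) by (simp add: algebra_simps)
  then have "((\<lambda>\<tau>. F (x + \<tau> *\<^sub>R v) (t + \<tau> * w)) has_real_derivative D) (at (0 + \<tau>))"
    by (subst DERIV_shift)
  moreover have "\<bar>D\<bar> \<le> (norm v + \<bar>w\<bar>) * M * ?t powr (\<alpha> - 1)"
  proof -
    note D(2)
    also have "(norm v + \<bar>w\<bar>) / ?t ^ DIM('a) * (\<integral>y. norm (Du y) \<partial>lebesgue_on (cball ?x ?t))
        \<le> (norm v + \<bar>w\<bar>) / ?t ^ DIM('a) * (M * ?t powr (real DIM('a) - 1 + \<alpha>))"
      using assms(1) by (intro mult_left_mono gradient_bound[OF assms]) auto
    also have "\<dots> = (norm v + \<bar>w\<bar>) * M * (?t powr (real DIM('a) - 1 + \<alpha>) / ?t powr DIM('a))"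
      using assms(1) by (simp add: powr_realpow)
    also have "?t powr (real DIM('a) - 1 + \<alpha>) / ?t powr DIM('a) = ?t powr (\<alpha> - 1)"
      by (simp add: powr_diff[symmetric])
    finally show ?thesis .
  qed
  ultimately show ?thesis by auto
qed

text \<open>The derivative bound is integrated through a comparison function \<open>\<phi>\<close>
  whose derivative dominates it, so a mean value inequality takes the place of an integral along the
  path.\<close>

lemma path_bound:
  assumes "a \<le> b"
    and path: "\<And>\<tau>. a \<le> \<tau> \<Longrightarrow> \<tau> \<le> b \<Longrightarrow> 0 < t + \<tau> * w"
      "\<And>\<tau>. a \<le> \<tau> \<Longrightarrow> \<tau> \<le> b \<Longrightarrow> cball (x + \<tau> *\<^sub>R v) (2 * (t + \<tau> * w)) \<subseteq> \<Omega>"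
    and \<phi>: "\<And>\<tau>. a \<le> \<tau> \<Longrightarrow> \<tau> \<le> b \<Longrightarrow> (\<phi> has_real_derivative \<phi>' \<tau>) (at \<tau>)"
      "\<And>\<tau>. a \<le> \<tau> \<Longrightarrow> \<tau> \<le> b \<Longrightarrow> (norm v + \<bar>w\<bar>) * M * (t + \<tau> * w) powr (\<alpha> - 1) \<le> \<phi>' \<tau>"
  shows "\<bar>F (x + b *\<^sub>R v) (t + b * w) - F (x + a *\<^sub>R v) (t + a * w)\<bar> \<le> \<phi> b - \<phi> a"
proof (cases "a = b")
  case False
  define f where "f = (\<lambda>\<tau>. F (x + \<tau> *\<^sub>R v) (t + \<tau> * w))"
  have "\<forall>\<tau>\<in>{a..b}. \<exists>D. (f has_real_derivative D) (at \<tau>) \<and> \<bar>D\<bar> \<le> \<phi>' \<tau>"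
  proof
    fix \<tau> assume "\<tau> \<in> {a..b}"
    then have ab: "a \<le> \<tau>" "\<tau> \<le> b" by auto
    from DERIV_path[OF path[OF ab]] \<phi>(2)[OF ab]
    show "\<exists>D. (f has_real_derivative D) (at \<tau>) \<and> \<bar>D\<bar> \<le> \<phi>' \<tau>"
      unfolding f_def by (meson order_trans)
  qed
  then obtain D where D: "\<And>\<tau>. \<tau> \<in> {a..b} \<Longrightarrow> (f has_real_derivative D \<tau>) (at \<tau>)"
    "\<And>\<tau>. \<tau> \<in> {a..b} \<Longrightarrow> \<bar>D \<tau>\<bar> \<le> \<phi>' \<tau>"
    by metis
  have "norm (f b - f a) \<le> \<phi> b - \<phi> a"
  proof (rule differentiable_bound_general)
    show "a < b" using assms(1) False by simp
    show "continuous_on {a..b} f"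
      using D(1) by (intro continuous_at_imp_continuous_on ballI DERIV_isCont) blast
    show "continuous_on {a..b} \<phi>"
      using \<phi>(1) by (intro continuous_at_imp_continuous_on ballI DERIV_isCont) auto
    show "(f has_vector_derivative D \<tau>) (at \<tau>)" if "a < \<tau>" "\<tau> < b" for \<tau>
      using D(1)[of \<tau>] that by (simp add: has_real_derivative_iff_has_vector_derivative)
    show "(\<phi> has_vector_derivative \<phi>' \<tau>) (at \<tau>)" if "a < \<tau>" "\<tau> < b" for \<tau>
      using \<phi>(1)[of \<tau>] that by (simp add: has_real_derivative_iff_has_vector_derivative)
    show "norm (D \<tau>) \<le> \<phi>' \<tau>" if "a < \<tau>" "\<tau> < b" for \<tau>
      using D(2)[of \<tau>] that by simp
  qed
  then show ?thesis by (simp add: f_def)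
qed simp

lemma translation_bound:
  assumes "0 < t" "\<And>\<tau>. 0 \<le> \<tau> \<Longrightarrow> \<tau> \<le> 1 \<Longrightarrow> cball (x + \<tau> *\<^sub>R v) (2 * t) \<subseteq> \<Omega>"
  shows "\<bar>F (x + v) t - F x t\<bar> \<le> norm v * M * t powr (\<alpha> - 1)"
proof -
  have "\<bar>F (x + 1 *\<^sub>R v) (t + 1 * 0) - F (x + 0 *\<^sub>R v) (t + 0 * 0)\<bar>
      \<le> 1 * (norm v * M * t powr (\<alpha> - 1)) - 0 * (norm v * M * t powr (\<alpha> - 1))"
    by (rule path_bound[where \<phi> = "\<lambda>\<tau>. \<tau> * (norm v * M * t powr (\<alpha> - 1))"
          and \<phi>' = "\<lambda>_. norm v * M * t powr (\<alpha> - 1)"])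
      (use assms in \<open>auto intro!: derivative_eq_intros\<close>)
  then show ?thesis by simp
qed

text \<open>The comparison function is a multiple of \<tau>^\<alpha> / \<alpha>, bounded as
  \<open>S\<close> tends to 0 because \<alpha> > 0. The scale at height \<tau> is c \<tau>, whence
  the factor c^(\<alpha> - 1).\<close>

lemma cone_bound:
  assumes "0 < c" "norm e \<le> 1" "0 < S" "S \<le> T"
    and "\<And>\<tau>. S \<le> \<tau> \<Longrightarrow> \<tau> \<le> T \<Longrightarrow> cball (x + \<tau> *\<^sub>R e) (2 * (c * \<tau>)) \<subseteq> \<Omega>"
  shows "\<bar>F (x + T *\<^sub>R e) (c * T) - F (x + S *\<^sub>R e) (c * S)\<bar>
    \<le> (1 + c) * M * c powr (\<alpha> - 1) / \<alpha> * (T powr \<alpha> - S powr \<alpha>)"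
proof -
  define k where "k = (1 + c) * M * c powr (\<alpha> - 1)"
  have "\<bar>F (x + T *\<^sub>R e) (0 + T * c) - F (x + S *\<^sub>R e) (0 + S * c)\<bar> \<le> k / \<alpha> * T powr \<alpha> - k / \<alpha> * S powr \<alpha>"
  proof (rule path_bound[where \<phi> = "\<lambda>\<tau>. k / \<alpha> * \<tau> powr \<alpha>" and \<phi>' = "\<lambda>\<tau>. k * \<tau> powr (\<alpha> - 1)"])
    fix \<tau> assume \<tau>: "S \<le> \<tau>" "\<tau> \<le> T"
    then have "0 < \<tau>" using assms by simp
    show "((\<lambda>\<tau>. k / \<alpha> * \<tau> powr \<alpha>) has_real_derivative k * \<tau> powr (\<alpha> - 1)) (at \<tau>)"
      using \<open>0 < \<tau>\<close> \<alpha>_pos by (auto intro!: derivative_eq_intros)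
    have "(norm e + \<bar>c\<bar>) * (M * (\<tau> * c) powr (\<alpha> - 1)) \<le> (1 + c) * (M * (\<tau> * c) powr (\<alpha> - 1))"
      using assms M_nonneg by (intro mult_right_mono) auto
    then show "(norm e + \<bar>c\<bar>) * M * (0 + \<tau> * c) powr (\<alpha> - 1) \<le> k * \<tau> powr (\<alpha> - 1)"
      using \<open>0 < \<tau>\<close> assms by (simp add: k_def powr_mult mult_ac)
  qed (use assms in \<open>auto simp: mult_ac\<close>)
  then show ?thesis
    unfolding k_def[symmetric] by (simp add: right_diff_distrib mult.commute)
qed

section \<open>Limits of the mollifications at scale zero\<close>

lemma open_contains_cball_twice:
  assumes "x \<in> \<Omega>"
  obtains r where "0 < r" "cball x (2 * r) \<subseteq> \<Omega>"
proof -
  obtain e where "e > 0" "cball x e \<subseteq> \<Omega>"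
    using assms open_\<Omega> open_contains_cball by blast
  then show thesis
    by (intro that[of "e / 2"]) auto
qed

lemma vertical_bound:
  assumes "0 < s" "s \<le> t" "cball x (2 * t) \<subseteq> \<Omega>"
  shows "\<bar>F x t - F x s\<bar> \<le> 2 * M / \<alpha> * (t powr \<alpha> - s powr \<alpha>)"
  using cone_bound[of 1 0 s t x] assms by (force simp: subset_iff)

text \<open>A single \<open>L\<close> has to serve all admissible scales. It is found along one
  geometric sequence of scales, where the vertical bound gives the Cauchy property; an arbitrary
  \<open>t\<close> is then compared with the terms below it.\<close>

lemma limit_exists:
  assumes "x \<in> \<Omega>"
  shows "\<exists>L. \<forall>t. 0 < t \<longrightarrow> cball x (2 * t) \<subseteq> \<Omega> \<longrightarrow> \<bar>F x t - L\<bar> \<le> 2 * M / \<alpha> * t powr \<alpha>"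
proof -
  obtain r where r: "0 < r" "cball x (2 * r) \<subseteq> \<Omega>"
    using open_contains_cball_twice[OF assms] .
  define k where "k = 2 * M / \<alpha>"
  have k: "0 \<le> k" using M_nonneg \<alpha>_pos by (simp add: k_def)
  define s where "s n = r * (1 / 2) ^ n" for n :: nat
  have s: "0 < s n" "s n \<le> r" for n
    using r(1) by (auto simp: s_def power_le_one)
  have anti: "s n \<le> s m" if "m \<le> n" for m n
    using r(1) that by (simp add: s_def power_decreasing)
  have s0: "s \<longlonglongrightarrow> 0"
    unfolding s_def by (intro tendsto_mult_right_zero LIMSEQ_realpow_zero) auto
  then have sa: "(\<lambda>n. s n powr \<alpha>) \<longlonglongrightarrow> 0"
    using \<alpha>_pos tendsto_powr2[OF s0 tendsto_const, of \<alpha>] less_imp_le[OF s(1)] by simp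
  have sub: "cball x (2 * t) \<subseteq> \<Omega>" if "t \<le> r" for t
    using r(2) that by (auto simp: subset_iff)
  have diff: "\<bar>F x (s m) - F x (s n)\<bar> \<le> k * s m powr \<alpha>" if "m \<le> n" for m n
  proof -
    have "\<bar>F x (s m) - F x (s n)\<bar> \<le> k * (s m powr \<alpha> - s n powr \<alpha>)"
      unfolding k_def using s anti[OF that] sub by (intro vertical_bound) auto
    also have "\<dots> \<le> k * s m powr \<alpha>"
      using k by (intro mult_left_mono) auto
    finally show ?thesis .
  qed
  have "Cauchy (\<lambda>n. F x (s n))"
    unfolding Cauchy_altdef2
  proof (intro allI impI)
    fix e :: real assume "e > 0"
    have "(\<lambda>n. k * s n powr \<alpha>) \<longlonglongrightarrow> 0"
      using sa by (rule tendsto_mult_right_zero)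
    then have "\<forall>\<^sub>F n in sequentially. k * s n powr \<alpha> < e"
      using \<open>e > 0\<close> by (rule order_tendstoD)
    then obtain N where "k * s N powr \<alpha> < e"
      by (auto simp: eventually_sequentially)
    then show "\<exists>N. \<forall>n\<ge>N. dist (F x (s n)) (F x (s N)) < e"
      using diff[of N] by (intro exI[of _ N]) (auto simp: dist_real_def abs_minus_commute[of _ "F x (s N)"] intro: le_less_trans)
  qed
  then obtain L where L: "(\<lambda>n. F x (s n)) \<longlonglongrightarrow> L"
    by (auto simp: Cauchy_convergent_iff convergent_def)
  have "\<bar>F x t - L\<bar> \<le> k * t powr \<alpha>" if t: "0 < t" "cball x (2 * t) \<subseteq> \<Omega>" for t
  proof (rule tendsto_upperbound)
    show "(\<lambda>n. \<bar>F x t - F x (s n)\<bar>) \<longlonglongrightarrow> \<bar>F x t - L\<bar>"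
      by (intro tendsto_intros L)
    have "\<forall>\<^sub>F n in sequentially. s n < t"
      using s0 t(1) by (rule order_tendstoD)
    then show "\<forall>\<^sub>F n in sequentially. \<bar>F x t - F x (s n)\<bar> \<le> k * t powr \<alpha>"
    proof eventually_elim
      case (elim n)
      then have "\<bar>F x t - F x (s n)\<bar> \<le> k * (t powr \<alpha> - s n powr \<alpha>)"
        unfolding k_def using s t by (intro vertical_bound) auto
      also have "\<dots> \<le> k * t powr \<alpha>"
        using k by (intro mult_left_mono) auto
      finally show ?case .
    qed
  qed simp
  then show ?thesis
    unfolding k_def by blast
qed

text \<open>For \<open>x\<close> in \<Omega> the bound determines this value: it is the limit of
  \<open>F x t\<close> as \<open>t\<close> tends to 0. Because the kernel is not normalised, it is
  \<open>bump_mass\<close> times the continuous representative of \<open>u\<close>, once that is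
  shown to exist.\<close>

definition limit_value :: "'a \<Rightarrow> real" where
  "limit_value x = (SOME L. \<forall>t. 0 < t \<longrightarrow> cball x (2 * t) \<subseteq> \<Omega> \<longrightarrow> \<bar>F x t - L\<bar> \<le> 2 * M / \<alpha> * t powr \<alpha>)"

lemma limit_value_bound:
  assumes "0 < t" "cball x (2 * t) \<subseteq> \<Omega>"
  shows "\<bar>F x t - limit_value x\<bar> \<le> 2 * M / \<alpha> * t powr \<alpha>"
proof -
  have "x \<in> \<Omega>"
    using assms by auto
  from someI_ex[OF limit_exists[OF this]] show ?thesis
    using assms unfolding limit_value_def by blast
qed

text \<open>Near the boundary the vertical segment above \<open>x\<close> is admissible only for
  tiny scales, while the cone reaches scale \<open>c * T\<close>. Both have the same limit: at
  height S a horizontal move of length at most S costs a multiple of S (c S)^(\<alpha> - 1), which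
  tends to 0.\<close>

lemma cone_limit_bound:
  assumes "0 < c" "norm e \<le> 1" "0 < T" "x \<in> \<Omega>"
    and cone: "\<And>\<tau>. 0 < \<tau> \<Longrightarrow> \<tau> \<le> T \<Longrightarrow> cball (x + \<tau> *\<^sub>R e) (2 * (c * \<tau>)) \<subseteq> \<Omega>"
  shows "\<bar>F (x + T *\<^sub>R e) (c * T) - limit_value x\<bar> \<le> (1 + c) * M * c powr (\<alpha> - 1) / \<alpha> * T powr \<alpha>"
proof -
  define k where "k = (1 + c) * M * c powr (\<alpha> - 1) / \<alpha>"
  have k: "0 \<le> k" using M_nonneg \<alpha>_pos assms by (simp add: k_def)
  obtain r where r: "0 < r" "cball x (2 * r) \<subseteq> \<Omega>"
    using open_contains_cball_twice[OF assms(4)] .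
  define E where "E S = M * c powr (\<alpha> - 1) * S powr \<alpha> + 2 * M / \<alpha> * (c * S) powr \<alpha>" for S
  have "((\<lambda>S. k * T powr \<alpha> + E S) \<longlongrightarrow> k * T powr \<alpha> + 0) (at_right 0)"
  proof (intro tendsto_add tendsto_const)
    have p: "((\<lambda>S::real. S powr \<alpha>) \<longlongrightarrow> 0) (at_right 0)"
      using tendsto_powr2[of "\<lambda>S. S" 0 "at_right 0" "\<lambda>_. \<alpha>" \<alpha>] \<alpha>_pos
      by (auto simp: eventually_at_filter)
    have "E = (\<lambda>S. (M * c powr (\<alpha> - 1) + 2 * M / \<alpha> * c powr \<alpha>) * S powr \<alpha>)"
      by (auto simp: E_def fun_eq_iff powr_mult distrib_right)
    then show "(E \<longlongrightarrow> 0) (at_right 0)"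
      using tendsto_mult_right_zero[OF p] by simp
  qed
  moreover have "\<forall>\<^sub>F S in at_right 0. \<bar>F (x + T *\<^sub>R e) (c * T) - limit_value x\<bar> \<le> k * T powr \<alpha> + E S"
  proof -
    \<comment> \<open>The bound by \<open>r / (1 + c)\<close> keeps the horizontal move of length S,
      together with balls of radius 2 c S, inside the ball of radius 2 r.\<close>
    have "\<forall>\<^sub>F S in at_right 0. S < min T (r / (1 + c))"
      using assms r by (intro order_tendstoD(2)[OF tendsto_ident_at]) auto
    moreover have "\<forall>\<^sub>F S::real in at_right 0. 0 < S"
      by (simp add: eventually_at_filter)
    ultimately show ?thesis
    proof eventually_elim
      case (elim S)
      then have S: "0 < S" "S \<le> T" "S * (1 + c) \<le> r"
        using assms(1) by (auto simp: field_simps)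
      have cs: "0 \<le> c * S" using S assms by simp
      have sub: "cball x (2 * (c * S)) \<subseteq> \<Omega>"
        using r(2) S cs by (auto simp: subset_iff distrib_left mult.commute)
      have tr: "\<bar>F (x + S *\<^sub>R e) (c * S) - F x (c * S)\<bar> \<le> norm (S *\<^sub>R e) * M * (c * S) powr (\<alpha> - 1)"
      proof (rule translation_bound)
        show "0 < c * S" using S assms by simp
        fix \<tau> :: real assume \<tau>: "0 \<le> \<tau>" "\<tau> \<le> 1"
        have "norm (\<tau> *\<^sub>R (S *\<^sub>R e)) \<le> 1 * (S * 1)"
          unfolding norm_scaleR using \<tau> S assms(2) by (intro mult_mono) auto
        then have *: "norm (\<tau> *\<^sub>R (S *\<^sub>R e)) \<le> S" by simp
        show "cball (x + \<tau> *\<^sub>R (S *\<^sub>R e)) (2 * (c * S)) \<subseteq> \<Omega>"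
        proof
          fix y assume y: "y \<in> cball (x + \<tau> *\<^sub>R (S *\<^sub>R e)) (2 * (c * S))"
          have "dist x y \<le> dist x (x + \<tau> *\<^sub>R (S *\<^sub>R e)) + dist (x + \<tau> *\<^sub>R (S *\<^sub>R e)) y"
            by (rule dist_triangle)
          also have "\<dots> \<le> S + 2 * (c * S)"
            using y * by (intro add_mono) (auto simp: dist_norm)
          also have "\<dots> \<le> 2 * r"
            using S cs r(1) by (simp add: distrib_left mult.commute)
          finally show "y \<in> \<Omega>" using r(2) by auto
        qed
      qed
      also have "\<dots> \<le> S * M * (c * S) powr (\<alpha> - 1)"
        using S assms(2) M_nonneg mult_left_mono[OF assms(2), of S] by (intro mult_right_mono) auto
      also have "\<dots> = M * c powr (\<alpha> - 1) * S powr \<alpha>"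
        using S assms(1) by (simp add: powr_mult powr_diff)
      finally have 1: "\<bar>F (x + S *\<^sub>R e) (c * S) - F x (c * S)\<bar> \<le> M * c powr (\<alpha> - 1) * S powr \<alpha>" .
      have 2: "\<bar>F x (c * S) - limit_value x\<bar> \<le> 2 * M / \<alpha> * (c * S) powr \<alpha>"
        using S assms(1) by (intro limit_value_bound sub) auto
      have "\<bar>F (x + T *\<^sub>R e) (c * T) - F (x + S *\<^sub>R e) (c * S)\<bar> \<le> k * (T powr \<alpha> - S powr \<alpha>)"
        unfolding k_def using S assms by (intro cone_bound cone) auto
      also have "\<dots> \<le> k * T powr \<alpha>"
        using k by (intro mult_left_mono) auto
      finally have 3: "\<bar>F (x + T *\<^sub>R e) (c * T) - F (x + S *\<^sub>R e) (c * S)\<bar> \<le> k * T powr \<alpha>" .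
      from 1 2 3 show ?case
        unfolding E_def by linarith
    qed
  qed
  ultimately have "\<bar>F (x + T *\<^sub>R e) (c * T) - limit_value x\<bar> \<le> k * T powr \<alpha> + 0"
    by (rule tendsto_lowerbound) simp
  then show ?thesis by (simp add: k_def)
qed

text \<open>The translation at the top has length |x - y| and costs a multiple of |x - y|^(\<alpha>
  - 1) per unit length, the same order as climbing the two cones. Keeping \<open>c\<close>,
  \<open>k\<close> and \<open>e\<close> general covers interior points (\<open>e = 0\<close>,
  \<open>c = k = 1\<close>) and boundary points alike.\<close>

lemma two_point_bound:
  assumes "0 < c" "0 < k" "norm e \<le> 1" "x \<in> \<Omega>" "y \<in> \<Omega>"
    and x: "\<And>\<tau>. 0 < \<tau> \<Longrightarrow> \<tau> \<le> k * dist x y \<Longrightarrow> cball (x + \<tau> *\<^sub>R e) (2 * (c * \<tau>)) \<subseteq> \<Omega>"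
    and y: "\<And>\<tau>. 0 < \<tau> \<Longrightarrow> \<tau> \<le> k * dist x y \<Longrightarrow> cball (y + \<tau> *\<^sub>R e) (2 * (c * \<tau>)) \<subseteq> \<Omega>"
    and xy: "\<And>s. 0 \<le> s \<Longrightarrow> s \<le> 1 \<Longrightarrow>
      cball (x + s *\<^sub>R (y - x) + (k * dist x y) *\<^sub>R e) (2 * (c * (k * dist x y))) \<subseteq> \<Omega>"
  shows "\<bar>limit_value x - limit_value y\<bar>
    \<le> M * (2 * (1 + c) * c powr (\<alpha> - 1) / \<alpha> * k powr \<alpha> + (c * k) powr (\<alpha> - 1)) * dist x y powr \<alpha>"
proof (cases "x = y")
  case False
  define d where "d = dist x y"
  define T where "T = k * d"
  have d: "0 < d" and T: "0 < T"
    using False assms by (auto simp: d_def T_def)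
  have "\<bar>F (x + T *\<^sub>R e) (c * T) - limit_value x\<bar> \<le> (1 + c) * M * c powr (\<alpha> - 1) / \<alpha> * T powr \<alpha>"
    "\<bar>F (y + T *\<^sub>R e) (c * T) - limit_value y\<bar> \<le> (1 + c) * M * c powr (\<alpha> - 1) / \<alpha> * T powr \<alpha>"
    by (rule cone_limit_bound[OF assms(1,3) T assms(4) x[folded d_def, folded T_def]]
        cone_limit_bound[OF assms(1,3) T assms(5) y[folded d_def, folded T_def]]; assumption)+
  moreover have "\<bar>F ((x + T *\<^sub>R e) + (y - x)) (c * T) - F (x + T *\<^sub>R e) (c * T)\<bar> \<le> norm (y - x) * M * (c * T) powr (\<alpha> - 1)"
  proof (rule translation_bound)
    show "0 < c * T" using assms T by simp
    show "cball (x + T *\<^sub>R e + s *\<^sub>R (y - x)) (2 * (c * T)) \<subseteq> \<Omega>" if "0 \<le> s" "s \<le> 1" for s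
      using xy[OF that] by (simp add: T_def d_def algebra_simps)
  qed
  moreover have "(x + T *\<^sub>R e) + (y - x) = y + T *\<^sub>R e"
    by simp
  ultimately have "\<bar>limit_value x - limit_value y\<bar>
      \<le> 2 * ((1 + c) * M * c powr (\<alpha> - 1) / \<alpha> * T powr \<alpha>) + d * M * (c * T) powr (\<alpha> - 1)"
    by (simp only: d_def dist_norm norm_minus_commute[of x y])
  also have "T powr \<alpha> = k powr \<alpha> * d powr \<alpha>"
    using assms d by (simp add: T_def powr_mult)
  also have "d * M * (c * T) powr (\<alpha> - 1) = M * (c * k) powr (\<alpha> - 1) * d powr \<alpha>"
    using assms d by (simp add: T_def powr_mult powr_diff)
  also have "2 * ((1 + c) * M * c powr (\<alpha> - 1) / \<alpha> * (k powr \<alpha> * d powr \<alpha>)) + M * (c * k) powr (\<alpha> - 1) * d powr \<alpha>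
    = M * (2 * (1 + c) * c powr (\<alpha> - 1) / \<alpha> * k powr \<alpha> + (c * k) powr (\<alpha> - 1)) * d powr \<alpha>"
    by (simp add: algebra_simps)
  finally show ?thesis by (simp add: d_def)
qed simp

end

section \<open>Geometry of Lipschitz domains\<close>

text \<open>Around interior points the cones degenerate to vertical segments. The radius R / 8
  suffices because R / 8 + R / 4 + R / 2 < R: distance to the centre, distance between the points,
  radius of the largest ball.\<close>

lemma interior_cone:
  fixes x0 :: "'a::euclidean_space"
  assumes "0 < R" "ball x0 R \<subseteq> \<Omega>" "x \<in> ball x0 (R / 8)" "y \<in> ball x0 (R / 8)"
  shows "0 < \<tau> \<Longrightarrow> \<tau> \<le> dist x y \<Longrightarrow> cball x (2 * \<tau>) \<subseteq> \<Omega>"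
    and "0 \<le> s \<Longrightarrow> s \<le> 1 \<Longrightarrow> cball (x + s *\<^sub>R (y - x)) (2 * dist x y) \<subseteq> \<Omega>"
proof -
  have d: "dist x y < R / 4"
    using dist_triangle_less_add[of x x0 "R / 8" y "R / 8"] assms(3,4) by (simp add: dist_commute)
  have *: "cball z (2 * \<tau>) \<subseteq> \<Omega>" if "dist x z \<le> dist x y" "\<tau> \<le> dist x y" for z \<tau>
  proof
    fix w assume "w \<in> cball z (2 * \<tau>)"
    then have "dist z w \<le> R / 2"
      using that d by simp
    moreover have "dist x0 w \<le> dist x0 x + dist x z + dist z w"
      by (meson add_right_mono dist_triangle order_trans)
    ultimately have "dist x0 w < R"
      using that d assms(1,3) by simp
    then show "w \<in> \<Omega>" using assms(2) by auto
  qed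
  show "0 < \<tau> \<Longrightarrow> \<tau> \<le> dist x y \<Longrightarrow> cball x (2 * \<tau>) \<subseteq> \<Omega>"
    by (rule *) auto
  show "cball (x + s *\<^sub>R (y - x)) (2 * dist x y) \<subseteq> \<Omega>" if "0 \<le> s" "s \<le> 1"
  proof (rule *)
    have "s * norm (x - y) \<le> 1 * norm (x - y)"
      using that by (intro mult_right_mono) auto
    then show "dist x (x + s *\<^sub>R (y - x)) \<le> dist x y"
      using that by (simp add: dist_norm norm_minus_commute)
  qed simp
qed

lemma norm_orthogonal_projection_le:
  fixes b e :: "'a::euclidean_space"
  assumes "norm e = 1"
  shows "norm (b - (b \<bullet> e) *\<^sub>R e) \<le> norm b"
proof -
  have "(norm (b - (b \<bullet> e) *\<^sub>R e))\<^sup>2 = (norm b)\<^sup>2 - (b \<bullet> e)\<^sup>2"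
    using assms unfolding norm_eq_1 power2_norm_eq_inner
    by (simp add: inner_diff_left inner_diff_right inner_commute[of e b] power2_eq_square)
  then have "(norm (b - (b \<bullet> e) *\<^sub>R e))\<^sup>2 \<le> (norm b)\<^sup>2"
    using zero_le_power2[of "b \<bullet> e"] by linarith
  then show ?thesis
    by (rule power2_le_imp_le) simp
qed

text \<open>Moving by \<open>b\<close> raises the graph by at most L |b| and lowers the point by at
  most |b|; lifting by \<tau> \<ge> (1 + L) |b| compensates for both.\<close>

lemma epigraph_translate:
  fixes x b e :: "'a::euclidean_space"
  assumes e: "norm e = 1" and lip: "L-lipschitz_on {y. y \<bullet> e = 0} \<gamma>"
    and x: "\<gamma> (x - (x \<bullet> e) *\<^sub>R e) < x \<bullet> e" and b: "(1 + L) * norm b \<le> \<tau>"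
    and z: "z = x + \<tau> *\<^sub>R e + b"
  shows "\<gamma> (z - (z \<bullet> e) *\<^sub>R e) < z \<bullet> e"
proof -
  let ?P = "\<lambda>w. w - (w \<bullet> e) *\<^sub>R e"
  have ee: "e \<bullet> e = 1" using e by (simp add: norm_eq_1)
  have P0: "?P w \<in> {y. y \<bullet> e = 0}" for w
    by (simp add: inner_diff_left ee)
  have "?P z - ?P x = ?P b"
    by (simp add: z inner_add_left ee algebra_simps)
  then have "dist (\<gamma> (?P z)) (\<gamma> (?P x)) \<le> L * norm (?P b)"
    using lipschitz_onD[OF lip P0 P0, of z x] by (simp add: dist_norm)
  also have "\<dots> \<le> L * norm b"
    using lipschitz_on_nonneg[OF lip] norm_orthogonal_projection_le[OF e] by (intro mult_left_mono)
  finally have "\<gamma> (?P z) \<le> \<gamma> (?P x) + L * norm b"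
    by (simp add: dist_real_def)
  moreover have "\<bar>b \<bullet> e\<bar> \<le> norm b"
    using Cauchy_Schwarz_ineq2[of b e] e by simp
  moreover have "z \<bullet> e = x \<bullet> e + \<tau> + b \<bullet> e"
    by (simp add: z inner_add_left ee)
  ultimately show ?thesis
    using x b by (simp add: distrib_right)
qed

text \<open>With c = 1 / k and k = 4 (1 + L), a ball of radius 2 c \<tau> uses up \<tau> / 2 of the
  lift \<tau>, and a horizontal shift by |x - y| at the top height \<tau> = k |x - y| another \<tau>
  / 4. The choice of \<open>r\<close> keeps everything in the chart: r + 3 k r + 2 r \<le> 4 (1 + k)
  r = R.\<close>

lemma boundary_cone:
  fixes x0 :: "'a::euclidean_space"
  assumes R: "0 < R" and e: "norm e = 1" and lip: "L-lipschitz_on {y. y \<bullet> e = 0} \<gamma>"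
    and graph: "\<Omega> \<inter> ball x0 R = {x \<in> ball x0 R. \<gamma> (x - (x \<bullet> e) *\<^sub>R e) < x \<bullet> e}"
    and k: "k = 4 * (1 + L)" and c: "c = 1 / k" and r: "r = R / (4 * (1 + k))"
    and x: "x \<in> \<Omega> \<inter> ball x0 r" and y: "y \<in> \<Omega> \<inter> ball x0 r"
  shows "0 < \<tau> \<Longrightarrow> \<tau> \<le> k * dist x y \<Longrightarrow> cball (x + \<tau> *\<^sub>R e) (2 * (c * \<tau>)) \<subseteq> \<Omega>"
    and "0 \<le> s \<Longrightarrow> s \<le> 1 \<Longrightarrow>
      cball (x + s *\<^sub>R (y - x) + (k * dist x y) *\<^sub>R e) (2 * (c * (k * dist x y))) \<subseteq> \<Omega>"
proof -
  have L: "0 \<le> L"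
    by (rule lipschitz_on_nonneg[OF lip])
  have k4: "4 \<le> k" and kc: "k * c = 1" and Lc: "(1 + L) * c = 1 / 4" and c4: "c \<le> 1 / 4" "0 < c"
    using L by (auto simp: k c field_simps)
  have rR: "r * (4 * (1 + k)) = R" and r0: "0 < r"
    using k4 R by (auto simp: r)
  have d: "dist x y < 2 * r"
    using dist_triangle_less_add[of x x0 r y r] x y by (simp add: dist_commute)
  have rR': "r \<le> R"
    using rR mult_left_mono[of 1 "4 * (1 + k)" r] r0 k4 by simp
  \<comment> \<open>Shared by both claims: the first bound on \<open>b\<close> keeps w in the chart
    ball, the second puts it above the graph.\<close>
  have *: "w \<in> \<Omega>" if \<tau>: "0 \<le> \<tau>" "\<tau> \<le> k * dist x y" and "norm b \<le> dist x y + 2 * (c * \<tau>)"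
    and "(1 + L) * norm b \<le> \<tau>" and w: "w = x + \<tau> *\<^sub>R e + b" for b \<tau> w
  proof -
    have "x \<in> ball x0 R" using x rR' by auto
    then have "\<gamma> (x - (x \<bullet> e) *\<^sub>R e) < x \<bullet> e"
      using x graph by blast
    from epigraph_translate[OF e lip this that(4) w]
    have "\<gamma> (w - (w \<bullet> e) *\<^sub>R e) < w \<bullet> e" .
    moreover have "w \<in> ball x0 R"
    proof -
      have "dist x0 w \<le> dist x0 x + dist x w"
        by (rule dist_triangle)
      moreover have "dist x w \<le> norm (\<tau> *\<^sub>R e) + norm b"
        unfolding w dist_norm using norm_triangle_ineq[of "- (\<tau> *\<^sub>R e)" "- b"] by simp
      moreover have "norm (\<tau> *\<^sub>R e) = \<tau>"
        using e \<tau> by simp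
      moreover have "2 * (c * \<tau>) \<le> \<tau> / 2"
        using mult_right_mono[OF c4(1) \<tau>(1)] by simp
      moreover have "k * dist x y \<le> k * (2 * r)"
        using d k4 by (intro mult_left_mono) auto
      moreover have "dist x0 x < r" using x by simp
      ultimately have "dist x0 w < r + 3 / 2 * (k * (2 * r)) + 2 * r"
        using \<tau> that(3) d by linarith
      also have "\<dots> \<le> R"
        unfolding rR[symmetric] using r0 k4 by (simp add: algebra_simps)
      finally show ?thesis by simp
    qed
    ultimately show ?thesis using graph by blast
  qed
  show "cball (x + \<tau> *\<^sub>R e) (2 * (c * \<tau>)) \<subseteq> \<Omega>" if \<tau>: "0 < \<tau>" "\<tau> \<le> k * dist x y"
  proof
    fix w assume "w \<in> cball (x + \<tau> *\<^sub>R e) (2 * (c * \<tau>))"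
    then have b: "norm (w - x - \<tau> *\<^sub>R e) \<le> 2 * (c * \<tau>)"
      by (simp add: dist_norm norm_minus_commute algebra_simps)
    then have "(1 + L) * norm (w - x - \<tau> *\<^sub>R e) \<le> (1 + L) * (2 * (c * \<tau>))"
      using L by (intro mult_left_mono) auto
    also have "\<dots> = 2 * ((1 + L) * c) * \<tau>"
      by (simp add: mult_ac)
    also have "\<dots> \<le> \<tau>"
      unfolding Lc using \<tau> by simp
    finally show "w \<in> \<Omega>"
      using \<tau> b by (intro *[of \<tau> "w - x - \<tau> *\<^sub>R e"]) (auto intro: add_increasing)
  qed
  show "cball (x + s *\<^sub>R (y - x) + (k * dist x y) *\<^sub>R e) (2 * (c * (k * dist x y))) \<subseteq> \<Omega>"
    if s: "0 \<le> s" "s \<le> 1"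
  proof
    define \<tau> where "\<tau> = k * dist x y"
    fix w assume "w \<in> cball (x + s *\<^sub>R (y - x) + (k * dist x y) *\<^sub>R e) (2 * (c * (k * dist x y)))"
    then have 1: "norm (w - x - \<tau> *\<^sub>R e - s *\<^sub>R (y - x)) \<le> 2 * (c * \<tau>)"
      by (simp add: dist_norm norm_minus_commute algebra_simps \<tau>_def)
    have "s * norm (y - x) \<le> 1 * norm (y - x)"
      using s by (intro mult_right_mono) auto
    then have 2: "norm (s *\<^sub>R (y - x)) \<le> dist x y"
      using s by (simp add: dist_norm norm_minus_commute)
    have b: "norm (w - x - \<tau> *\<^sub>R e) \<le> dist x y + 2 * (c * \<tau>)"
      using norm_triangle_ineq[of "s *\<^sub>R (y - x)" "w - x - \<tau> *\<^sub>R e - s *\<^sub>R (y - x)"] 1 2 by simp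
    then have "(1 + L) * norm (w - x - \<tau> *\<^sub>R e) \<le> (1 + L) * (dist x y + 2 * (c * \<tau>))"
      using L by (intro mult_left_mono) auto
    also have "\<dots> = \<tau> / 4 + 2 * ((1 + L) * c) * \<tau>"
      unfolding \<tau>_def k by (simp add: algebra_simps)
    also have "\<dots> \<le> \<tau>"
      unfolding Lc \<tau>_def using k4 by simp
    finally show "w \<in> \<Omega>"
      using b k4 by (intro *[of \<tau> "w - x - \<tau> *\<^sub>R e"]) (auto simp: \<tau>_def)
  qed
qed

text \<open>The constants are uniform over the family \<open>V\<close>. Small distances fall into
  one chart by compactness; for large distances it is enough to bound differences of values, and
  connectedness supplies that bound.\<close>

lemma hoelder_local_to_global:
  fixes \<Omega> :: "'a::euclidean_space set" and V :: "('a \<Rightarrow> real) set"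
  assumes "open \<Omega>" "bounded \<Omega>" "connected \<Omega>" "0 < \<alpha>"
    and loc: "\<And>x0. x0 \<in> closure \<Omega> \<Longrightarrow> \<exists>r>0. \<exists>C. \<forall>v\<in>V. \<forall>x\<in>\<Omega> \<inter> ball x0 r. \<forall>y\<in>\<Omega> \<inter> ball x0 r.
      \<bar>v x - v y\<bar> \<le> C * dist x y powr \<alpha>"
  shows "\<exists>K\<ge>0. \<forall>v\<in>V. \<forall>x\<in>\<Omega>. \<forall>y\<in>\<Omega>. \<bar>v x - v y\<bar> \<le> K * dist x y powr \<alpha>"
proof -
  obtain r C where r: "\<And>x0. x0 \<in> closure \<Omega> \<Longrightarrow> 0 < r x0"
    and C: "\<And>x0 v x y. x0 \<in> closure \<Omega> \<Longrightarrow> v \<in> V \<Longrightarrow> x \<in> \<Omega> \<inter> ball x0 (r x0) \<Longrightarrow> y \<in> \<Omega> \<inter> ball x0 (r x0) \<Longrightarrow>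
      \<bar>v x - v y\<bar> \<le> C x0 * dist x y powr \<alpha>"
    using loc by metis
  have osc: "\<bar>v x - v y\<bar> \<le> \<bar>C x0\<bar> * (2 * r x0) powr \<alpha>"
    if "x0 \<in> closure \<Omega>" "v \<in> V" "x \<in> \<Omega> \<inter> ball x0 (r x0)" "y \<in> \<Omega> \<inter> ball x0 (r x0)" for x0 v x y
  proof -
    have "dist x y \<le> 2 * r x0"
      using dist_triangle_less_add[of x x0 "r x0" y "r x0"] that by (simp add: dist_commute)
    then have "dist x y powr \<alpha> \<le> (2 * r x0) powr \<alpha>"
      using assms(4) by (intro powr_mono2) auto
    then have "C x0 * dist x y powr \<alpha> \<le> \<bar>C x0\<bar> * (2 * r x0) powr \<alpha>"
      by (intro mult_mono) auto
    with C[OF that] show ?thesis by linarith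
  qed
  \<comment> \<open>Having differences bounded uniformly over \<open>V\<close> is an equivalence
    relation on \<Omega> with open classes, so connectedness leaves a single class.\<close>
  have equi: "\<exists>B. \<forall>v\<in>V. \<bar>v a - v b\<bar> \<le> B" if "a \<in> \<Omega>" "b \<in> \<Omega>" for a b
  proof (rule connected_equivalence_relation[OF assms(3) that, where R = "\<lambda>a b. \<exists>B. \<forall>v\<in>V. \<bar>v a - v b\<bar> \<le> B"])
    show "\<exists>B. \<forall>v\<in>V. \<bar>v y - v x\<bar> \<le> B" if "\<exists>B. \<forall>v\<in>V. \<bar>v x - v y\<bar> \<le> B" for x y
      using that by (simp add: abs_minus_commute)
    show "\<exists>B. \<forall>v\<in>V. \<bar>v x - v z\<bar> \<le> B"
      if xy: "\<exists>B. \<forall>v\<in>V. \<bar>v x - v y\<bar> \<le> B" and yz: "\<exists>B. \<forall>v\<in>V. \<bar>v y - v z\<bar> \<le> B" for x y z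
    proof -
      obtain B1 B2 where B: "\<And>v. v \<in> V \<Longrightarrow> \<bar>v x - v y\<bar> \<le> B1" "\<And>v. v \<in> V \<Longrightarrow> \<bar>v y - v z\<bar> \<le> B2"
        using xy yz by blast
      have "\<bar>v x - v z\<bar> \<le> B1 + B2" if "v \<in> V" for v
        using B[OF that] by linarith
      then show ?thesis by blast
    qed
    show "\<exists>T. openin (top_of_set \<Omega>) T \<and> a \<in> T \<and> (\<forall>x\<in>T. \<exists>B. \<forall>v\<in>V. \<bar>v a - v x\<bar> \<le> B)" if "a \<in> \<Omega>" for a
    proof (intro exI[of _ "\<Omega> \<inter> ball a (r a)"] conjI)
      have a: "a \<in> closure \<Omega>" using that closure_subset by blast
      show "openin (top_of_set \<Omega>) (\<Omega> \<inter> ball a (r a))"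
        by (simp add: openin_open_Int)
      show a': "a \<in> \<Omega> \<inter> ball a (r a)" using that r[OF a] by simp
      show "\<forall>x\<in>\<Omega> \<inter> ball a (r a). \<exists>B. \<forall>v\<in>V. \<bar>v a - v x\<bar> \<le> B"
        using osc[OF a _ a'] by blast
    qed
  qed
  then obtain B where B: "\<And>a b v. a \<in> \<Omega> \<Longrightarrow> b \<in> \<Omega> \<Longrightarrow> v \<in> V \<Longrightarrow> \<bar>v a - v b\<bar> \<le> B a b"
    by metis
  have cpt: "compact (closure \<Omega>)"
    using assms(2) by simp
  have cover: "closure \<Omega> \<subseteq> (\<Union>x0\<in>closure \<Omega>. ball x0 (r x0))"
  proof
    fix x assume "x \<in> closure \<Omega>"
    then show "x \<in> (\<Union>x0\<in>closure \<Omega>. ball x0 (r x0))"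
      using r[of x] by (intro UN_I[of x]) auto
  qed
  obtain T where T: "T \<subseteq> closure \<Omega>" "finite T" "closure \<Omega> \<subseteq> (\<Union>x0\<in>T. ball x0 (r x0))"
    by (rule compactE_image[OF cpt _ cover]) auto
  \<comment> \<open>A Lebesgue number of the finite cover: points closer than \<delta> share a
    chart.\<close>
  obtain \<delta> where \<delta>: "0 < \<delta>" "\<And>x. x \<in> closure \<Omega> \<Longrightarrow> \<exists>G\<in>(\<lambda>x0. ball x0 (r x0)) ` T. ball x \<delta> \<subseteq> G"
    by (rule Heine_Borel_lemma[OF cpt T(3)]) auto
  \<comment> \<open>The centres may lie on the boundary, where nothing is known about
    \<open>v\<close>, so each chart receives a representative inside \<Omega>.\<close>
  have "\<exists>p. p \<in> \<Omega> \<inter> ball x0 (r x0)" if "x0 \<in> T" for x0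
  proof -
    have "x0 \<in> closure \<Omega>" using that T(1) by blast
    then obtain p where "p \<in> \<Omega>" "dist p x0 < r x0"
      using r closure_approachable by blast
    then show ?thesis by (auto simp: dist_commute)
  qed
  then obtain p where p: "\<And>x0. x0 \<in> T \<Longrightarrow> p x0 \<in> \<Omega> \<inter> ball x0 (r x0)"
    by metis
  define C' where "C' = (\<Sum>x0\<in>T. \<bar>C x0\<bar>)"
  define O' where "O' = (\<Sum>x0\<in>T. \<bar>C x0\<bar> * (2 * r x0) powr \<alpha>)"
  define B' where "B' = (\<Sum>x0\<in>T. \<Sum>x1\<in>T. \<bar>B (p x0) (p x1)\<bar>)"
  \<comment> \<open>\<open>C'\<close> handles distances below \<delta>. Beyond \<delta>, two points
    are joined through the representatives of their charts at a cost of at most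
    \<open>2 * O' + B'\<close>, and (dist x y / \<delta>)^\<alpha> is at least 1.\<close>
  define K where "K = C' + (2 * O' + B') * \<delta> powr (- \<alpha>)"
  have nn: "0 \<le> C'" "0 \<le> O'" "0 \<le> B'"
    by (auto simp: C'_def O'_def B'_def intro!: sum_nonneg)
  then have "0 \<le> K" by (simp add: K_def)
  moreover have "\<bar>v x - v y\<bar> \<le> K * dist x y powr \<alpha>" if v: "v \<in> V" and x: "x \<in> \<Omega>" and y: "y \<in> \<Omega>" for v x y
  proof (cases "dist x y < \<delta>")
    case True
    have "x \<in> closure \<Omega>" using x closure_subset by blast
    from \<delta>(2)[OF this] obtain x0 where x0: "x0 \<in> T" "ball x \<delta> \<subseteq> ball x0 (r x0)"
      by blast
    then have "x \<in> \<Omega> \<inter> ball x0 (r x0)" "y \<in> \<Omega> \<inter> ball x0 (r x0)"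
      using x y True \<delta>(1) by (auto simp: subset_iff)
    then have "\<bar>v x - v y\<bar> \<le> C x0 * dist x y powr \<alpha>"
      using C x0(1) T(1) v by blast
    also have "\<dots> \<le> K * dist x y powr \<alpha>"
    proof (intro mult_right_mono)
      have "\<bar>C x0\<bar> \<le> C'"
        unfolding C'_def by (rule member_le_sum[OF x0(1)]) (use T in auto)
      moreover have "0 \<le> (2 * O' + B') * \<delta> powr (- \<alpha>)"
        using nn by simp
      ultimately show "C x0 \<le> K" unfolding K_def by linarith
    qed simp
    finally show ?thesis .
  next
    case False
    have near: "\<exists>x0\<in>T. \<bar>v z - v (p x0)\<bar> \<le> O'" if "z \<in> \<Omega>" for z
    proof -
      have "z \<in> closure \<Omega>" using that closure_subset by blast
      then obtain x0 where x0: "x0 \<in> T" "z \<in> ball x0 (r x0)"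
        using T(3) by blast
      then have "\<bar>v z - v (p x0)\<bar> \<le> \<bar>C x0\<bar> * (2 * r x0) powr \<alpha>"
        using osc[of x0 v z "p x0"] v that p[OF x0(1)] T(1) by blast
      also have "\<dots> \<le> O'"
        unfolding O'_def by (rule member_le_sum[OF x0(1)]) (use T in auto)
      finally show ?thesis using x0(1) by blast
    qed
    obtain x0 x1 where 0: "x0 \<in> T" "\<bar>v x - v (p x0)\<bar> \<le> O'" and 1: "x1 \<in> T" "\<bar>v y - v (p x1)\<bar> \<le> O'"
      using near[OF x] near[OF y] by blast
    have "\<bar>v (p x0) - v (p x1)\<bar> \<le> \<bar>B (p x0) (p x1)\<bar>"
      using B[of "p x0" "p x1" v] p[OF 0(1)] p[OF 1(1)] v by (auto intro: order_trans)
    also have "\<dots> \<le> (\<Sum>x1\<in>T. \<bar>B (p x0) (p x1)\<bar>)"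
      by (rule member_le_sum[OF 1(1)]) (use T in auto)
    also have "\<dots> \<le> B'"
      unfolding B'_def by (rule member_le_sum[OF 0(1)]) (use T in \<open>auto intro: sum_nonneg\<close>)
    finally have "\<bar>v x - v y\<bar> \<le> 2 * O' + B'"
      using 0(2) 1(2) by linarith
    also have "\<dots> \<le> (2 * O' + B') * (\<delta> powr (- \<alpha>) * dist x y powr \<alpha>)"
    proof -
      have "\<delta> powr (- \<alpha>) * \<delta> powr \<alpha> \<le> \<delta> powr (- \<alpha>) * dist x y powr \<alpha>"
        using False \<delta>(1) assms(4) by (intro mult_left_mono powr_mono2) auto
      then have "1 \<le> \<delta> powr (- \<alpha>) * dist x y powr \<alpha>"
        using \<delta>(1) by (simp flip: powr_add)
      from mult_left_mono[OF this, of "2 * O' + B'"] show ?thesis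
        using nn by simp
    qed
    also have "\<dots> = ((2 * O' + B') * \<delta> powr (- \<alpha>)) * dist x y powr \<alpha>"
      by (rule mult.assoc[symmetric])
    also have "\<dots> \<le> K * dist x y powr \<alpha>"
      using nn unfolding K_def by (intro mult_right_mono) auto
    finally show ?thesis .
  qed
  ultimately show ?thesis by blast
qed

lemma limit_value_hoelder:
  fixes \<Omega> :: "'a::euclidean_space set"
  assumes "open \<Omega>" "bounded \<Omega>" "connected \<Omega>" "lipschitz_boundary \<Omega>" "0 < \<alpha>"
  shows "\<exists>K\<ge>0. \<forall>u Du. morrey_gradient \<Omega> u Du M \<alpha> \<longrightarrow> (\<forall>x\<in>\<Omega>. \<forall>y\<in>\<Omega>.
    \<bar>morrey_gradient.limit_value \<Omega> u M \<alpha> x - morrey_gradient.limit_value \<Omega> u M \<alpha> y\<bar> \<le> K * dist x y powr \<alpha>)"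
proof -
  \<comment> \<open>All limit functions with the same \<open>M\<close> and \<alpha> form one family,
    so the resulting constant cannot depend on \<open>u\<close>.\<close>
  define V where "V = {morrey_gradient.limit_value \<Omega> u M \<alpha> |u. \<exists>Du. morrey_gradient \<Omega> u Du M \<alpha>}"
  have "\<exists>K\<ge>0. \<forall>v\<in>V. \<forall>x\<in>\<Omega>. \<forall>y\<in>\<Omega>. \<bar>v x - v y\<bar> \<le> K * dist x y powr \<alpha>"
  proof (rule hoelder_local_to_global[OF assms(1-3,5)])
    fix x0 assume x0: "x0 \<in> closure \<Omega>"
    show "\<exists>r>0. \<exists>C. \<forall>v\<in>V. \<forall>x\<in>\<Omega> \<inter> ball x0 r. \<forall>y\<in>\<Omega> \<inter> ball x0 r. \<bar>v x - v y\<bar> \<le> C * dist x y powr \<alpha>"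
    proof (cases "x0 \<in> \<Omega>")
      case True
      then obtain R where R: "0 < R" "ball x0 R \<subseteq> \<Omega>"
        using assms(1) open_contains_ball by blast
      have "\<bar>v x - v y\<bar> \<le> (M * (2 * (1 + 1) * 1 powr (\<alpha> - 1) / \<alpha> * 1 powr \<alpha> + (1 * 1) powr (\<alpha> - 1))) * dist x y powr \<alpha>"
        if "v \<in> V" and xy: "x \<in> \<Omega> \<inter> ball x0 (R / 8)" "y \<in> \<Omega> \<inter> ball x0 (R / 8)" for v x y
      proof -
        from that(1) obtain u Du where u: "morrey_gradient \<Omega> u Du M \<alpha>"
          and v: "v = morrey_gradient.limit_value \<Omega> u M \<alpha>"
          unfolding V_def by blast
        show ?thesis
          unfolding v
          by (rule morrey_gradient.two_point_bound[OF u, where e = 0])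
            (use xy interior_cone[OF R, of x y] interior_cone[OF R, of y x] in \<open>auto simp: dist_commute simp del: mem_ball\<close>)
      qed
      then show ?thesis using R(1) by (intro exI[of _ "R / 8"]) (auto simp del: mem_ball)
    next
      case False
      then have "x0 \<in> frontier \<Omega>"
        using x0 assms(1) by (simp add: frontier_def interior_open)
      then obtain R e L \<gamma> where R: "0 < R" "norm e = 1" "L-lipschitz_on {y. y \<bullet> e = 0} \<gamma>"
        "\<Omega> \<inter> ball x0 R = {x \<in> ball x0 R. \<gamma> (x - (x \<bullet> e) *\<^sub>R e) < x \<bullet> e}"
        using assms(4) unfolding lipschitz_boundary_def by blast
      define k where "k = 4 * (1 + L)"
      define c where "c = 1 / k"
      define r where "r = R / (4 * (1 + k))"
      have pos: "0 < k" "0 < c" "0 < r"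
        using lipschitz_on_nonneg[OF R(3)] R(1) by (auto simp: k_def c_def r_def)
      note cone = boundary_cone[OF R k_def c_def r_def]
      have "\<bar>v x - v y\<bar> \<le> (M * (2 * (1 + c) * c powr (\<alpha> - 1) / \<alpha> * k powr \<alpha> + (c * k) powr (\<alpha> - 1))) * dist x y powr \<alpha>"
        if "v \<in> V" and xy: "x \<in> \<Omega> \<inter> ball x0 r" "y \<in> \<Omega> \<inter> ball x0 r" for v x y
      proof -
        from that(1) obtain u Du where u: "morrey_gradient \<Omega> u Du M \<alpha>"
          and v: "v = morrey_gradient.limit_value \<Omega> u M \<alpha>"
          unfolding V_def by blast
        show ?thesis
          unfolding v
        proof (rule morrey_gradient.two_point_bound[OF u pos(2,1), where e = e])
          show "cball (y + \<tau> *\<^sub>R e) (2 * (c * \<tau>)) \<subseteq> \<Omega>" if "0 < \<tau>" "\<tau> \<le> k * dist x y" for \<tau>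
            using cone(1)[OF xy(2,1) that(1)] that(2) by (simp add: dist_commute)
        qed (use xy R(2) cone[OF xy] in auto)
      qed
      then show ?thesis using pos(3) by blast
    qed
  qed
  then show ?thesis
    unfolding V_def by blast
qed

section \<open>Identification of the limit\<close>

text \<open>Boxes are stable under intersection and generate the Borel sets, so the vanishing of the
  integrals spreads to all Borel sets. Complements require the integral over the whole space, which
  is obtained by exhausting it with boxes.\<close>

lemma AE_eq_0_if_box_integrals_0:
  fixes g :: "'a::euclidean_space \<Rightarrow> real"
  assumes g: "integrable lborel g" and box0: "\<And>a b. (\<integral>x\<in>box a b. g x \<partial>lborel) = 0"
  shows "AE x in lborel. g x = 0"
proof -
  let ?B = "\<lambda>n::nat. box (- (real n *\<^sub>R One)) (real n *\<^sub>R One) :: 'a set"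
  have "(\<lambda>n. \<integral>x. indicator (?B n) x *\<^sub>R g x \<partial>lborel) \<longlonglongrightarrow> (\<integral>x. g x \<partial>lborel)"
  proof (rule integral_dominated_convergence[where w = "\<lambda>x. norm (g x)"])
    show "AE x in lborel. (\<lambda>n. indicator (?B n) x *\<^sub>R g x) \<longlonglongrightarrow> g x"
    proof (rule AE_I2)
      fix x :: 'a
      obtain n where n: "x \<in> ?B n"
        using UN_box_eq_UNIV by blast
      have "\<forall>\<^sub>F m in sequentially. indicator (?B m) x *\<^sub>R g x = g x"
        using eventually_ge_at_top[of n]
      proof eventually_elim
        case (elim m)
        then have "?B n \<subseteq> ?B m"
          by (intro subset_box_imp) auto
        then show ?case using n by (auto simp: indicator_def)
      qed
      then show "(\<lambda>n. indicator (?B n) x *\<^sub>R g x) \<longlonglongrightarrow> g x"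
        by (rule tendsto_eventually)
    qed
  qed (use g in \<open>auto simp: indicator_def\<close>)
  then have total: "(\<integral>x. g x \<partial>lborel) = 0"
    using box0 LIMSEQ_unique[OF _ tendsto_const] unfolding set_lebesgue_integral_def by force
  have int: "integrable lborel (\<lambda>x. indicator A x *\<^sub>R g x)" if "A \<in> sets borel" for A
    using integrable_mult_indicator[OF _ g, of A] that by simp
  have borel: "sets (borel :: 'a measure) = sigma_sets UNIV (range (\<lambda>(a, b). box a b))"
    by (simp add: borel_eq_box[where 'a = 'a])
  have stable: "Int_stable (range (\<lambda>(a, b). box a b :: 'a set))"
    by (auto simp: Int_stable_def box_Int_box)
  have sets: "(\<integral>x\<in>A. g x \<partial>lborel) = 0" if "A \<in> sets borel" for A
  proof (rule sigma_sets_induct_disjoint[OF stable _ that[unfolded borel]])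
    fix A :: "'a set"
    assume "A \<in> sigma_sets UNIV (range (\<lambda>(a, b). box a b))" and IH: "(\<integral>x\<in>A. g x \<partial>lborel) = 0"
    then have A: "A \<in> sets borel" by (simp add: borel)
    have "(\<integral>x. indicator (UNIV - A) x *\<^sub>R g x \<partial>lborel) = (\<integral>x. g x - indicator A x *\<^sub>R g x \<partial>lborel)"
      by (rule Bochner_Integration.integral_cong) (auto simp: indicator_def)
    also have "\<dots> = 0"
      using IH total int[OF A] g by (simp add: set_lebesgue_integral_def)
    finally show "(\<integral>x\<in>UNIV - A. g x \<partial>lborel) = 0" by (simp add: set_lebesgue_integral_def)
  next
    fix A :: "nat \<Rightarrow> 'a set"
    assume disj: "disjoint_family A" and "range A \<subseteq> sigma_sets UNIV (range (\<lambda>(a, b). box a b))"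
      and IH: "\<And>i. (\<integral>x\<in>A i. g x \<partial>lborel) = 0"
    then have A: "A i \<in> sets lborel" for i by (auto simp: borel)
    have "(\<integral>x\<in>(\<Union>i. A i). g x \<partial>lborel) = (\<Sum>i. \<integral>x\<in>A i. g x \<partial>lborel)"
    proof (rule lebesgue_integral_countable_add[OF A])
      show "A i \<inter> A j = {}" if "i \<noteq> j" for i j
        using disj that by (auto simp: disjoint_family_on_def)
      show "set_integrable lborel (\<Union>i. A i) g"
        unfolding set_integrable_def by (rule int) (use A in auto)
    qed
    then show "(\<integral>x\<in>(\<Union>i. A i). g x \<partial>lborel) = 0" using IH by simp
  qed (auto simp: box0, simp add: set_lebesgue_integral_def)
  have "AE x in lborel. g x = (\<lambda>_. 0) x"
    by (rule density_unique_real[OF g]) (use sets in \<open>auto simp: set_lebesgue_integral_def\<close>)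
  then show ?thesis by simp
qed

section \<open>The mass of the mollification kernel\<close>

definition bump_mass :: "('a::euclidean_space) itself \<Rightarrow> real" where
  "bump_mass _ = integral\<^sup>L lborel (bump 0 1 :: 'a \<Rightarrow> real)"

lemma borel_measurable_bump [measurable]: "bump n t \<in> borel_measurable borel"
proof -
  have "continuous_on UNIV (\<lambda>s. flat_exp n s)"
    by (intro continuous_intros)
  then have [measurable]: "flat_exp n \<in> borel_measurable borel"
    by (rule borel_measurable_continuous_onI)
  show ?thesis
    unfolding bump_def[abs_def] by measurable
qed

lemma bump_scale:
  assumes "0 < t"
  shows "bump n t (t *\<^sub>R z) = bump n 1 z"
  using assms by (simp add: bump_def power2_eq_square)

lemma integrable_bump:
  assumes "0 < t"
  shows "integrable lborel (bump n t :: 'a::euclidean_space \<Rightarrow> real)"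
proof (rule integrableI_bounded_set[of "cball 0 t" _ _ "fact n"])
  show "emeasure lborel (cball (0::'a) t) < \<infinity>"
    by (rule emeasure_lborel_cball_finite)
  show "AE x in lborel. x \<notin> cball (0::'a) t \<longrightarrow> bump n t x = 0"
    by (intro AE_I2) (auto simp: bump_eq_0[OF assms])
  show "AE x in lborel. x \<in> cball (0::'a) t \<longrightarrow> norm (bump n t x) \<le> fact n"
    by (intro AE_I2) (auto simp: bump_nonneg bump_le)
qed auto

lemma bump_mass_pos: "0 < bump_mass TYPE('a::euclidean_space)"
proof -
  have "0 < measure lborel (cball (0::'a) (1 / 2))"
    using content_cball_pos[of "1 / 2" "0::'a"] by simp
  then have "0 < (\<integral>z. exp (- 4 / 3) * indicat_real (cball (0::'a) (1 / 2)) z \<partial>lborel)"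
    by simp
  also have "\<dots> \<le> bump_mass TYPE('a)"
    unfolding bump_mass_def
  proof (rule integral_mono)
    show "integrable lborel (\<lambda>z::'a. exp (- 4 / 3) * indicat_real (cball 0 (1 / 2)) z)"
      using emeasure_lborel_cball_finite[of "0::'a" "1 / 2"] by simp
    show "exp (- 4 / 3) * indicat_real (cball 0 (1 / 2)) z \<le> bump 0 1 z" for z :: 'a
      using bump_lower[of z 1] bump_nonneg[of 0 1 z] by (auto simp: indicator_def)
  qed (rule integrable_bump, simp)
  finally show ?thesis .
qed

lemma integral_bump_translate:
  fixes y :: "'a::euclidean_space"
  assumes "0 < t"
  shows "(\<integral>x. bump 0 t (x - y) / t ^ DIM('a) \<partial>lborel) = bump_mass TYPE('a)"
proof -
  have "(\<integral>x. bump 0 t (x - y) / t ^ DIM('a) \<partial>lborel)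
      = (\<integral>x. bump 0 t (x - y) / t ^ DIM('a) \<partial>density (distr lborel borel (\<lambda>x. y + t *\<^sub>R x)) (\<lambda>_. \<bar>t\<bar> ^ DIM('a)))"
    using assms by (subst lborel_affine[of t y]) auto
  also have "\<dots> = (\<integral>x. t ^ DIM('a) * (bump 0 t (y + t *\<^sub>R x - y) / t ^ DIM('a)) \<partial>lborel)"
    using assms by (subst integral_density) (auto simp: integral_distr)
  also have "\<dots> = bump_mass TYPE('a)"
    using assms by (simp add: bump_mass_def bump_scale)
  finally show ?thesis .
qed

lemma integrable_bump_translate:
  fixes y :: "'a::euclidean_space"
  assumes "0 < t"
  shows "integrable lborel (\<lambda>x. bump 0 t (x - y))"
  using integrable_bump[OF assms, where 'a = 'a and n = 0]
  by (subst (asm) lborel_distr_plus[of "- y", symmetric]) (simp add: integrable_distr_eq add.commute[of "- y"])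

context morrey_gradient
begin

text \<open>Fubini moves the mollification from \<open>u\<close> to the indicator of a box, where
  its limit is explicit. Comparing integrals over all sub-boxes then identifies the two functions
  almost everywhere.\<close>

lemma limit_value_AE_on_box:
  assumes "continuous_on \<Omega> limit_value" and sub: "cbox a b \<subseteq> \<Omega>"
  shows "AE x in lebesgue. x \<in> box a b \<longrightarrow> limit_value x = bump_mass TYPE('a) * u x"
proof -
  let ?N = "DIM('a)"
  define c0 where "c0 = bump_mass TYPE('a)"
  have c0: "0 < c0" by (simp add: c0_def bump_mass_pos)
  obtain \<epsilon> where \<epsilon>: "0 < \<epsilon>" "(\<Union>x\<in>cbox a b. cball x \<epsilon>) \<subseteq> \<Omega>"
    using compact_subset_open_imp_cball_epsilon_subset[OF compact_cbox open_\<Omega> sub] by blast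
  \<comment> \<open>A compact subset of \<Omega> containing the supports of all kernels of scale at
    most \<epsilon> centred in the box; cutting \<open>u\<close> off there makes it integrable on
    the whole space.\<close>
  define C where "C = (\<Union>x\<in>cbox a b. cball x \<epsilon>)"
  have C: "compact C"
  proof -
    have "C = {x + y |x y. x \<in> cbox a b \<and> y \<in> cball 0 \<epsilon>}"
    proof (intro set_eqI iffI)
      fix z assume "z \<in> C"
      then obtain x where "x \<in> cbox a b" "dist x z \<le> \<epsilon>" by (auto simp: C_def)
      then show "z \<in> {x + y |x y. x \<in> cbox a b \<and> y \<in> cball 0 \<epsilon>}"
        by (intro CollectI exI[of _ x] exI[of _ "z - x"]) (auto simp: dist_norm norm_minus_commute)
    next
      fix z assume "z \<in> {x + y |x y. x \<in> cbox a b \<and> y \<in> cball 0 \<epsilon>}"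
      then obtain x y where "x \<in> cbox a b" "norm y \<le> \<epsilon>" "z = x + y" by auto
      then show "z \<in> C"
        unfolding C_def by (intro UN_I[of x]) (auto simp: dist_norm)
    qed
    then show ?thesis
      using compact_sums[OF compact_cbox compact_cball, of a b 0 \<epsilon>] by (simp only:)
  qed
  have cballC: "cball x t \<subseteq> C" if "x \<in> cbox a b" "t \<le> \<epsilon>" for x t
  proof
    fix z assume "z \<in> cball x t"
    then show "z \<in> C"
      unfolding C_def using that by (intro UN_I[of x]) auto
  qed
  have C\<Omega>: "C \<subseteq> \<Omega>" using \<epsilon>(2) by (simp add: C_def)
  have Cs: "C \<in> sets lebesgue" and \<Omega>s: "\<Omega> \<in> sets lebesgue"
    using fmeasurableD[OF lmeasurable_compact[OF C]] open_\<Omega> by auto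
  have "u \<in> Lp 1 C"
    using weak_gradient C C\<Omega> by (auto simp: has_weak_gradient_def Lp_loc_def)
  then have "integrable (lebesgue_on C) u"
    unfolding Lp_def by (auto intro: integrable_norm_cancel)
  then have uC: "integrable lebesgue (\<lambda>y. indicator C y *\<^sub>R u y)"
    using Cs by (simp add: integrable_restrict_space)
  \<comment> \<open>The product measure for Fubini is built from \<open>lborel\<close>, so the
    cut-off of \<open>u\<close>, which is only Lebesgue measurable, is replaced by a Borel function
    equal to it almost everywhere.\<close>
  then obtain U where U[measurable]: "U \<in> borel_measurable lborel"
    and UAE: "AE y in lborel. indicator C y *\<^sub>R u y = U y"
    using completion_ex_borel_measurable_real by (metis borel_measurable_integrable)
  have UAE': "AE y in lebesgue. indicator C y *\<^sub>R u y = U y"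
    using UAE by (rule AE_completion)
  have U': "U \<in> borel_measurable lebesgue"
    using measurable_completion[OF U] .
  have Uint: "integrable lborel U"
  proof -
    have "integrable lebesgue U"
      using integrable_cong_AE[OF _ U' UAE'] uC by blast
    then show ?thesis using integrable_completion[OF U] by blast
  qed
  define \<rho> where "\<rho> = (\<lambda>t (x::'a) y. bump 0 t (x - y) / t ^ ?N)"
  have \<rho>m[measurable]: "(\<lambda>p. \<rho> t (fst p) (snd p)) \<in> borel_measurable (borel \<Otimes>\<^sub>M borel)" for t
    unfolding \<rho>_def by measurable
  have FU: "F x t = (\<integral>y. U y * \<rho> t x y \<partial>lborel)" if "x \<in> cbox a b" "0 < t" "t \<le> \<epsilon>" for x t
  proof -
    have tC: "cball x t \<subseteq> C"
      by (rule cballC[OF that(1,3)])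
    have "F x t = (\<integral>y. u y * \<rho> t x y \<partial>lebesgue_on C)"
      unfolding \<rho>_def by (rule mollify_eq_integral_on[OF \<Omega>s Cs tC C\<Omega> that(2)])
    also have "\<dots> = (\<integral>y. indicator C y *\<^sub>R (u y * \<rho> t x y) \<partial>lebesgue)"
      using Cs by (simp add: integral_restrict_space)
    also have "\<dots> = (\<integral>y. U y * \<rho> t x y \<partial>lebesgue)"
    proof (rule integral_cong_AE)
      have r: "\<rho> t x \<in> borel_measurable lebesgue"
        unfolding \<rho>_def by (intro measurable_completion) simp
      have "(\<lambda>y. indicator C y *\<^sub>R u y) \<in> borel_measurable lebesgue"
        using uC by (rule borel_measurable_integrable)
      from borel_measurable_times[OF this r]
      show "(\<lambda>y. indicator C y *\<^sub>R (u y * \<rho> t x y)) \<in> borel_measurable lebesgue"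
        by (simp add: mult.assoc)
      show "(\<lambda>y. U y * \<rho> t x y) \<in> borel_measurable lebesgue"
        using U' r by (rule borel_measurable_times)
      show "AE y in lebesgue. indicator C y *\<^sub>R (u y * \<rho> t x y) = U y * \<rho> t x y"
        using UAE' by eventually_elim (metis mult.assoc real_scaleR_def)
    qed
    also have "\<dots> = (\<integral>y. U y * \<rho> t x y \<partial>lborel)"
      by (rule integral_completion) (simp add: \<rho>_def)
    finally show ?thesis .
  qed
  have int_v: "integrable lborel (\<lambda>x. indicator (box a' b') x * limit_value x)"
    if "box a' b' \<subseteq> cbox a b" for a' b'
  proof -
    have cont: "continuous_on (cbox a b) limit_value"
      using assms(1) sub by (rule continuous_on_subset)
    have "integrable lborel (\<lambda>x. indicator (cbox a b) x *\<^sub>R limit_value x)"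
      by (rule borel_integrable_compact[OF compact_cbox cont])
    from integrable_mult_indicator[OF _ this, of "box a' b'"]
    have "integrable lborel (\<lambda>x. indicator (box a' b') x *\<^sub>R indicator (cbox a b) x *\<^sub>R limit_value x)"
      by simp
    moreover have "indicator (box a' b') x *\<^sub>R indicator (cbox a b) x *\<^sub>R limit_value x
        = indicator (box a' b') x * limit_value x" for x
      using that by (auto simp: indicator_def)
    ultimately show ?thesis by (simp only:)
  qed
  have box_eq: "(\<integral>x. indicator (box a' b') x * limit_value x \<partial>lborel) = c0 * (\<integral>y. indicator (box a' b') y * U y \<partial>lborel)"
    if Q: "box a' b' \<subseteq> cbox a b" for a' b'
  proof -
    define Q where "Q = box a' b'"
    define k where "k = (\<lambda>t y. \<integral>x. indicator Q x * \<rho> t x y \<partial>lborel)"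
    \<comment> \<open>The factor 1 / 2 keeps \<open>2 * s n\<close> below \<epsilon>, as
      \<open>limit_value_bound\<close> asks for the doubled ball in \<Omega>.\<close>
    define s where "s n = \<epsilon> / 2 / real (Suc n)" for n
    have s: "0 < s n" "s n \<le> \<epsilon>" "2 * s n \<le> \<epsilon>" for n
      using \<epsilon>(1) by (auto simp: s_def field_simps)
    have s0: "s \<longlonglongrightarrow> 0"
      unfolding s_def divide_inverse[of _ "real _"]
      by (rule tendsto_mult_right_zero[OF LIMSEQ_inverse_real_of_nat])
    have Qs[measurable]: "Q \<in> sets borel" by (simp add: Q_def)
    have pair: "integrable (lborel \<Otimes>\<^sub>M lborel) (\<lambda>p. indicator Q (fst p) * U (snd p) * \<rho> t (fst p) (snd p))"
      if "0 < t" for t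
    proof (rule integrable_dominated[where C = "1 / t ^ ?N" and f = "\<lambda>p. indicator Q (fst p) * U (snd p)"])
      show "integrable (lborel \<Otimes>\<^sub>M lborel) (\<lambda>p. indicator Q (fst p) * U (snd p))"
      proof (rule lborel_pair.Fubini_integrable)
        show "integrable lborel (\<lambda>x. \<integral>y. norm (indicator Q (fst (x, y)) * U (snd (x, y))) \<partial>lborel)"
          using emeasure_lborel_box_finite[of a' b'] by (simp add: abs_mult Q_def)
        show "AE x in lborel. integrable lborel (\<lambda>y. indicator Q (fst (x, y)) * U (snd (x, y)))"
          using Uint by simp
      qed measurable
      show "norm (indicator Q (fst p) * U (snd p) * \<rho> t (fst p) (snd p)) \<le> 1 / t ^ ?N * norm (indicator Q (fst p) * U (snd p))" for p
      proof -
        have "\<bar>\<rho> t (fst p) (snd p)\<bar> \<le> 1 / t ^ ?N"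
          using that bump_nonneg[of 0 t "fst p - snd p"] bump_le[of 0 t "fst p - snd p"]
          by (simp add: \<rho>_def divide_right_mono)
        from mult_right_mono[OF this, of "\<bar>indicator Q (fst p) * U (snd p)\<bar>"] show ?thesis
          by (simp add: abs_mult mult_ac)
      qed
    qed measurable
    have fubini: "(\<integral>x. indicator Q x * F x t \<partial>lborel) = (\<integral>y. U y * k t y \<partial>lborel)"
      and int_F: "integrable lborel (\<lambda>x. indicator Q x * F x t)" if t: "0 < t" "t \<le> \<epsilon>" for t
    proof -
      define f where "f = (\<lambda>x y. indicator Q x * U y * \<rho> t x y)"
      have f: "integrable (lborel \<Otimes>\<^sub>M lborel) (case_prod f)"
        using pair[OF t(1)] by (simp add: f_def case_prod_unfold)
      have 1: "(\<integral>y. f x y \<partial>lborel) = indicator Q x * F x t" for x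
      proof (cases "x \<in> Q")
        case True
        then have "x \<in> cbox a b" using Q by (auto simp: Q_def)
        then show ?thesis using FU[of x t] t True by (simp add: f_def)
      qed (simp add: f_def)
      have 2: "(\<integral>x. f x y \<partial>lborel) = U y * k t y" for y
        unfolding f_def k_def by (simp add: mult_ac flip: Bochner_Integration.integral_mult_right_zero)
      show "(\<integral>x. indicator Q x * F x t \<partial>lborel) = (\<integral>y. U y * k t y \<partial>lborel)"
        using lborel_pair.Fubini_integral[OF f] unfolding 1 2 by simp
      show "integrable lborel (\<lambda>x. indicator Q x * F x t)"
        using lborel_pair.integrable_fst'[of "\<lambda>p. f (fst p) (snd p)"] f 1 by (simp add: case_prod_unfold)
    qed
    have "(\<lambda>n. \<integral>y. U y * k (s n) y \<partial>lborel) \<longlonglongrightarrow> (\<integral>y. U y * (c0 * indicator Q y) \<partial>lborel)"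
    proof (rule integral_dominated_convergence[where w = "\<lambda>y. c0 * \<bar>U y\<bar>"])
      have k_le: "0 \<le> k t y \<and> k t y \<le> c0" if "0 < t" for t y
      proof
        show "0 \<le> k t y"
          unfolding k_def \<rho>_def using that
          by (intro Bochner_Integration.integral_nonneg mult_nonneg_nonneg divide_nonneg_pos bump_nonneg) auto
        have i: "integrable lborel (\<lambda>x. \<rho> t x y)"
          unfolding \<rho>_def by (intro Bochner_Integration.integrable_divide integrable_bump_translate that)
        have "k t y \<le> (\<integral>x. \<rho> t x y \<partial>lborel)"
          unfolding k_def
        proof (rule integral_mono[OF _ i])
          show "integrable lborel (\<lambda>x. indicator Q x * \<rho> t x y)"
            using integrable_mult_indicator[OF _ i, of Q] by simp
          show "indicator Q x * \<rho> t x y \<le> \<rho> t x y" for x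
            using that bump_nonneg[of 0 t "x - y"] by (auto simp: indicator_def \<rho>_def)
        qed
        also have "\<dots> = c0"
          unfolding \<rho>_def c0_def by (rule integral_bump_translate[OF that])
        finally show "k t y \<le> c0" .
      qed
      show "AE y in lborel. norm (U y * k (s n) y) \<le> c0 * \<bar>U y\<bar>" for n
      proof (rule AE_I2)
        fix y
        have "\<bar>U y\<bar> * \<bar>k (s n) y\<bar> \<le> \<bar>U y\<bar> * c0"
          using k_le[OF s(1), of n y] by (intro mult_left_mono) auto
        then show "norm (U y * k (s n) y) \<le> c0 * \<bar>U y\<bar>"
          by (simp add: abs_mult mult.commute)
      qed
      \<comment> \<open>Off the boundary of the box a kernel of small scale meets only the inside or
        only the outside, so \<open>k (s n) y\<close> eventually equals its limit; the boundary is a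
        null set.\<close>
      have "negligible (cbox a' b' - box a' b')"
        by (rule negligible_frontier_interval)
      then have "AE y in lebesgue. y \<notin> cbox a' b' - box a' b'"
        by (intro AE_not_in) (simp add: negligible_iff_null_sets[symmetric])
      then have ae: "AE y in lborel. y \<notin> cbox a' b' - box a' b'"
        by (simp add: AE_completion_iff)
      show "AE y in lborel. (\<lambda>n. U y * k (s n) y) \<longlonglongrightarrow> U y * (c0 * indicator Q y)"
        using ae
      proof eventually_elim
        case (elim y)
        have "\<forall>\<^sub>F n in sequentially. k (s n) y = c0 * indicator Q y"
        proof (cases "y \<in> Q")
          case True
          then obtain r where r: "0 < r" "ball y r \<subseteq> Q"
            unfolding Q_def using open_box open_contains_ball by blast
          have "\<forall>\<^sub>F n in sequentially. s n < r"
            using s0 r(1) by (rule order_tendstoD)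
          then show ?thesis
          proof eventually_elim
            case (elim n)
            have "indicator Q x * \<rho> (s n) x y = \<rho> (s n) x y" for x
            proof (cases "x \<in> Q")
              case False
              then have "x \<notin> ball y r" using r(2) by blast
              then have "s n \<le> norm (x - y)"
                using elim by (simp add: dist_norm norm_minus_commute)
              then have "bump 0 (s n) (x - y) = 0"
                by (rule bump_eq_0[OF s(1)])
              then show ?thesis
                by (simp add: \<rho>_def)
            qed simp
            then have "k (s n) y = (\<integral>x. \<rho> (s n) x y \<partial>lborel)"
              unfolding k_def by (simp only:)
            also have "\<dots> = c0"
              unfolding \<rho>_def c0_def by (rule integral_bump_translate[OF s(1)])
            finally show ?case
              using True by simp
          qed
        next
          case False
          then have "y \<in> - cbox a' b'" using elim by (auto simp: Q_def)
          then obtain r where r: "0 < r" "ball y r \<subseteq> - cbox a' b'"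
            using open_Compl[OF closed_cbox] open_contains_ball by blast
          have "\<forall>\<^sub>F n in sequentially. s n < r"
            using s0 r(1) by (rule order_tendstoD)
          then show ?thesis
          proof eventually_elim
            case (elim n)
            have "indicator Q x * \<rho> (s n) x y = 0" for x
            proof (cases "x \<in> Q")
              case True
              then have "x \<notin> ball y r" using r(2) box_subset_cbox[of a' b'] by (auto simp: Q_def)
              then have "s n \<le> norm (x - y)"
                using elim by (simp add: dist_norm norm_minus_commute)
              then have "bump 0 (s n) (x - y) = 0"
                by (rule bump_eq_0[OF s(1)])
              then show ?thesis
                by (simp add: \<rho>_def)
            qed simp
            then have "k (s n) y = 0"
              unfolding k_def by (simp only: Bochner_Integration.integral_zero)
            then show ?case
              using False by simp
          qed
        qed
        then show "(\<lambda>n. U y * k (s n) y) \<longlonglongrightarrow> U y * (c0 * indicator Q y)"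
          by (intro tendsto_mult tendsto_const tendsto_eventually)
      qed
      show "(\<lambda>y. U y * k (s n) y) \<in> borel_measurable lborel" for n
        unfolding k_def \<rho>_def by measurable
    qed (use Uint in auto)
    moreover have "(\<lambda>n. \<integral>x. indicator Q x * F x (s n) \<partial>lborel) \<longlonglongrightarrow> (\<integral>x. indicator Q x * limit_value x \<partial>lborel)"
    proof (rule LIM_zero_cancel, rule Lim_null_comparison)
      have "(\<lambda>n. s n powr \<alpha>) \<longlonglongrightarrow> 0"
        using \<alpha>_pos tendsto_powr2[OF s0 tendsto_const, of \<alpha>] less_imp_le[OF s(1)] by simp
      then show "(\<lambda>n. 2 * M / \<alpha> * measure lborel Q * s n powr \<alpha>) \<longlonglongrightarrow> 0"
        by (rule tendsto_mult_right_zero)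
      show "\<forall>\<^sub>F n in sequentially. norm ((\<integral>x. indicator Q x * F x (s n) \<partial>lborel) - (\<integral>x. indicator Q x * limit_value x \<partial>lborel))
          \<le> 2 * M / \<alpha> * measure lborel Q * s n powr \<alpha>"
      proof (intro always_eventually allI)
        fix n
        let ?d = "\<lambda>x. indicator Q x * F x (s n) - indicator Q x * limit_value x"
        have i: "integrable lborel ?d"
          using int_F[OF s(1,2)] int_v[OF Q] by (simp add: Q_def)
        have le: "\<bar>?d x\<bar> \<le> 2 * M / \<alpha> * s n powr \<alpha> * indicator Q x" for x
        proof (cases "x \<in> Q")
          case True
          then have "cball x (2 * s n) \<subseteq> \<Omega>"
            using cballC[OF _ s(3)] Q C\<Omega> unfolding Q_def by blast
          from limit_value_bound[OF s(1) this] True show ?thesis by simp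
        qed simp
        have "\<bar>\<integral>x. ?d x \<partial>lborel\<bar> \<le> (\<integral>x. \<bar>?d x\<bar> \<partial>lborel)"
          by (rule integral_abs_bound)
        also have "\<dots> \<le> (\<integral>x. 2 * M / \<alpha> * s n powr \<alpha> * indicator Q x \<partial>lborel)"
          using i le emeasure_lborel_box_finite[of a' b'] by (intro integral_mono) (auto simp: Q_def)
        also have "\<dots> = 2 * M / \<alpha> * measure lborel Q * s n powr \<alpha>"
          by (simp add: Q_def)
        finally show "norm ((\<integral>x. indicator Q x * F x (s n) \<partial>lborel) - (\<integral>x. indicator Q x * limit_value x \<partial>lborel))
          \<le> 2 * M / \<alpha> * measure lborel Q * s n powr \<alpha>"
          using int_F[OF s(1,2)] int_v[OF Q] by (simp add: Q_def)
      qed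
    qed
    ultimately have "(\<integral>x. indicator Q x * limit_value x \<partial>lborel) = (\<integral>y. U y * (c0 * indicator Q y) \<partial>lborel)"
      unfolding fubini[OF s(1,2)] using LIMSEQ_unique by blast
    also have "\<dots> = c0 * (\<integral>y. indicator Q y * U y \<partial>lborel)"
      by (simp add: mult_ac flip: Bochner_Integration.integral_mult_right_zero)
    finally show ?thesis by (simp add: Q_def)
  qed
  \<comment> \<open>Restricting to \<open>box a b\<close> is harmless because an intersection of two
    boxes is a box: the identity for sub-boxes makes the integral of \<open>g\<close> vanish over
    every box.\<close>
  define g where "g = (\<lambda>x. indicator (box a b) x * limit_value x - c0 * (indicator (box a b) x * U x))"
  have intU: "integrable lborel (\<lambda>x. indicator (box a' b') x * U x)" for a' b'
    using integrable_mult_indicator[OF _ Uint, of "box a' b'"] by simp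
  have "AE x in lborel. g x = 0"
  proof (rule AE_eq_0_if_box_integrals_0)
    show "integrable lborel g"
      unfolding g_def using int_v[OF box_subset_cbox] intU by simp
    show "(\<integral>x\<in>box a' b'. g x \<partial>lborel) = 0" for a' b'
    proof -
      obtain a'' b'' where Q: "box a' b' \<inter> box a b = box a'' b''"
        using box_Int_box[of a' b' a b] by blast
      then have sub: "box a'' b'' \<subseteq> cbox a b"
        using box_subset_cbox[of a b] by blast
      have "indicator (box a' b') x *\<^sub>R g x = indicator (box a'' b'') x * limit_value x - c0 * (indicator (box a'' b'') x * U x)" for x
        unfolding g_def Q[symmetric] by (auto simp: indicator_def)
      then have "(\<integral>x\<in>box a' b'. g x \<partial>lborel) = (\<integral>x. indicator (box a'' b'') x * limit_value x \<partial>lborel) - c0 * (\<integral>x. indicator (box a'' b'') x * U x \<partial>lborel)"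
        using int_v[OF sub] intU by (simp add: set_lebesgue_integral_def)
      then show ?thesis using box_eq[OF sub] by simp
    qed
  qed
  then have "AE x in lebesgue. g x = 0"
    by (rule AE_completion)
  with UAE' show ?thesis
  proof eventually_elim
    case (elim x)
    show ?case
    proof
      assume x: "x \<in> box a b"
      then have "x \<in> C"
        using \<epsilon>(1) box_subset_cbox[of a b] by (force simp: C_def)
      then show "limit_value x = bump_mass TYPE('a) * u x"
        using elim x by (simp add: g_def c0_def)
    qed
  qed
qed

text \<open>By the Lindeloef property countably many of the admissible boxes cover \<Omega>, so
  their exceptional null sets can be united.\<close>

lemma limit_value_AE:
  assumes "continuous_on \<Omega> limit_value"
  shows "AE x in lebesgue_on \<Omega>. limit_value x = bump_mass TYPE('a) * u x"
proof -
  define B where "B = {box a b |a b. cbox a b \<subseteq> \<Omega>}"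
  obtain D where D: "D \<subseteq> B" "countable D" "\<Union>D = \<Union>B"
    by (rule Lindelof[of B]) (auto simp: B_def)
  have "\<Omega> \<subseteq> \<Union>B"
  proof
    fix x assume "x \<in> \<Omega>"
    then obtain a b where "cbox a b \<subseteq> \<Omega>" "x \<in> box a b"
      using open_contains_cbox[OF open_\<Omega>] by metis
    then show "x \<in> \<Union>B" by (auto simp: B_def)
  qed
  have "AE x in lebesgue. \<forall>X\<in>D. x \<in> X \<longrightarrow> limit_value x = bump_mass TYPE('a) * u x"
    unfolding AE_ball_countable[OF D(2)]
  proof
    fix X assume "X \<in> D"
    then obtain a b where X: "X = box a b" "cbox a b \<subseteq> \<Omega>"
      using D(1) unfolding B_def by blast
    show "AE x in lebesgue. x \<in> X \<longrightarrow> limit_value x = bump_mass TYPE('a) * u x"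
      unfolding X(1) by (rule limit_value_AE_on_box[OF assms X(2)])
  qed
  then have "AE x in lebesgue. x \<in> \<Omega> \<longrightarrow> limit_value x = bump_mass TYPE('a) * u x"
  proof eventually_elim
    case (elim x)
    show ?case
    proof
      assume "x \<in> \<Omega>"
      then have "x \<in> \<Union>D"
        using \<open>\<Omega> \<subseteq> \<Union>B\<close> unfolding D(3) by (rule subsetD[rotated])
      then obtain X where "X \<in> D" "x \<in> X" by (rule UnionE)
      then show "limit_value x = bump_mass TYPE('a) * u x" using elim by blast
    qed
  qed
  then show ?thesis
    using open_\<Omega> by (subst AE_restrict_space_iff) auto
qed

end

section \<open>Hoelder continuity up to the boundary\<close>

text \<open>The first claim makes \<open>limit_value\<close> continuous, which its identification
  with \<open>u\<close> presupposes. The second passes the inequality to the closure by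
  approximating both points from \<Omega>.\<close>

lemma hoelder_extension_to_closure:
  fixes w :: "'a::metric_space \<Rightarrow> real"
  assumes "0 < \<alpha>" "0 \<le> K" and w: "\<And>x y. x \<in> \<Omega> \<Longrightarrow> y \<in> \<Omega> \<Longrightarrow> \<bar>w x - w y\<bar> \<le> K * dist x y powr \<alpha>"
  shows "uniformly_continuous_on \<Omega> w"
    and "\<exists>v. continuous_on (closure \<Omega>) v \<and> (\<forall>x\<in>\<Omega>. v x = w x) \<and>
      (\<forall>x\<in>closure \<Omega>. \<forall>y\<in>closure \<Omega>. \<bar>v x - v y\<bar> \<le> K * dist x y powr \<alpha>)"
proof -
  show unif: "uniformly_continuous_on \<Omega> w"
    unfolding uniformly_continuous_on_def
  proof (intro allI impI)
    fix e :: real assume e: "0 < e"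
    \<comment> \<open>Solves \<delta>^\<alpha> = e / (K + 1); K + 1 in place of K gives a strict
      inequality and admits K = 0.\<close>
    define \<delta> where "\<delta> = (e / (K + 1)) powr (1 / \<alpha>)"
    have ek: "0 < e / (K + 1)" using e assms(2) by simp
    have "dist (w x') (w x) < e" if "x \<in> \<Omega>" "x' \<in> \<Omega>" "dist x' x < \<delta>" for x x'
    proof -
      have "dist x' x powr \<alpha> \<le> \<delta> powr \<alpha>"
        using that(3) assms(1) by (intro powr_mono2) auto
      also have "\<dots> = e / (K + 1)"
        using e assms(1,2) unfolding \<delta>_def powr_powr by simp
      finally have "K * dist x' x powr \<alpha> \<le> K * (e / (K + 1))"
        using assms(2) by (rule mult_left_mono)
      also have "\<dots> < e"
        using e assms(2) by (simp add: field_simps)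
      finally show ?thesis
        using w[OF that(2,1)] by (simp add: dist_real_def)
    qed
    moreover have "0 < \<delta>" using e assms(2) by (simp add: \<delta>_def)
    ultimately show "\<exists>d>0. \<forall>x\<in>\<Omega>. \<forall>x'\<in>\<Omega>. dist x' x < d \<longrightarrow> dist (w x') (w x) < e"
      by blast
  qed
  obtain v where v: "uniformly_continuous_on (closure \<Omega>) v" "\<And>x. x \<in> \<Omega> \<Longrightarrow> w x = v x"
    using uniformly_continuous_on_extension_on_closure[OF unif] by metis
  have cont: "continuous_on (closure \<Omega>) v"
    using v(1) by (rule uniformly_continuous_imp_continuous)
  have "\<bar>v x - v y\<bar> \<le> K * dist x y powr \<alpha>" if xy: "x \<in> closure \<Omega>" "y \<in> closure \<Omega>" for x y
  proof -
    obtain X Y where X: "\<And>n. X n \<in> \<Omega>" "X \<longlonglongrightarrow> x" and Y: "\<And>n. Y n \<in> \<Omega>" "Y \<longlonglongrightarrow> y"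
      using xy unfolding closure_sequential by blast
    have lim: "(\<lambda>n. v (Z n)) \<longlonglongrightarrow> v z" if "\<And>n. Z n \<in> \<Omega>" "Z \<longlonglongrightarrow> z" "z \<in> closure \<Omega>" for Z z
      by (rule continuous_on_tendsto_compose[OF cont that(2,3)])
        (use that(1) closure_subset in \<open>auto intro!: always_eventually\<close>)
    show ?thesis
    proof (rule LIMSEQ_le)
      show "(\<lambda>n. \<bar>v (X n) - v (Y n)\<bar>) \<longlonglongrightarrow> \<bar>v x - v y\<bar>"
        by (intro tendsto_rabs tendsto_diff lim X Y xy)
      have "(\<lambda>n. dist (X n) (Y n) powr \<alpha>) \<longlonglongrightarrow> dist x y powr \<alpha>"
        using assms(1) by (intro tendsto_powr2 tendsto_dist X Y tendsto_const) auto
      then show "(\<lambda>n. K * dist (X n) (Y n) powr \<alpha>) \<longlonglongrightarrow> K * dist x y powr \<alpha>"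
        by (intro tendsto_mult tendsto_const)
      show "\<exists>N. \<forall>n\<ge>N. \<bar>v (X n) - v (Y n)\<bar> \<le> K * dist (X n) (Y n) powr \<alpha>"
        using w[OF X(1) Y(1)] by (simp add: v(2)[OF X(1)] v(2)[OF Y(1)])
    qed
  qed
  then show "\<exists>v. continuous_on (closure \<Omega>) v \<and> (\<forall>x\<in>\<Omega>. v x = w x) \<and>
      (\<forall>x\<in>closure \<Omega>. \<forall>y\<in>closure \<Omega>. \<bar>v x - v y\<bar> \<le> K * dist x y powr \<alpha>)"
    using cont v(2) by (intro exI[of _ v]) auto
qed

text \<open>Dividing \<open>limit_value\<close> by \<open>bump_mass\<close> corrects for the
  unnormalised kernel, both in the almost everywhere identity and in the constant.\<close>

lemma morrey_gradient_hoelder: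
  fixes \<Omega> :: "'a::euclidean_space set"
  assumes "open \<Omega>" "bounded \<Omega>" "connected \<Omega>" "lipschitz_boundary \<Omega>" "0 < \<alpha>"
  shows "\<exists>K\<ge>0. \<forall>u Du. morrey_gradient \<Omega> u Du M \<alpha> \<longrightarrow>
    (\<exists>v. continuous_on (closure \<Omega>) v \<and> (AE x in lebesgue_on \<Omega>. v x = u x) \<and>
      (\<forall>x\<in>closure \<Omega>. \<forall>y\<in>closure \<Omega>. \<bar>v x - v y\<bar> \<le> K * dist x y powr \<alpha>))"
proof -
  obtain K where K: "0 \<le> K" "\<And>u Du x y. morrey_gradient \<Omega> u Du M \<alpha> \<Longrightarrow> x \<in> \<Omega> \<Longrightarrow> y \<in> \<Omega> \<Longrightarrow>
    \<bar>morrey_gradient.limit_value \<Omega> u M \<alpha> x - morrey_gradient.limit_value \<Omega> u M \<alpha> y\<bar> \<le> K * dist x y powr \<alpha>"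
    using limit_value_hoelder[OF assms, of M] by blast
  define c where "c = bump_mass TYPE('a)"
  have c: "0 < c" by (simp add: c_def bump_mass_pos)
  have "\<exists>v. continuous_on (closure \<Omega>) v \<and> (AE x in lebesgue_on \<Omega>. v x = u x) \<and>
      (\<forall>x\<in>closure \<Omega>. \<forall>y\<in>closure \<Omega>. \<bar>v x - v y\<bar> \<le> K / c * dist x y powr \<alpha>)"
    if u: "morrey_gradient \<Omega> u Du M \<alpha>" for u Du
  proof -
    interpret morrey_gradient \<Omega> u Du M \<alpha> by (rule u)
    have "continuous_on \<Omega> limit_value"
      using hoelder_extension_to_closure(1)[OF assms(5) K(1) K(2)[OF u]]
      by (rule uniformly_continuous_imp_continuous)
    from limit_value_AE[OF this] have ae: "AE x in lebesgue_on \<Omega>. limit_value x / c = u x"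
      by eventually_elim (use c in \<open>simp add: c_def\<close>)
    have "\<bar>limit_value x / c - limit_value y / c\<bar> \<le> K / c * dist x y powr \<alpha>" if "x \<in> \<Omega>" "y \<in> \<Omega>" for x y
    proof -
      have "\<bar>limit_value x / c - limit_value y / c\<bar> = \<bar>limit_value x - limit_value y\<bar> / c"
        using c by (simp add: abs_divide flip: diff_divide_distrib)
      also have "\<dots> \<le> K * dist x y powr \<alpha> / c"
        using K(2)[OF u that] c by (intro divide_right_mono) auto
      finally show ?thesis by simp
    qed
    moreover have "0 \<le> K / c" using K(1) c by simp
    ultimately obtain v where v: "continuous_on (closure \<Omega>) v" "\<forall>x\<in>\<Omega>. v x = limit_value x / c"
      "\<forall>x\<in>closure \<Omega>. \<forall>y\<in>closure \<Omega>. \<bar>v x - v y\<bar> \<le> K / c * dist x y powr \<alpha>"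
      using hoelder_extension_to_closure(2)[OF assms(5), of "K / c" \<Omega> "\<lambda>x. limit_value x / c"] by blast
    have "AE x in lebesgue_on \<Omega>. x \<in> \<Omega>"
      using AE_space[of "lebesgue_on \<Omega>"] by simp
    with ae have "AE x in lebesgue_on \<Omega>. v x = u x"
      by eventually_elim (use v(2) in auto)
    with v show ?thesis by blast
  qed
  then show ?thesis
    using K(1) c by (intro exI[of _ "K / c"]) auto
qed

lemma integral_powr_eq_Lp_norm:
  "0 < q \<Longrightarrow> (\<integral>x. norm (f x) powr q \<partial>lebesgue_on \<Omega>) = Lp_norm q \<Omega> f powr q"
  by (simp add: Lp_norm_def powr_powr)

theorem theorem1p1:
  fixes \<Omega> :: "(real ^ 'n) set" and p q \<beta> :: real
  assumes "open \<Omega>" and "bounded \<Omega>" and "connected \<Omega>"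
    and "lipschitz_boundary \<Omega>" and "uniform_interior_sphere \<Omega>"
    and "\<beta> > 0" and "p > 2" and "q \<ge> 1" and "q > real CARD('n) / p"
  shows "\<exists>K :: real \<Rightarrow> real \<Rightarrow> real.
    \<forall>(a :: real ^ 'n \<Rightarrow> real \<Rightarrow> real ^ 'n \<Rightarrow> real ^ 'n) (l :: real) (f :: real ^ 'n \<Rightarrow> real)
      (u :: real ^ 'n \<Rightarrow> real) (Du :: real ^ 'n \<Rightarrow> real ^ 'n).
      caratheodory \<Omega> a \<longrightarrow>
      (AE x in lebesgue_on \<Omega>. \<forall>s \<xi>. norm (a x s \<xi>) \<le> \<beta> * (1 + norm \<xi>)) \<longrightarrow>
      l \<ge> 0 \<longrightarrow>
      f \<in> Lp q \<Omega> \<longrightarrow>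
      W1p_loc p \<Omega> u Du \<longrightarrow>
      (\<lambda>x. l * max (- u x) 0) \<in> Lp q \<Omega> \<longrightarrow>
      distributional_ineq \<Omega> a l p f u Du \<longrightarrow>
      (\<exists>v :: real ^ 'n \<Rightarrow> real.
        continuous_on (closure \<Omega>) v \<and>
        (AE x in lebesgue_on \<Omega>. v x = u x) \<and>
        (\<forall>x \<in> closure \<Omega>. \<forall>y \<in> closure \<Omega>.
          \<bar>v x - v y\<bar> \<le> K (Lp_norm q \<Omega> f) (Lp_norm q \<Omega> (\<lambda>x. l * max (- u x) 0))
            * norm (x - y) powr min (1 - real CARD('n) / (p * q)) (1 - 1 / (p - 1))))"
proof -
  define \<alpha> where "\<alpha> = min (1 - real CARD('n) / (p * q)) (1 - 1 / (p - 1))"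
  \<comment> \<open>The conditions q > N / p and p > 2 are exactly the positivity of the two terms
    of the minimum.\<close>
  have \<alpha>: "0 < \<alpha>"
    using assms(7-9) by (simp add: \<alpha>_def field_simps)
  \<comment> \<open>The two norms are frozen at values \<open>A\<close> and \<open>B\<close>, so a
    constant valid for all such data depends on nothing else about them.\<close>
  define hyp where "hyp A B a l f u Du \<longleftrightarrow>
      (AE x in lebesgue_on \<Omega>. \<forall>s \<xi>. norm (a x s \<xi>) \<le> \<beta> * (1 + norm \<xi>)) \<and> 0 \<le> l \<and>
      f \<in> Lp q \<Omega> \<and> Lp_norm q \<Omega> f = A \<and> W1p_loc p \<Omega> u Du \<and>
      (\<lambda>x. l * max (- u x) 0) \<in> Lp q \<Omega> \<and> Lp_norm q \<Omega> (\<lambda>x. l * max (- u x) 0) = B \<and>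
      distributional_ineq \<Omega> a l p f u Du"
    for A B and a :: "real ^ 'n \<Rightarrow> real \<Rightarrow> real ^ 'n \<Rightarrow> real ^ 'n" and l f u Du
  define concl where "concl K u \<longleftrightarrow> (\<exists>v. continuous_on (closure \<Omega>) v \<and> (AE x in lebesgue_on \<Omega>. v x = u x) \<and>
      (\<forall>x\<in>closure \<Omega>. \<forall>y\<in>closure \<Omega>. \<bar>v x - v y\<bar> \<le> K * dist x y powr \<alpha>))" for K and u :: "real ^ 'n \<Rightarrow> real"
  have "\<exists>K. \<forall>a l f u Du. hyp A B a l f u Du \<longrightarrow> concl K u" for A B
  proof -
    obtain M where M: "0 \<le> M" and mean: "\<forall>a l f u Du x t.
      (AE y in lebesgue_on \<Omega>. \<forall>s \<xi>. norm (a y s \<xi>) \<le> \<beta> * (1 + norm \<xi>)) \<longrightarrow> 0 \<le> l \<longrightarrow>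
      f \<in> Lp q \<Omega> \<longrightarrow> (\<integral>y. \<bar>f y\<bar> powr q \<partial>lebesgue_on \<Omega>) \<le> A powr q \<longrightarrow>
      (\<lambda>y. l * max (- u y) 0) \<in> Lp q \<Omega> \<longrightarrow> (\<integral>y. \<bar>l * max (- u y) 0\<bar> powr q \<partial>lebesgue_on \<Omega>) \<le> B powr q \<longrightarrow>
      Du \<in> Lp_loc p \<Omega> \<longrightarrow> distributional_ineq \<Omega> a l p f u Du \<longrightarrow>
      0 < t \<longrightarrow> cball x (2 * t) \<subseteq> \<Omega> \<longrightarrow>
      (\<integral>y. norm (Du y) \<partial>lebesgue_on (cball x t)) \<le> M * t powr (real DIM(real ^ 'n) - 1 + \<alpha>)"
      using gradient_mean_bound[OF assms(1,2,7,8) less_imp_le[OF assms(6)], of "A powr q" "B powr q"]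
      unfolding \<alpha>_def by auto
    obtain K where K: "\<And>u Du. morrey_gradient \<Omega> u Du M \<alpha> \<Longrightarrow> concl K u"
      using morrey_gradient_hoelder[OF assms(1-4) \<alpha>, of M] unfolding concl_def by blast
    have "concl K u" if h: "hyp A B a l f u Du" for a l f u Du
    proof (rule K)
      show "morrey_gradient \<Omega> u Du M \<alpha>"
      proof
        show "has_weak_gradient \<Omega> u Du"
          using h by (simp add: hyp_def W1p_loc_def)
        show "(\<integral>y. norm (Du y) \<partial>lebesgue_on (cball x t)) \<le> M * t powr (real DIM(real ^ 'n) - 1 + \<alpha>)"
          if "0 < t" "cball x (2 * t) \<subseteq> \<Omega>" for x t
        proof (rule mean[rule_format, where a = a and l = l and f = f and u = u])
          show "(\<integral>y. \<bar>f y\<bar> powr q \<partial>lebesgue_on \<Omega>) \<le> A powr q"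
            "(\<integral>y. \<bar>l * max (- u y) 0\<bar> powr q \<partial>lebesgue_on \<Omega>) \<le> B powr q"
            using h assms(8) integral_powr_eq_Lp_norm[of q \<Omega> f]
              integral_powr_eq_Lp_norm[of q \<Omega> "\<lambda>y. l * max (- u y) 0"]
            by (simp_all add: hyp_def)
        qed (use h that in \<open>simp_all add: hyp_def W1p_loc_def\<close>)
      qed (use assms(1) \<alpha> M in auto)
    qed
    then show ?thesis by blast
  qed
  \<comment> \<open>Choice over all pairs of norm values turns the separate constants into the
    function of two real arguments that is asked for.\<close>
  then obtain K where K: "\<And>A B a l f u Du. hyp A B a l f u Du \<Longrightarrow> concl (K A B) u"
    by metis
  show ?thesis
  proof (intro exI[of _ K] allI impI)
    fix a :: "real ^ 'n \<Rightarrow> real \<Rightarrow> real ^ 'n \<Rightarrow> real ^ 'n" and l f u Du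
    assume "AE x in lebesgue_on \<Omega>. \<forall>s \<xi>. norm (a x s \<xi>) \<le> \<beta> * (1 + norm \<xi>)" "0 \<le> l" "f \<in> Lp q \<Omega>"
      "W1p_loc p \<Omega> u Du" "(\<lambda>x. l * max (- u x) 0) \<in> Lp q \<Omega>" "distributional_ineq \<Omega> a l p f u Du"
    then have "concl (K (Lp_norm q \<Omega> f) (Lp_norm q \<Omega> (\<lambda>x. l * max (- u x) 0))) u"
      by (intro K[of _ _ a l f u Du]) (simp add: hyp_def)
    then show "\<exists>v. continuous_on (closure \<Omega>) v \<and>
        (AE x in lebesgue_on \<Omega>. v x = u x) \<and>
        (\<forall>x \<in> closure \<Omega>. \<forall>y \<in> closure \<Omega>.
          \<bar>v x - v y\<bar> \<le> K (Lp_norm q \<Omega> f) (Lp_norm q \<Omega> (\<lambda>x. l * max (- u x) 0))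
            * norm (x - y) powr min (1 - real CARD('n) / (p * q)) (1 - 1 / (p - 1)))"
      unfolding concl_def \<alpha>_def dist_norm .
  qed
qed

end
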